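(* The Thue--Morse sequence $\mathbf t$ has level of distribution $1$ with respect to $\mathcal Q$ and $\mathcal R$ given by $\mathcal Q(d)=\mathcal R(d)=\mathbb Z/d\mathbb Z$ for all integers $d\ge 1$. More precisely, for every $\varepsilon>0$ there exist $\eta>0$ and $C>0$ (depending only on $\varepsilon$) such that for all real $x\ge 1$, with $D=x^{1-\varepsilon}$, \[ \sum_{1\leq d\leq D}\; \max_{0\leq y\leq x}\; \max_{0\leq a<d} \Biggl\lvert \sum_{\substack{0\leq n<y\\ n\equiv a\bmod d}} (-1)^{s(n)} \Biggr\rvert \leq C x^{1-\eta}, \] where $d,a,n$ run over integers and $y$ over real numbers.
   Context: For a nonnegative integer $n$, $s(n)$ denotes the binary sum-of-digits function, i.e. the number of $1$s in the binary expansion of $n$. The Thue--Morse sequence $\mathbf t=(\mathbf t(n))_{n\ge 0}$ takes the values $0$ and $1$, with $\mathbf t(n)=0$ if and only if $s(n)\equiv 0\bmod 2$. Level of distribution: Let $c=(c_n)_{n\geq 0}$ be a sequence of complex numbers, and for each integer $d\geq 1$ let $\mathcal Q(d)$ and $\mathcal R(d)\neq\emptyset$ be subsets of $\mathbb Z/d\mathbb Z$ such that $\mathcal Q(d)\subseteq \mathcal R(d)$. The sequence $c$ has level of distribution $\theta$ with respect to $\mathcal Q$ and $\mathcal R$ if for all $\varepsilon>0$ and $A>0$ there is a constant $C'$ (which may depend on $A$ and $\varepsilon$) such that for all $x\geq 1$ \[ \sum_{1\leq d\leq x^{\theta-\varepsilon}} \max_{0\leq y\leq x} \max_{\substack{0\leq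 a<d\\ a+d\mathbb Z\in \mathcal Q(d)}} \Biggl\lvert \sum_{\substack{0\leq n<y\\ n\equiv a \bmod d}}c_n -\frac 1{\lvert \mathcal R(d)\rvert} \sum_{\substack{0\leq n<y\\ n+d\mathbb Z\in \mathcal R(d)}}c_n \Biggr\rvert \leq C'\Biggl(\sum_{0\leq n<x}\lvert c_n\rvert\Biggr)(\log 2x)^{-A}. \] The maximum over the empty index set is defined as $0$. For the Thue--Morse sequence one takes $c_n=\mathbf t(n)\in\{0,1\}$. *)

theory Defs
  imports Complex_Main "HOL-Number_Theory.Cong"
begin

definition binary_digit_sum :: "nat \<Rightarrow> nat" where
  "binary_digit_sum n = card {i. bit n i}"

definition thue_morse :: "nat \<Rightarrow> nat" where
  "thue_morse n = (if [binary_digit_sum n = 0] (mod 2) then 0 else 1)"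

text \<open>A maximum over an empty index set is 0.\<close>

definition max_over :: "'a set \<Rightarrow> ('a \<Rightarrow> real) \<Rightarrow> real" where
  "max_over I f = (if I = {} then 0 else Max (f ` I))"

text \<open>
  A subset of \<open>\<int>/d\<int>\<close> is represented by the set of the least nonnegative residues of its
  elements, a subset of \<open>{..<d}\<close>; thus \<open>n + d\<int> \<in> R d\<close> becomes \<open>n mod d \<in> R d\<close>.
  The variable \<open>y\<close> is real and ranges over an infinite set, but the inner expression takes only
  finitely many values (see \<open>finite_image_partial_sums\<close>), so the maximum exists.
\<close>

definition level_of_distribution ::
  "(nat \<Rightarrow> complex) \<Rightarrow> real \<Rightarrow> (nat \<Rightarrow> nat set) \<Rightarrow> (nat \<Rightarrow> nat set) \<Rightarrow> bool" where
  "level_of_distribution c \<theta> Q R \<longleftrightarrow>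
     (\<forall>d\<ge>1. R d \<noteq> {} \<and> Q d \<subseteq> R d \<and> R d \<subseteq> {..<d}) \<and>
     (\<forall>\<epsilon>>0. \<forall>A>0. \<exists>C'. \<forall>x::real. x \<ge> 1 \<longrightarrow>
        (\<Sum>d | 1 \<le> d \<and> real d \<le> x powr (\<theta> - \<epsilon>).
           max_over {0..x} (\<lambda>y.
             max_over {a. a < d \<and> a \<in> Q d} (\<lambda>a.
               norm ((\<Sum>n | real n < y \<and> [n = a] (mod d). c n)
                     - 1 / of_nat (card (R d)) * (\<Sum>n | real n < y \<and> n mod d \<in> R d. c n)))))
        \<le> C' * (\<Sum>n | real n < x. norm (c n)) * ln (2 * x) powr (- A))"

lemma finite_image_partial_sums:
  fixes F :: "nat set \<Rightarrow> 'b"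
  shows "finite ((\<lambda>y::real. F {n. real n < y}) ` {0..x})"
proof -
  have "{n. real n < y} = {..<nat \<lceil>y\<rceil>}" for y :: real
    by (auto simp: less_ceiling_iff zless_nat_eq_int_zless)
  moreover have "nat \<lceil>y\<rceil> \<le> nat \<lceil>x\<rceil>" if "y \<in> {0..x}" for y :: real
    using that by (intro nat_mono ceiling_mono) simp
  ultimately have "(\<lambda>y::real. F {n. real n < y}) ` {0..x} \<subseteq> (\<lambda>k. F {..<k}) ` {..nat \<lceil>x\<rceil>}"
    by auto
  then show ?thesis
    by (rule finite_subset) auto
qed

end

theory Submission
  imports Defs "HOL-Analysis.Kronecker_Approximation_Theorem"
begin

text \<open>
  Write \<open>t(n) = (-1)^s(n)\<close>. The moduli are split into dyadic blocks \<open>2 ^ \<Lambda> \<le> d < 2 ^ (\<Lambda> + 1)\<close>, and with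
  \<open>n = j * d + a\<close> the inner sum becomes a sum of \<open>t(j * d + a)\<close> over an initial segment of the \<open>j < N\<close>, where
  \<open>N\<close> is about \<open>x / 2 ^ \<Lambda>\<close> and thus at least a fixed power of \<open>x\<close>. One has to save a power of \<open>x\<close> on average over
  \<open>d\<close>, uniformly in \<open>a\<close> and the length of the sum, although \<open>N\<close> may be much smaller than \<open>d\<close>.

  \<^bold>\<open>Removing digits.\<close> The van der Corput inequality with step \<open>K\<close> replaces \<open>t(u)\<close> by the products
  \<open>t(u + K * r * d) * t(u + K * r' * d)\<close>. If \<open>K * d\<close> is close to a multiple of \<open>2 ^ L\<close>, then both arguments agree
  in the digits just below position \<open>L\<close>, except for rare carries, so that these digits drop out of the
  product. Dirichlet's theorem provides such \<open>K\<close> of size a small power of \<open>N\<close>, and a bounded number of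
  steps removes all digits except a window of the lowest ones, whose length is a small multiple of
  \<open>log 2 x\<close> (\<open>iterated_van_der_Corput\<close>, \<open>sum_truncate\<close>).

  \<^bold>\<open>Cube averages.\<close> What remains is an average, over all shifts \<open>r\<close>, of a product of truncated signs over
  the vertices of a cube, as in the Gowers norms. When the exact power of two in every \<open>K * d\<close> is under
  control, the shifts are uniformly distributed modulo powers of two. The average is then evaluated in
  blocks of digits: in each block, if two base points show a certain pattern of digits, two choices of
  the digits of the shifts lead to the same carries and to opposite signs. Random base points show the
  pattern with positive probability in each block, independently, which gives exponential decay in the
  number of blocks (\<open>signed_average_decay\<close>, \<open>mean_cube_decay\<close>).

  \<^bold>\<open>Averaging over the moduli.\<close> Both the rarity of carries and the control of powers of two may fail
  for special \<open>d\<close>. Counting the \<open>d\<close> for which \<open>q * d\<close> is close to a multiple of a power of two shows that this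
  is negligible on average (\<open>sum_card_near\<close>, \<open>card_resonant\<close>); the result is \<open>dyadic_estimate\<close>. Moduli below
  a small power of \<open>x\<close> do not form large enough blocks for such an averaging, but for them two simple van
  der Corput steps are sufficient (\<open>small_modulus_estimate\<close>).

  Summation over the blocks yields the power saving (\<open>progression_max_sum_decay\<close>), and the statement on
  the level of distribution follows since the Thue--Morse sequence is \<open>(1 - t) / 2\<close>.
\<close>

section \<open>Averages over finite sets\<close>

definition mean :: "'a set \<Rightarrow> ('a \<Rightarrow> real) \<Rightarrow> real" where
  "mean A f = (\<Sum>x\<in>A. f x) / real (card A)"

lemma mean_mono: "(\<And>x. x \<in> A \<Longrightarrow> f x \<le> g x) \<Longrightarrow> mean A f \<le> mean A g"
  unfolding mean_def by (intro divide_right_mono sum_mono) auto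

lemma mean_cong: "(\<And>x. x \<in> A \<Longrightarrow> f x = g x) \<Longrightarrow> mean A f = mean A g"
  unfolding mean_def by (metis (mono_tags, lifting) sum.cong)

lemma mean_const: "finite A \<Longrightarrow> A \<noteq> {} \<Longrightarrow> mean A (\<lambda>_. c) = c"
  unfolding mean_def by simp

lemma mean_add: "mean A (\<lambda>x. f x + g x) = mean A f + mean A g"
  unfolding mean_def by (simp add: sum.distrib add_divide_distrib)

lemma mean_cmult: "mean A (\<lambda>x. c * f x) = c * mean A f"
  unfolding mean_def by (simp add: sum_distrib_left)

lemma abs_mean_le: "\<bar>mean A f\<bar> \<le> mean A (\<lambda>x. \<bar>f x\<bar>)"
  unfolding mean_def by (simp add: abs_divide divide_right_mono)

lemma mean_swap: "mean A (\<lambda>a. mean B (f a)) = mean B (\<lambda>b. mean A (\<lambda>a. f a b))"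
proof -
  have "(\<Sum>a\<in>A. \<Sum>b\<in>B. f a b) = (\<Sum>b\<in>B. \<Sum>a\<in>A. f a b)" by (rule sum.swap)
  then show ?thesis
    unfolding mean_def by (simp flip: sum_divide_distrib add: mult.commute)
qed

lemma mean_Times: "mean (A \<times> B) f = mean A (\<lambda>a. mean B (\<lambda>b. f (a, b)))"
  unfolding mean_def
  by (simp add: sum.cartesian_product card_cartesian_product mult.commute flip: sum_divide_distrib)

lemma mean_reindex: "bij_betw g A B \<Longrightarrow> mean B f = mean A (\<lambda>x. f (g x))"
  unfolding mean_def by (simp add: bij_betw_same_card sum.reindex_bij_betw)

lemma mean_power2: "(mean A f)\<^sup>2 \<le> mean A (\<lambda>x. (f x)\<^sup>2)"
proof (cases "card A = 0")
  case True then show ?thesis by (simp add: mean_def)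
next
  case False
  have "(\<Sum>x\<in>A. f x)\<^sup>2 \<le> real (card A) * (\<Sum>x\<in>A. (f x)\<^sup>2)"
    using Cauchy_Schwarz_ineq_sum[of "\<lambda>_. 1" f A] by simp
  then show ?thesis using False
    unfolding mean_def by (simp add: power_divide power2_eq_square field_simps)
qed

text \<open>
  Jensen's inequality for the exponents \<open>2 ^ j\<close>. For \<open>j = 0\<close> it is an equality, so \<open>f\<close> may take
  negative values; this lets the iterated van der Corput inequality carry signed averages.
\<close>

lemma mean_power: "(mean A f) ^ (2 ^ j) \<le> mean A (\<lambda>x. (f x) ^ (2 ^ j))"
proof (induction j arbitrary: f)
  case 0 then show ?case by simp
next
  case (Suc j)
  have "(mean A f) ^ (2 ^ Suc j) = ((mean A f)\<^sup>2) ^ (2 ^ j)"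
    by (simp add: power_mult)
  also have "\<dots> \<le> (mean A (\<lambda>x. (f x)\<^sup>2)) ^ (2 ^ j)"
    by (intro power_mono mean_power2) auto
  also have "\<dots> \<le> mean A (\<lambda>x. ((f x)\<^sup>2) ^ (2 ^ j))" by (rule Suc.IH)
  finally show ?case by (simp add: power_mult)
qed

section \<open>Truncated Thue--Morse signs and products over cubes\<close>

text \<open>
  The sign \<open>(-1)^s\<close> of the number formed by the lowest \<open>L\<close> binary digits. Integers are read in two's
  complement, so this is a function of \<open>u mod 2 ^ L\<close> on all of \<open>\<int>\<close>.
\<close>

definition tm :: "nat \<Rightarrow> int \<Rightarrow> real" where
  "tm L u = (\<Prod>j<L. if bit u j then -1 else 1)"

lemma tm_0 [simp]: "tm 0 u = 1"
  by (simp add: tm_def)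

lemma tm_cases: "tm L u = 1 \<or> tm L u = -1"
  by (induction L) (auto simp: tm_def)

lemma abs_tm [simp]: "\<bar>tm L u\<bar> = 1"
  using tm_cases[of L u] by auto

lemma tm_square [simp]: "tm L u * tm L u = 1"
  using tm_cases[of L u] by auto

lemma bit_div_power: "bit (u div 2 ^ m) j = bit (u::int) (m + j)"
  by (metis bit_drop_bit_eq drop_bit_eq_div comp_apply)

lemma tm_add: "tm (m + L) u = tm m u * tm L (u div 2 ^ m)"
  by (induction L) (simp_all add: tm_def bit_div_power)

lemma tm_mod: "tm L (u mod 2 ^ L) = tm L u"
  unfolding tm_def by (intro prod.cong) (auto simp: bit_take_bit_iff simp flip: take_bit_eq_mod)

lemma tm_cong: "u mod 2 ^ L = u' mod 2 ^ L \<Longrightarrow> tm L u = tm L u'"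
  by (metis tm_mod)

lemma tm_periodic: "tm L (u + 2 ^ L * h) = tm L u"
  by (rule tm_cong) simp

lemma tm_digit_sum:
  assumes "n < 2 ^ L"
  shows "tm L (int n) = (-1) ^ binary_digit_sum n"
proof -
  have sub: "{i. bit n i} \<subseteq> {..<L}"
  proof
    fix i assume "i \<in> {i. bit n i}"
    then have "2 ^ i \<le> n"
      by (metis bit_iff_odd div_less even_zero linorder_not_le mem_Collect_eq)
    with assms have "(2::nat) ^ i < 2 ^ L" by linarith
    then show "i \<in> {..<L}" by simp
  qed
  have "tm L (int n) = (\<Prod>j<L. if bit n j then -1 else 1)"
    unfolding tm_def by (simp add: bit_of_nat_iff_bit)
  also have "\<dots> = (\<Prod>j\<in>{i. bit n i}. -1)"
    using sub by (intro prod.mono_neutral_cong_right) auto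
  finally show ?thesis by (simp add: binary_digit_sum_def)
qed

definition bools :: "nat \<Rightarrow> bool list set" where
  "bools k = {w. length w = k}"

lemma finite_bools [simp]: "finite (bools k)"
  using finite_lists_length_eq[of "UNIV :: bool set" k] by (simp add: bools_def)

lemma card_bools [simp]: "card (bools k) = 2 ^ k"
  using card_lists_length_eq[of "UNIV :: bool set" k] by (simp add: bools_def)

lemma bools_0 [simp]: "bools 0 = {[]}"
  by (auto simp: bools_def)

lemma bools_Suc: "bools (Suc k) = (Cons False ` bools k) \<union> (Cons True ` bools k)"
  by (auto simp: bools_def length_Suc_conv image_iff)

lemma prod_bools_Suc:
  "(\<Prod>w\<in>bools (Suc k). f w) = (\<Prod>w\<in>bools k. f (False # w)) * (\<Prod>w\<in>bools k. (f (True # w) :: real))"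
  unfolding bools_Suc by (subst prod.union_disjoint) (auto simp: prod.reindex)

fun vertex :: "bool list \<Rightarrow> (int \<times> int) list \<Rightarrow> int" where
  "vertex (b # w) (p # ss) = (if b then snd p else fst p) + vertex w ss"
| "vertex _ _ = 0"

text \<open>
  The product of \<open>F\<close> over the vertices of a discrete cube, as in a Gowers norm: coordinate \<open>i\<close> of a
  vertex chooses one of the two shifts in the \<open>i\<close>-th pair. Pairs of shifts, in place of one
  difference, keep the two copies produced by Cauchy--Schwarz symmetric and independent.
\<close>

definition cube :: "(int \<times> int) list \<Rightarrow> (int \<Rightarrow> real) \<Rightarrow> int \<Rightarrow> real" where
  "cube ss F u = (\<Prod>w\<in>bools (length ss). F (u + vertex w ss))"

lemma cube_Nil [simp]: "cube [] F u = F u"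
  by (simp add: cube_def)

lemma cube_Cons: "cube (p # ss) F u = cube ss F (u + fst p) * cube ss F (u + snd p)"
  by (simp add: cube_def prod_bools_Suc add.assoc)

lemma cube_Cons': "cube (p # ss) F u = cube ss (\<lambda>v. F (v + fst p) * F (v + snd p)) u"
  unfolding cube_Cons by (simp add: cube_def prod.distrib ac_simps)

lemma cube_mult: "cube ss (\<lambda>v. F v * G v) u = cube ss F u * cube ss G u"
  by (simp add: cube_def prod.distrib)

lemma abs_cube_tm [simp]: "\<bar>cube ss (tm L) u\<bar> = 1"
  unfolding cube_def abs_prod by simp

section \<open>The van der Corput inequality\<close>

lemma mean_sum: "(\<Sum>i\<in>I. mean A (f i)) = mean A (\<lambda>x. \<Sum>i\<in>I. f i x)"
proof -
  have "(\<Sum>i\<in>I. \<Sum>x\<in>A. f i x) = (\<Sum>x\<in>A. \<Sum>i\<in>I. f i x)" by (rule sum.swap)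
  then show ?thesis unfolding mean_def by (simp flip: sum_divide_distrib)
qed

abbreviation pairs :: "nat \<Rightarrow> (int \<times> int) set" where
  "pairs R \<equiv> {0..<int R} \<times> {0..<int R}"

fun tuples :: "nat list \<Rightarrow> (int \<times> int) list set" where
  "tuples [] = {[]}"
| "tuples (R # Rs) = (\<lambda>(p, ps). p # ps) ` (pairs R \<times> tuples Rs)"

lemma finite_tuples [simp]: "finite (tuples Rs)"
  by (induction Rs) auto

lemma tuples_nonempty: "(\<And>R. R \<in> set Rs \<Longrightarrow> R > 0) \<Longrightarrow> tuples Rs \<noteq> {}"
  by (induction Rs) auto

lemma length_tuples: "rs \<in> tuples Rs \<Longrightarrow> length rs = length Rs"
  by (induction Rs arbitrary: rs) auto

lemma nth_tuples: "rs \<in> tuples Rs \<Longrightarrow> i < length Rs \<Longrightarrow> rs ! i \<in> pairs (Rs ! i)"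
  by (induction Rs arbitrary: rs i) (auto simp: nth_Cons split: nat.splits)

lemma mean_tuples_Cons:
  "mean (tuples (R # Rs)) F = mean (pairs R) (\<lambda>p. mean (tuples Rs) (\<lambda>ps. F (p # ps)))"
proof -
  have "bij_betw (\<lambda>(p, ps). p # ps) (pairs R \<times> tuples Rs) (tuples (R # Rs))"
    unfolding tuples.simps by (rule inj_on_imp_bij_betw) (auto simp: inj_on_def)
  from mean_reindex[OF this, of F] show ?thesis by (simp add: mean_Times[of "pairs R"])
qed

definition dilate :: "int list \<Rightarrow> (int \<times> int) list \<Rightarrow> (int \<times> int) list" where
  "dilate Ks rs = map2 (\<lambda>K (r, r'). (K * r, K * r')) Ks rs"

lemma dilate_Nil [simp]: "dilate [] rs = []" "dilate Ks [] = []"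
  by (simp_all add: dilate_def)

lemma dilate_Cons [simp]: "dilate (K # Ks) (p # ps) = (K * fst p, K * snd p) # dilate Ks ps"
  by (simp add: dilate_def split_def)

lemma length_dilate [simp]: "length (dilate Ks rs) = min (length Ks) (length rs)"
  by (simp add: dilate_def)

lemma sum_shift_bound:
  fixes f :: "int \<Rightarrow> real"
  assumes "\<And>v. \<bar>f v\<bar> \<le> 1"
  shows "\<bar>(\<Sum>n<N. f (int n)) - (\<Sum>n<N. f (int n + int j))\<bar> \<le> 2 * real j"
proof (induction j)
  case 0 then show ?case by simp
next
  case (Suc j)
  have "(\<Sum>n<N. f (int n + int j)) - (\<Sum>n<N. f (int n + int (Suc j)))
      = (\<Sum>n<N. f (int n + int j) - f (int (Suc n) + int j))"
    by (simp add: sum_subtractf algebra_simps)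
  also have "\<dots> = f (int j) - f (int N + int j)"
    by (subst sum_lessThan_telescope') simp
  finally have "\<bar>(\<Sum>n<N. f (int n + int j)) - (\<Sum>n<N. f (int n + int (Suc j)))\<bar> \<le> 2"
    using assms[of "int j"] assms[of "int N + int j"] by linarith
  with Suc show ?case by simp
qed

text \<open>
  Shifting the summation range by \<open>K * r\<close> costs at most \<open>2 * K * R\<close>. After averaging over \<open>r < R\<close>,
  Cauchy--Schwarz in \<open>n\<close> and expanding the square produce the pairs of shifts. The sum is normalised by
  a fixed \<open>N\<close>, not by its own length, so that the bound is uniform over all shorter sums.
\<close>

lemma van_der_Corput:
  fixes f :: "int \<Rightarrow> real"
  assumes f: "\<And>v. \<bar>f v\<bar> \<le> 1" and "N' \<le> N" "N > 0" "K \<ge> 0" "R > 0"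
  shows "((\<Sum>n<N'. f (int n)) / real N)\<^sup>2
    \<le> mean (pairs R) (\<lambda>p. (\<Sum>n<N'. f (int n + K * fst p) * f (int n + K * snd p)) / real N)
      + 4 * real_of_int K * real R / real N"
proof -
  define S where "S = (\<Sum>n<N'. f (int n))"
  define A where "A = mean {0..<int R} (\<lambda>r. \<Sum>n<N'. f (int n + K * r))"
  define Q where "Q = (\<Sum>n<N'. (mean {0..<int R} (\<lambda>r. f (int n + K * r)))\<^sup>2)"
  have ne: "finite {0..<int R}" "{0..<int R} \<noteq> {}" using \<open>R > 0\<close> by auto
  have bound: "\<bar>\<Sum>n<N'. g n\<bar> \<le> real N'" if "\<And>n. \<bar>g n\<bar> \<le> 1" for g :: "nat \<Rightarrow> real"
  proof -
    have "\<bar>\<Sum>n<N'. g n\<bar> \<le> (\<Sum>n<N'. \<bar>g n\<bar>)" by (rule sum_abs)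
    also have "\<dots> \<le> (\<Sum>n<N'. 1)" by (rule sum_mono) (rule that)
    finally show ?thesis by simp
  qed
  have S: "\<bar>S\<bar> \<le> real N'" unfolding S_def by (rule bound) (rule f)
  have A: "\<bar>A\<bar> \<le> real N'"
  proof -
    have "\<bar>A\<bar> \<le> mean {0..<int R} (\<lambda>r. real N')"
      unfolding A_def by (rule order_trans[OF abs_mean_le]) (intro mean_mono bound f)
    then show ?thesis using mean_const[OF ne] by simp
  qed
  have diff: "\<bar>S - A\<bar> \<le> 2 * real_of_int K * real R"
  proof -
    have "S - A = mean {0..<int R} (\<lambda>r. S + (-1) * (\<Sum>n<N'. f (int n + K * r)))"
      unfolding mean_add mean_cmult A_def using mean_const[OF ne] by simp
    also have "\<bar>\<dots>\<bar> \<le> mean {0..<int R} (\<lambda>r. 2 * real_of_int K * real R)"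
    proof (rule order_trans[OF abs_mean_le], rule mean_mono)
      fix r assume r: "r \<in> {0..<int R}"
      define j where "j = nat (K * r)"
      have j: "int j = K * r" using r \<open>K \<ge> 0\<close> by (simp add: j_def)
      have "K * r \<le> K * int R" using r \<open>K \<ge> 0\<close> by (intro mult_left_mono) auto
      then have "real j \<le> real_of_int K * real R" using j
        by (metis of_int_le_iff of_int_mult of_int_of_nat_eq)
      then show "\<bar>S + (-1) * (\<Sum>n<N'. f (int n + K * r))\<bar> \<le> 2 * real_of_int K * real R"
        using sum_shift_bound[where f = f and N = N' and j = j, OF f] unfolding S_def j by simp
    qed
    finally show ?thesis using mean_const[OF ne] by simp
  qed
  have A2: "A\<^sup>2 \<le> real N' * Q"
  proof -
    have "A = (\<Sum>n<N'. mean {0..<int R} (\<lambda>r. f (int n + K * r)))"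
      unfolding A_def by (rule mean_sum[symmetric])
    then show ?thesis
      using mean_power2[of "{..<N'}" "\<lambda>n. mean {0..<int R} (\<lambda>r. f (int n + K * r))"]
      unfolding Q_def mean_def[of "{..<N'}"]
      by (cases "N' = 0") (auto simp: power_divide power2_eq_square field_simps)
  qed
  have Q: "Q / real N = mean (pairs R) (\<lambda>p. (\<Sum>n<N'. f (int n + K * fst p) * f (int n + K * snd p)) / real N)"
  proof -
    have "(mean {0..<int R} (\<lambda>r. g r))\<^sup>2 = mean (pairs R) (\<lambda>p. g (fst p) * g (snd p))" for g
      unfolding mean_Times power2_eq_square by (simp add: mean_cmult mult.commute flip: mean_cmult)
    then have "Q = (\<Sum>n<N'. mean (pairs R) (\<lambda>p. f (int n + K * fst p) * f (int n + K * snd p)))"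
      unfolding Q_def by simp
    also have "\<dots> = mean (pairs R) (\<lambda>p. \<Sum>n<N'. f (int n + K * fst p) * f (int n + K * snd p))"
      by (rule mean_sum)
    finally show ?thesis unfolding mean_def by (simp add: sum_divide_distrib mult.commute)
  qed
  have "S\<^sup>2 - A\<^sup>2 \<le> \<bar>S - A\<bar> * (\<bar>S\<bar> + \<bar>A\<bar>)"
  proof -
    have "S\<^sup>2 - A\<^sup>2 = (S - A) * (S + A)" by (simp add: power2_eq_square algebra_simps)
    also have "\<dots> \<le> \<bar>S - A\<bar> * \<bar>S + A\<bar>" by (metis abs_ge_self abs_mult)
    also have "\<dots> \<le> \<bar>S - A\<bar> * (\<bar>S\<bar> + \<bar>A\<bar>)" by (intro mult_left_mono) auto
    finally show ?thesis .
  qed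
  also have "\<dots> \<le> (2 * real_of_int K * real R) * (2 * real N)"
    using diff S A \<open>N' \<le> N\<close> by (intro mult_mono) auto
  finally have "S\<^sup>2 \<le> real N' * Q + 4 * real_of_int K * real R * real N" using A2 by simp
  also have "real N' * Q \<le> real N * Q"
    using \<open>N' \<le> N\<close> unfolding Q_def by (intro mult_right_mono sum_nonneg) auto
  finally have "S\<^sup>2 \<le> real N * (Q + 4 * real_of_int K * real R)" by (simp add: algebra_simps)
  then have "(S / real N)\<^sup>2 \<le> (Q + 4 * real_of_int K * real R) / real N"
    using \<open>N > 0\<close> by (simp add: power_divide power2_eq_square divide_simps mult_ac)
  then show ?thesis unfolding S_def[symmetric] Q[symmetric] by (simp add: add_divide_distrib)
qed

text \<open>
  Squaring \<open>A + e\<close> gives at most \<open>A\<^sup>2 + 3 * e\<close> while \<open>e \<le> 1\<close>; iterating, an error grows by a factor 3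
  for each squaring.
\<close>

lemma power_perturb:
  fixes A e :: real
  assumes "\<bar>A\<bar> \<le> 1" "0 \<le> e" "0 \<le> A + e" "3 ^ j * e \<le> 1"
  shows "(A + e) ^ (2 ^ j) \<le> A ^ (2 ^ j) + 3 ^ j * e"
  using assms
proof (induction j arbitrary: A e)
  case 0 then show ?case by simp
next
  case (Suc j)
  have "(1::real) \<le> 3 ^ Suc j" by (rule one_le_power) simp
  then have "1 * e \<le> 3 ^ Suc j * e" using Suc.prems by (intro mult_right_mono) auto
  then have e1: "e \<le> 1" using Suc.prems by linarith
  have "(A + e)\<^sup>2 = A\<^sup>2 + (2 * A + e) * e" by (simp add: power2_eq_square algebra_simps)
  also have "\<dots> \<le> A\<^sup>2 + 3 * e" using Suc.prems e1 by (intro add_left_mono mult_right_mono) auto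
  finally have *: "(A + e)\<^sup>2 \<le> A\<^sup>2 + 3 * e" .
  have "(A + e) ^ (2 ^ Suc j) = ((A + e)\<^sup>2) ^ (2 ^ j)" by (simp add: power_mult)
  also have "\<dots> \<le> (A\<^sup>2 + 3 * e) ^ (2 ^ j)" using * by (intro power_mono) auto
  also have "\<dots> \<le> (A\<^sup>2) ^ (2 ^ j) + 3 ^ j * (3 * e)"
    using Suc.prems by (intro Suc.IH) (auto simp: abs_square_le_1)
  finally show ?case by (simp add: power_mult)
qed

text \<open>
  One application of the van der Corput inequality for each direction \<open>K\<close>. Between two applications
  Jensen's inequality moves the power inside the average over the previous shifts.
\<close>

lemma iterated_van_der_Corput:
  fixes f :: "int \<Rightarrow> real"
  assumes "\<And>v. \<bar>f v\<bar> \<le> 1" and "N' \<le> N" "N > 0"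
    and "\<And>K R. (K, R) \<in> set ds \<Longrightarrow> K \<ge> 0 \<and> R > 0"
    and "3 ^ length ds * (\<Sum>(K, R)\<leftarrow>ds. 4 * real_of_int K * real R / real N) \<le> 1"
  shows "((\<Sum>n<N'. f (int n)) / real N) ^ (2 ^ length ds)
    \<le> mean (tuples (map snd ds)) (\<lambda>rs. (\<Sum>n<N'. cube (dilate (map fst ds) rs) f (int n)) / real N)
      + 3 ^ length ds * (\<Sum>(K, R)\<leftarrow>ds. 4 * real_of_int K * real R / real N)"
  using assms
proof (induction ds arbitrary: f)
  case Nil
  show ?case by (simp add: mean_def)
next
  case (Cons d ds)
  obtain K R where d: "d = (K, R)" by force
  define l where "l = length ds"
  define e where "e = 4 * real_of_int K * real R / real N"
  define e' where "e' = (\<Sum>(K, R)\<leftarrow>ds. 4 * real_of_int K * real R / real N)"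
  have K: "K \<ge> 0" "R > 0" using Cons.prems(4) d by auto
  have e0: "e \<ge> 0" using K by (simp add: e_def)
  have e'0: "e' \<ge> 0" unfolding e'_def using Cons.prems(4) by (intro sum_list_nonneg) force
  have small: "3 * (3 ^ l * (e + e')) \<le> 1"
    using Cons.prems(5) by (simp add: d e_def e'_def l_def)
  have p: "3 ^ l * e' \<le> 1" "3 ^ l * e \<le> 1" "3 ^ l * (e + e') \<le> 3 * (3 ^ l * (e + e'))"
  proof -
    have "0 \<le> 3 ^ l * e" "0 \<le> 3 ^ l * e'" using e0 e'0 by auto
    with small show "3 ^ l * e' \<le> 1" "3 ^ l * e \<le> 1" "3 ^ l * (e + e') \<le> 3 * (3 ^ l * (e + e'))"
      by (simp_all add: algebra_simps)
  qed
  define g where "g = (\<lambda>p v. f (v + K * fst p) * f (v + K * snd p))"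
  define A where "A p = (\<Sum>n<N'. g p (int n)) / real N" for p
  have g: "\<bar>g p v\<bar> \<le> 1" for p v
    unfolding g_def abs_mult using Cons.prems(1) by (intro mult_le_one) auto
  have absA: "\<bar>A p\<bar> \<le> 1" for p
  proof -
    have "\<bar>\<Sum>n<N'. g p (int n)\<bar> \<le> (\<Sum>n<N'. \<bar>g p (int n)\<bar>)" by (rule sum_abs)
    also have "\<dots> \<le> (\<Sum>n<N'. 1)" by (rule sum_mono) (rule g)
    finally show ?thesis using Cons.prems(2,3) by (simp add: A_def abs_divide)
  qed
  have ne: "finite (pairs R)" "pairs R \<noteq> {}" using K by auto
  have vdc: "((\<Sum>n<N'. f (int n)) / real N)\<^sup>2 \<le> mean (pairs R) A + e"
  proof -
    have "mean (pairs R) A = mean (pairs R) (\<lambda>p. (\<Sum>n<N'. f (int n + K * fst p) * f (int n + K * snd p)) / real N)"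
      by (rule mean_cong) (simp add: A_def g_def)
    then show ?thesis
      using van_der_Corput[where f = f, OF Cons.prems(1-3) K] by (simp add: e_def)
  qed
  have absm: "\<bar>mean (pairs R) A\<bar> \<le> 1"
    by (rule order_trans[OF abs_mean_le])
       (metis (no_types, lifting) mean_mono absA mean_const[OF ne])
  have "((\<Sum>n<N'. f (int n)) / real N) ^ (2 ^ length (d # ds))
      = (((\<Sum>n<N'. f (int n)) / real N)\<^sup>2) ^ (2 ^ l)"
    by (simp add: power_mult l_def)
  also have "\<dots> \<le> (mean (pairs R) A + e) ^ (2 ^ l)"
    using vdc by (intro power_mono) auto
  also have "\<dots> \<le> mean (pairs R) A ^ (2 ^ l) + 3 ^ l * e"
    using absm e0 p vdc by (intro power_perturb) (auto intro: order_trans[OF zero_le_power2])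
  also have "mean (pairs R) A ^ (2 ^ l) \<le> mean (pairs R) (\<lambda>p. A p ^ (2 ^ l))"
    by (rule mean_power)
  also have "\<dots> \<le> mean (pairs R) (\<lambda>p. mean (tuples (map snd ds))
      (\<lambda>rs. (\<Sum>n<N'. cube (dilate (map fst ds) rs) (g p) (int n)) / real N) + 3 ^ l * e')"
  proof (rule mean_mono)
    fix p
    show "A p ^ (2 ^ l) \<le> mean (tuples (map snd ds))
      (\<lambda>rs. (\<Sum>n<N'. cube (dilate (map fst ds) rs) (g p) (int n)) / real N) + 3 ^ l * e'"
      unfolding A_def l_def e'_def
      by (rule Cons.IH[OF g Cons.prems(2,3)]) (use Cons.prems(4) p(1) in \<open>auto simp: l_def e'_def\<close>)
  qed
  also have "\<dots> = mean (tuples (map snd (d # ds)))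
      (\<lambda>rs. (\<Sum>n<N'. cube (dilate (map fst (d # ds)) rs) f (int n)) / real N) + 3 ^ l * e'"
    unfolding mean_add mean_const[OF ne] list.map mean_tuples_Cons d
    by (simp add: cube_Cons' g_def)
  finally have "((\<Sum>n<N'. f (int n)) / real N) ^ (2 ^ length (d # ds))
    \<le> mean (tuples (map snd (d # ds)))
      (\<lambda>rs. (\<Sum>n<N'. cube (dilate (map fst (d # ds)) rs) f (int n)) / real N) + 3 ^ l * (e + e')"
    by (simp add: algebra_simps)
  also have "3 ^ l * (e + e') \<le> 3 ^ length (d # ds) * (\<Sum>(K, R)\<leftarrow>d # ds. 4 * real_of_int K * real R / real N)"
    using p(3) by (simp add: d e_def e'_def l_def)
  finally show ?case by simp
qed

section \<open>Decay of cube averages of truncated signs\<close>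

lemma mean_split:
  "mean {0..<2 ^ (M + w)} f = mean {0..<2 ^ M} (\<lambda>c. mean {0..<2 ^ w} (\<lambda>r. f (c + 2 ^ M * r)))"
  for f :: "int \<Rightarrow> real"
proof -
  have "bij_betw (\<lambda>(c, r). c + 2 ^ M * r) ({0..<2 ^ M} \<times> {0..<2 ^ w}) {0..<2 ^ (M + w) :: int}"
  proof (rule bij_betw_byWitness[where f' = "\<lambda>n. (n mod 2 ^ M, n div 2 ^ M)"])
    show "(\<lambda>(c, r). c + 2 ^ M * r) ` ({0..<2 ^ M} \<times> {0..<2 ^ w}) \<subseteq> {0..<2 ^ (M + w) :: int}"
    proof clarsimp
      fix c r :: int
      assume "0 \<le> c" "c < 2 ^ M" "0 \<le> r" "r < 2 ^ w"
      then have "2 ^ M * (r + 1) \<le> (2::int) ^ M * 2 ^ w" by (intro mult_left_mono) auto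
      with \<open>c < 2 ^ M\<close> show "c + 2 ^ M * r < 2 ^ (M + w)" by (simp add: power_add algebra_simps)
    qed
    show "(\<lambda>n. (n mod 2 ^ M, n div 2 ^ M)) ` {0..<2 ^ (M + w)} \<subseteq> {0..<2 ^ M} \<times> {0..<2 ^ w :: int}"
    proof clarsimp
      fix n :: int
      assume "0 \<le> n" "n < 2 ^ (M + w)"
      moreover have "2 ^ M * (n div 2 ^ M) \<le> n"
      proof -
        have "0 \<le> n mod 2 ^ M" by simp
        then show ?thesis using mult_div_mod_eq[of "2 ^ M" n] by linarith
      qed
      ultimately have "2 ^ M * (n div 2 ^ M) < 2 ^ M * 2 ^ w"
        unfolding power_add by linarith
      then have "n div 2 ^ M < 2 ^ w"
        by (metis mult_less_cancel_left_pos zero_less_numeral zero_less_power)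
      with \<open>0 \<le> n\<close> show "0 \<le> n div 2 ^ M \<and> n div 2 ^ M < 2 ^ w"
        by (simp add: pos_imp_zdiv_nonneg_iff)
    qed
  qed auto
  from mean_reindex[OF this, of f] show ?thesis by (simp add: mean_Times)
qed

lemma mean_pairs_split:
  "mean (pairs (2 ^ (M + w))) f =
   mean (pairs (2 ^ M)) (\<lambda>c. mean (pairs (2 ^ w)) (\<lambda>r. f (fst c + 2 ^ M * fst r, snd c + 2 ^ M * snd r)))"
proof -
  have "mean (pairs (2 ^ (M + w))) f = mean {0..<2 ^ M} (\<lambda>c. mean {0..<2 ^ w} (\<lambda>r. mean {0..<2 ^ M} (\<lambda>c'.
      mean {0..<2 ^ w} (\<lambda>r'. f (c + 2 ^ M * r, c' + 2 ^ M * r')))))"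
    by (simp add: mean_Times mean_split)
  also have "\<dots> = mean {0..<2 ^ M} (\<lambda>c. mean {0..<2 ^ M} (\<lambda>c'. mean {0..<2 ^ w} (\<lambda>r.
      mean {0..<2 ^ w} (\<lambda>r'. f (c + 2 ^ M * r, c' + 2 ^ M * r')))))"
    by (subst (2) mean_swap) (rule refl)
  finally show ?thesis by (simp add: mean_Times)
qed

definition join_digits :: "nat \<Rightarrow> (int \<times> int) list \<Rightarrow> (int \<times> int) list \<Rightarrow> (int \<times> int) list" where
  "join_digits M cs rs = map2 (\<lambda>c r. (fst c + 2 ^ M * fst r, snd c + 2 ^ M * snd r)) cs rs"

lemma join_digits_Nil [simp]: "join_digits M [] [] = []"
  by (simp add: join_digits_def)

lemma join_digits_Cons [simp]:
  "join_digits M (c # cs) (r # rs) = (fst c + 2 ^ M * fst r, snd c + 2 ^ M * snd r) # join_digits M cs rs"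
  by (simp add: join_digits_def)

lemma vertex_join_digits:
  "length cs = length w \<Longrightarrow> length rs = length w \<Longrightarrow>
   vertex w (join_digits M cs rs) = vertex w cs + 2 ^ M * vertex w rs"
proof (induction w arbitrary: cs rs)
  case Nil then show ?case by simp
next
  case (Cons b w)
  then show ?case
    by (cases cs; cases rs) (auto simp: algebra_simps)
qed

text \<open>
  A uniform tuple of \<open>(M + w)\<close>-digit numbers consists of independent low and high parts.
\<close>

lemma mean_tuples_split:
  "mean (tuples (replicate k (2 ^ (M + w)))) F =
   mean (tuples (replicate k (2 ^ M))) (\<lambda>cs. mean (tuples (replicate k (2 ^ w))) (\<lambda>rs. F (join_digits M cs rs)))"
proof (induction k arbitrary: F)
  case 0
  then show ?case by (simp add: mean_def)
next
  case (Suc k)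
  let ?T = "\<lambda>L. tuples (replicate k (2 ^ L))"
  have "mean (tuples (replicate (Suc k) (2 ^ (M + w)))) F
    = mean (pairs (2 ^ (M + w))) (\<lambda>p. mean (?T M) (\<lambda>cs. mean (?T w) (\<lambda>rs. F (p # join_digits M cs rs))))"
    by (simp only: replicate_Suc mean_tuples_Cons Suc.IH)
  also have "\<dots> = mean (pairs (2 ^ M)) (\<lambda>c. mean (pairs (2 ^ w)) (\<lambda>r. mean (?T M) (\<lambda>cs. mean (?T w)
      (\<lambda>rs. F (join_digits M (c # cs) (r # rs))))))"
    by (simp only: mean_pairs_split join_digits_Cons)
  also have "\<dots> = mean (pairs (2 ^ M)) (\<lambda>c. mean (?T M) (\<lambda>cs. mean (pairs (2 ^ w)) (\<lambda>r. mean (?T w)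
      (\<lambda>rs. F (join_digits M (c # cs) (r # rs))))))"
    by (subst (2) mean_swap) (rule refl)
  also have "\<dots> = mean (tuples (replicate (Suc k) (2 ^ M))) (\<lambda>cs. mean (tuples (replicate (Suc k) (2 ^ w)))
      (\<lambda>rs. F (join_digits M cs rs)))"
    by (simp only: replicate_Suc mean_tuples_Cons)
  finally show ?case .
qed

lemma card_tuples: "card (tuples (replicate k R)) = R ^ (2 * k)"
proof (induction k)
  case 0 then show ?case by simp
next
  case (Suc k)
  have "card (tuples (R # replicate k R)) = card (pairs R \<times> tuples (replicate k R))"
    unfolding tuples.simps by (rule card_image) (auto simp: inj_on_def)
  with Suc show ?case by (simp add: card_cartesian_product power_add power2_eq_square)
qed

lemma vertex_bounds:
  assumes "cs \<in> tuples (replicate k R)" "length w = k" "R > 0"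
  shows "0 \<le> vertex w cs \<and> vertex w cs \<le> int k * (int R - 1)"
  using assms
proof (induction k arbitrary: cs w)
  case 0 then show ?case by simp
next
  case (Suc k)
  obtain b w' where w: "w = b # w'" "length w' = k" using Suc.prems by (cases w) auto
  obtain p ps where cs: "cs = p # ps" "p \<in> pairs R" "ps \<in> tuples (replicate k R)"
    using Suc.prems by auto
  from cs(2) have "fst p \<in> {0..int R - 1}" "snd p \<in> {0..int R - 1}" by auto
  with Suc.IH[of ps w'] w cs Suc.prems show ?case
    by (auto simp: algebra_simps)
qed

text \<open>
  The average of the cube product with two families of base points, one offset for every vertex.
  Vertex-dependent offsets are needed because carries from low digits differ between vertices.
\<close>

definition signed_average :: "nat \<Rightarrow> nat \<Rightarrow> (bool list \<Rightarrow> int) \<Rightarrow> (bool list \<Rightarrow> int) \<Rightarrow> real" where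
  "signed_average k w Z Z' = mean (tuples (replicate k (2 ^ w)))
     (\<lambda>rs. \<Prod>\<omega>\<in>bools k. tm w (Z \<omega> + vertex \<omega> rs) * tm w (Z' \<omega> + vertex \<omega> rs))"

lemma tm_split: "tm (M + w) (U + 2 ^ M * V) = tm M U * tm w (U div 2 ^ M + V)"
  unfolding tm_add by (simp add: tm_periodic add.commute)

text \<open>
  Splitting off the lowest \<open>M\<close> digits of all shifts: their signs become a factor, their carries become
  the new offsets, and what is left is an average of the same kind with fewer digits.
\<close>

lemma signed_average_split:
  "signed_average k (M + w) Z Z' = mean (tuples (replicate k (2 ^ M)))
     (\<lambda>cs. (\<Prod>\<omega>\<in>bools k. tm M (Z \<omega> + vertex \<omega> cs) * tm M (Z' \<omega> + vertex \<omega> cs)) *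
       signed_average k w (\<lambda>\<omega>. (Z \<omega> + vertex \<omega> cs) div 2 ^ M) (\<lambda>\<omega>. (Z' \<omega> + vertex \<omega> cs) div 2 ^ M))"
proof -
  have "(\<Prod>\<omega>\<in>bools k. tm (M + w) (Z \<omega> + vertex \<omega> (join_digits M cs rs)) * tm (M + w) (Z' \<omega> + vertex \<omega> (join_digits M cs rs)))
    = (\<Prod>\<omega>\<in>bools k. tm M (Z \<omega> + vertex \<omega> cs) * tm M (Z' \<omega> + vertex \<omega> cs)) *
      (\<Prod>\<omega>\<in>bools k. tm w ((Z \<omega> + vertex \<omega> cs) div 2 ^ M + vertex \<omega> rs) * tm w ((Z' \<omega> + vertex \<omega> cs) div 2 ^ M + vertex \<omega> rs))"
    if "cs \<in> tuples (replicate k (2 ^ M))" "rs \<in> tuples (replicate k (2 ^ w))" for cs rs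
    unfolding prod.distrib[symmetric]
  proof (rule prod.cong[OF refl])
    fix \<omega> assume "\<omega> \<in> bools k"
    then have "vertex \<omega> (join_digits M cs rs) = vertex \<omega> cs + 2 ^ M * vertex \<omega> rs"
      using that by (intro vertex_join_digits) (auto simp: bools_def length_tuples)
    then show "tm (M + w) (Z \<omega> + vertex \<omega> (join_digits M cs rs)) * tm (M + w) (Z' \<omega> + vertex \<omega> (join_digits M cs rs))
      = tm M (Z \<omega> + vertex \<omega> cs) * tm M (Z' \<omega> + vertex \<omega> cs) *
        (tm w ((Z \<omega> + vertex \<omega> cs) div 2 ^ M + vertex \<omega> rs) * tm w ((Z' \<omega> + vertex \<omega> cs) div 2 ^ M + vertex \<omega> rs))"
      by (simp add: add.assoc[symmetric] tm_split)
  qed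
  then show ?thesis
    unfolding signed_average_def mean_tuples_split mean_cmult[symmetric]
    by (intro mean_cong) simp
qed

lemma abs_prod_tm: "\<bar>\<Prod>\<omega>\<in>A. tm w (f \<omega>) * tm w' (g \<omega>)\<bar> = 1"
  by (simp add: abs_prod abs_mult)

text \<open>
  Two opposite terms in an average of terms bounded by \<open>B\<close> save a fixed proportion of \<open>B\<close>.
\<close>

lemma mean_cancel_pair:
  assumes "finite A" "c0 \<in> A" "c1 \<in> A" "c0 \<noteq> c1" "f c1 = - f c0" "\<And>c. c \<in> A \<Longrightarrow> \<bar>f c\<bar> \<le> B"
  shows "\<bar>mean A f\<bar> \<le> (1 - 2 / real (card A)) * B"
proof -
  have A: "A = insert c0 (insert c1 (A - {c0, c1}))" using assms by auto
  have c: "card A = card (A - {c0, c1}) + 2" using assms by (subst A) (simp add: card_insert_if)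
  have "sum f A = f c0 + (f c1 + sum f (A - {c0, c1}))"
    using assms by (subst A) (simp add: sum.insert_if)
  then have "\<bar>sum f A\<bar> = \<bar>sum f (A - {c0, c1})\<bar>" using assms by simp
  also have "\<dots> \<le> (\<Sum>c\<in>A - {c0, c1}. B)"
    by (rule order_trans[OF sum_abs sum_mono]) (use assms in auto)
  also have "\<dots> = (real (card A) - 2) * B" using c by simp
  finally have "\<bar>sum f A\<bar> / real (card A) \<le> (real (card A) - 2) * B / real (card A)"
    by (rule divide_right_mono) simp
  also have "\<dots> = (1 - 2 / real (card A)) * B" using c by (simp add: divide_simps)
  finally show ?thesis unfolding mean_def abs_divide by simp
qed

lemma tuples_replicate_nonempty: "R > 0 \<Longrightarrow> tuples (replicate k R) \<noteq> {}"
  by (induction k) auto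

definition trues :: "bool list \<Rightarrow> int" where
  "trues w = int (length (filter id w))"

lemma vertex_replicate: "vertex w (replicate (length w) (0, K)) = K * trues w"
  by (induction w) (auto simp: trues_def algebra_simps)

lemma trues_bounds: "0 \<le> trues w" "trues w \<le> int (length w)"
  by (auto simp: trues_def)

lemma trues_less:
  assumes "w \<noteq> replicate (length w) True"
  shows "trues w < int (length w)"
proof -
  obtain b where "b \<in> set w" "\<not> id b" using assms by (metis id_apply replicate_eqI)
  then show ?thesis unfolding trues_def using length_filter_less[of b w id] by simp
qed

lemma tm_2: "tm 2 0 = 1" "tm 2 1 = -1" "tm 2 2 = -1"
  by (simp_all add: tm_def numeral_2_eq_2 lessThan_Suc bit_iff_odd)

text \<open>
  Going from \<open>u\<close> to \<open>u + 2 ^ a\<close> flips the sign as long as \<open>u < 2 ^ a\<close>, but not for \<open>u = 2 ^ a\<close>, because of a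
  carry. This jump is the source of all cancellation below.
\<close>

lemma tm_shift_low: "0 \<le> u \<Longrightarrow> u < 2 ^ a \<Longrightarrow> tm (a + 2) u * tm (a + 2) (u + 2 ^ a) = -1"
  using tm_split[of a 2 u 0] tm_split[of a 2 u 1] by (simp add: tm_2 mult.left_commute)

lemma tm_shift_top: "tm (a + 2) (2 ^ a) * tm (a + 2) (2 ^ a + 2 ^ a) = 1"
proof -
  have "tm (a + 2) (2 ^ a) = - tm a 0" using tm_split[of a 2 0 1] by (simp add: tm_2)
  moreover have "tm (a + 2) (2 ^ a + 2 ^ a) = - tm a 0"
    using tm_split[of a 2 0 2] by (simp add: tm_2 mult.commute)
  ultimately show ?thesis by simp
qed

text \<open>
  A block consists of \<open>m\<close> zero digits, which absorb an offset of at most \<open>k\<close>, and above them \<open>m\<close> digits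
  forming the number \<open>t\<close>. Adding \<open>j\<close> to \<open>t\<close> then neither interferes with the offset nor leaves the block.
\<close>

lemma block_digits:
  assumes x: "x mod 2 ^ (m + m) = 2 ^ m * t" and t: "0 \<le> t" "t + k < 2 ^ m"
    and z: "x \<le> z" "z \<le> x + k" and k: "k < 2 ^ m" and j: "0 \<le> j" "j \<le> k"
  shows "(z + 2 ^ m * j) div 2 ^ (m + m) = x div 2 ^ (m + m)"
    and "tm (m + m) (z + 2 ^ m * j) = tm m (z - x) * tm m (t + j)"
proof -
  define e where "e = z - x"
  define q where "q = x div 2 ^ (m + m)"
  define r where "r = e + 2 ^ m * (t + j)"
  have e: "0 \<le> e" "e < 2 ^ m" using z k by (auto simp: e_def)
  have "x = 2 ^ (m + m) * q + 2 ^ m * t"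
    using mult_div_mod_eq[of "2 ^ (m + m)" x] by (simp add: q_def x)
  then have z': "z + 2 ^ m * j = r + 2 ^ (m + m) * q"
    by (simp add: r_def e_def algebra_simps)
  have r0: "0 \<le> r" using e t j by (auto simp: r_def)
  have "2 ^ m * (t + j) \<le> 2 ^ m * (2 ^ m - 1)"
    using t j by (intro mult_left_mono) auto
  then have r1: "r < 2 ^ (m + m)" using e by (simp add: r_def power_add algebra_simps)
  show "(z + 2 ^ m * j) div 2 ^ (m + m) = x div 2 ^ (m + m)"
    using r0 r1 by (simp add: z' q_def)
  show "tm (m + m) (z + 2 ^ m * j) = tm m (z - x) * tm m (t + j)"
    unfolding z' tm_periodic using tm_split[of m m e "t + j"] e by (simp add: r_def e_def)
qed

context
  fixes k a m :: nat and x y :: int and Z Z' :: "bool list \<Rightarrow> int"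
  assumes k: "1 \<le> k" "k \<le> 2 ^ a" and m: "m = a + 2"
    and x: "x mod 2 ^ (m + m) = 2 ^ m * (2 ^ a - int k)"
    and y: "y mod 2 ^ (m + m) = 2 ^ m * (2 ^ (a + 1) - int k)"
    and Z: "\<And>w. w \<in> bools k \<Longrightarrow> x \<le> Z w \<and> Z w \<le> x + int k"
    and Z': "\<And>w. w \<in> bools k \<Longrightarrow> y \<le> Z' w \<and> Z' w \<le> y + int k"
begin

text \<open>
  The distinguished pattern: the upper half of the block is \<open>2 ^ a - k\<close> for the first base point and
  \<open>2 ^ (a + 1) - k\<close> for the second. The sign of the pair is constant for \<open>j < k\<close> and jumps at \<open>j = k\<close>.
\<close>

lemma pattern_digits:
  assumes w: "w \<in> bools k" and j: "0 \<le> j" "j \<le> int k"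
  shows "(Z w + 2 ^ m * j) div 2 ^ (m + m) = x div 2 ^ (m + m)"
    and "(Z' w + 2 ^ m * j) div 2 ^ (m + m) = y div 2 ^ (m + m)"
    and "tm (m + m) (Z w + 2 ^ m * j) * tm (m + m) (Z' w + 2 ^ m * j)
      = (tm m (Z w - x) * tm m (Z' w - y)) * (if j = int k then 1 else -1)"
proof -
  have "int k \<le> int (2 ^ a)" using k by linarith
  then have k': "int k \<le> 2 ^ a" by simp
  have m4: "(2::int) ^ m = 4 * 2 ^ a" by (simp add: m power_add)
  have pa: "(2::int) ^ (a + 1) = 2 * 2 ^ a" by simp
  have "(2::int) ^ a \<ge> 1" by simp
  then have h: "0 \<le> 2 ^ a - int k" "2 ^ a - int k + int k < 2 ^ m" "int k < 2 ^ m"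
    "0 \<le> 2 ^ (a + 1) - int k" "2 ^ (a + 1) - int k + int k < 2 ^ m"
    using k' m4 pa by linarith+
  note bx = block_digits[OF x h(1,2) conjunct1[OF Z[OF w]] conjunct2[OF Z[OF w]] h(3) j]
  note b_y = block_digits[OF y h(4,5) conjunct1[OF Z'[OF w]] conjunct2[OF Z'[OF w]] h(3) j]
  show "(Z w + 2 ^ m * j) div 2 ^ (m + m) = x div 2 ^ (m + m)"
    and "(Z' w + 2 ^ m * j) div 2 ^ (m + m) = y div 2 ^ (m + m)"
    by (rule bx(1), rule b_y(1))
  have "tm m (2 ^ a - int k + j) * tm m (2 ^ (a + 1) - int k + j) = (if j = int k then 1 else -1)"
  proof (cases "j = int k")
    case True
    then show ?thesis using tm_shift_top[of a] by (simp add: m)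
  next
    case False
    then have "0 \<le> 2 ^ a - int k + j" "2 ^ a - int k + j < 2 ^ a" using j k' by auto
    from tm_shift_low[OF this] False show ?thesis by (simp add: m algebra_simps)
  qed
  then show "tm (m + m) (Z w + 2 ^ m * j) * tm (m + m) (Z' w + 2 ^ m * j)
      = (tm m (Z w - x) * tm m (Z' w - y)) * (if j = int k then 1 else -1)"
    unfolding bx(2) b_y(2) by (simp add: mult_ac)
qed

text \<open>
  With block digits \<open>(0, 0)\<close> in all directions every vertex contributes -1 apart from the offsets; with
  \<open>(0, 2 ^ m)\<close> the vertex choosing \<open>True\<close> everywhere, and only this one, reaches \<open>j = k\<close>. So the two
  choices of digits give opposite signs.
\<close>

lemma pattern_sign:
  "(\<Prod>w\<in>bools k. tm (m + m) (Z w + vertex w (replicate k (0, 2 ^ m))) * tm (m + m) (Z' w + vertex w (replicate k (0, 2 ^ m))))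
   = - (\<Prod>w\<in>bools k. tm (m + m) (Z w + vertex w (replicate k (0, 0))) * tm (m + m) (Z' w + vertex w (replicate k (0, 0))))"
proof -
  let ?E = "\<Prod>w\<in>bools k. tm m (Z w - x) * tm m (Z' w - y)"
  have 1: "(\<Prod>w\<in>bools k. tm (m + m) (Z w + vertex w (replicate k (0, 2 ^ m))) * tm (m + m) (Z' w + vertex w (replicate k (0, 2 ^ m))))
    = ?E * (\<Prod>w\<in>bools k. if trues w = int k then 1 else -1)"
    unfolding prod.distrib[symmetric]
  proof (rule prod.cong[OF refl])
    fix w assume w: "w \<in> bools k"
    then show "tm (m + m) (Z w + vertex w (replicate k (0, 2 ^ m))) * tm (m + m) (Z' w + vertex w (replicate k (0, 2 ^ m)))
      = tm m (Z w - x) * tm m (Z' w - y) * (if trues w = int k then 1 else -1)"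
      using pattern_digits(3)[OF w, of "trues w"] trues_bounds[of w] vertex_replicate[of w "2 ^ m"]
      by (simp add: bools_def)
  qed
  have 0: "(\<Prod>w\<in>bools k. tm (m + m) (Z w + vertex w (replicate k (0, 0))) * tm (m + m) (Z' w + vertex w (replicate k (0, 0))))
    = ?E * (\<Prod>w\<in>bools k. -1)"
    unfolding prod.distrib[symmetric]
  proof (rule prod.cong[OF refl])
    fix w assume w: "w \<in> bools k"
    then show "tm (m + m) (Z w + vertex w (replicate k (0, 0))) * tm (m + m) (Z' w + vertex w (replicate k (0, 0)))
      = tm m (Z w - x) * tm m (Z' w - y) * -1"
      using pattern_digits(3)[OF w, of 0] vertex_replicate[of w 0] k by (simp add: bools_def)
  qed
  have "bools k = insert (replicate k True) (bools k - {replicate k True})"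
    by (auto simp: bools_def)
  then have "(\<Prod>w\<in>bools k. if trues w = int k then 1 else -1 :: real)
    = (if trues (replicate k True) = int k then 1 else -1) * (\<Prod>w\<in>bools k - {replicate k True}. if trues w = int k then 1 else -1)"
    by (metis (no_types, lifting) finite_bools finite_Diff insert_Diff_single Diff_iff insertCI prod.insert)
  also have "trues (replicate k True) = int k" by (simp add: trues_def)
  also have "(\<Prod>w\<in>bools k - {replicate k True}. if trues w = int k then 1 else -1 :: real)
    = (\<Prod>w\<in>bools k - {replicate k True}. -1)"
    by (rule prod.cong) (auto simp: bools_def dest: trues_less)
  also have "\<dots> = (-1) ^ (2 ^ k - 1)" by (simp add: card_Diff_singleton_if bools_def[of k, symmetric]) (simp add: bools_def)
  also have "\<dots> = -1" proof -
    have "odd (2 ^ k - 1 :: nat)" using k(1) by simp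
    then show ?thesis by simp
  qed
  finally have p1: "(\<Prod>w\<in>bools k. if trues w = int k then 1 else -1 :: real) = -1" by simp
  have p0: "(\<Prod>w\<in>bools k. -1 :: real) = 1"
    using k(1) by (simp add: uminus_power_if)
  show ?thesis unfolding 0 1 p0 p1 by simp
qed

text \<open>
  The same two choices of digits produce no carry out of the block, hence the same remaining average.
\<close>

lemma pattern_carry:
  assumes "w \<in> bools k"
  shows "(Z w + vertex w (replicate k (0, 2 ^ m))) div 2 ^ (m + m) = (Z w + vertex w (replicate k (0, 0))) div 2 ^ (m + m)"
    and "(Z' w + vertex w (replicate k (0, 2 ^ m))) div 2 ^ (m + m) = (Z' w + vertex w (replicate k (0, 0))) div 2 ^ (m + m)"
  using assms pattern_digits(1,2)[OF assms, of 0] pattern_digits(1,2)[OF assms, of "trues w"]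
    trues_bounds[of w] vertex_replicate[of w "2 ^ m"] vertex_replicate[of w 0]
  by (simp_all add: bools_def)

end

text \<open>
  The bound obtained for a signed average with base points \<open>x\<close> and \<open>y\<close>: every block showing the pattern
  \<open>A\<close> contributes a saving.
\<close>

primrec damp :: "nat \<Rightarrow> real \<Rightarrow> int \<times> int \<Rightarrow> nat \<Rightarrow> int \<Rightarrow> int \<Rightarrow> real" where
  "damp M c A 0 x y = 1"
| "damp M c A (Suc p) x y = (if (x mod 2 ^ M, y mod 2 ^ M) = A then c else 1) * damp M c A p (x div 2 ^ M) (y div 2 ^ M)"

text \<open>
  Offsets stay in \<open>[0, k]\<close> when \<open>k\<close> numbers of \<open>M\<close> digits are added and the carry is passed on.
\<close>

lemma carry_bounds:
  fixes z x v :: int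
  assumes "x \<le> z" "z \<le> x + k" "0 \<le> v" "v \<le> k * (2 ^ M - 1)"
  shows "x div 2 ^ M \<le> (z + v) div 2 ^ M \<and> (z + v) div 2 ^ M \<le> x div 2 ^ M + k"
proof
  show "x div 2 ^ M \<le> (z + v) div 2 ^ M" using assms by (intro zdiv_mono1) auto
  have "(z + v) div 2 ^ M \<le> (x + 2 ^ M * k) div 2 ^ M"
    using assms by (intro zdiv_mono1) (auto simp: algebra_simps)
  then show "(z + v) div 2 ^ M \<le> x div 2 ^ M + k" by simp
qed

text \<open>
  Induction over the blocks. In every block the terms are bounded by the induction hypothesis; if the
  base points show the pattern, two of the \<open>2 ^ (2 * M * k)\<close> terms cancel.
\<close>

lemma signed_average_decay:
  fixes k a m :: nat
  assumes k: "1 \<le> k" "k \<le> 2 ^ a" and m: "m = a + 2"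
    and "\<And>w. w \<in> bools k \<Longrightarrow> x \<le> Z w \<and> Z w \<le> x + int k"
    and "\<And>w. w \<in> bools k \<Longrightarrow> y \<le> Z' w \<and> Z' w \<le> y + int k"
  shows "\<bar>signed_average k ((m + m) * p + w0) Z Z'\<bar> \<le>
    damp (m + m) (1 - 2 / 2 ^ ((m + m) * (2 * k))) (2 ^ m * (2 ^ a - int k), 2 ^ m * (2 ^ (a + 1) - int k)) p x y"
  using assms(4,5)
proof (induction p arbitrary: x y Z Z')
  case 0
  have "\<bar>signed_average k w0 Z Z'\<bar> \<le> mean (tuples (replicate k (2 ^ w0))) (\<lambda>_. 1)"
    unfolding signed_average_def by (rule order_trans[OF abs_mean_le], rule mean_mono) (simp add: abs_prod_tm)
  also have "\<dots> = 1" by (rule mean_const) (auto simp: tuples_replicate_nonempty)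
  finally show ?case by simp
next
  case (Suc p)
  let ?M = "m + m"
  let ?L = "?M * p + w0"
  let ?c = "1 - 2 / 2 ^ (?M * (2 * k)) :: real"
  let ?A = "(2 ^ m * (2 ^ a - int k), 2 ^ m * (2 ^ (a + 1) - int k))"
  let ?T = "tuples (replicate k (2 ^ ?M))"
  let ?Z = "\<lambda>Z cs w. (Z w + vertex w cs) div 2 ^ ?M"
  let ?s = "\<lambda>cs. \<Prod>w\<in>bools k. tm ?M (Z w + vertex w cs) * tm ?M (Z' w + vertex w cs)"
  let ?f = "\<lambda>cs. ?s cs * signed_average k ?L (?Z Z cs) (?Z Z' cs)"
  define B where "B = damp ?M ?c ?A p (x div 2 ^ ?M) (y div 2 ^ ?M)"
  have eq: "signed_average k (?M * Suc p + w0) Z Z' = mean ?T ?f"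
    using signed_average_split[of k ?M ?L Z Z'] by (simp add: algebra_simps)
  have B: "\<bar>?f cs\<bar> \<le> B" if cs: "cs \<in> ?T" for cs
  proof -
    have v: "0 \<le> vertex w cs \<and> vertex w cs \<le> int k * (2 ^ ?M - 1)" if "w \<in> bools k" for w
      using vertex_bounds[OF cs, of w] that by (simp add: bools_def)
    have "\<bar>signed_average k ?L (?Z Z cs) (?Z Z' cs)\<bar> \<le> B"
      unfolding B_def by (rule Suc.IH; rule carry_bounds) (use v Suc.prems in blast)+
    then show ?thesis by (simp add: abs_mult abs_prod_tm)
  qed
  have ne: "finite ?T" "?T \<noteq> {}" by (auto simp: tuples_replicate_nonempty)
  show ?case
  proof (cases "(x mod 2 ^ ?M, y mod 2 ^ ?M) = ?A")
    case False
    have "\<bar>mean ?T ?f\<bar> \<le> mean ?T (\<lambda>_. B)"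
      by (rule order_trans[OF abs_mean_le mean_mono]) (rule B)
    then show ?thesis using False unfolding eq mean_const[OF ne] by (auto simp: B_def)
  next
    case True
    \<comment> \<open>The two tuples of digits whose contributions cancel.\<close>
    let ?c0 = "replicate k (0, 0) :: (int \<times> int) list"
    let ?c1 = "replicate k (0, 2 ^ m) :: (int \<times> int) list"
    have in_T: "replicate j (0, t) \<in> tuples (replicate j (2 ^ ?M))" if "0 \<le> t" "t < 2 ^ ?M" for j and t :: int
      using that by (induction j) auto
    have "(2::int) ^ m < 2 ^ ?M" by (rule power_strict_increasing) (auto simp: m)
    then have c: "?c0 \<in> ?T" "?c1 \<in> ?T" "?c0 \<noteq> ?c1"
      using in_T[of 0] in_T[of "2 ^ m"] k(1) by (auto simp: replicate_eq_replicate)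
    have "?f ?c1 = - ?f ?c0"
    proof -
      have "signed_average k ?L (?Z Z ?c1) (?Z Z' ?c1) = signed_average k ?L (?Z Z ?c0) (?Z Z' ?c0)"
        unfolding signed_average_def
        using True pattern_carry[OF k m, of x y Z Z'] Suc.prems
        by (intro mean_cong prod.cong refl) simp
      then show ?thesis
        using True pattern_sign[OF k m, of x y Z Z'] Suc.prems by simp
    qed
    from mean_cancel_pair[OF ne(1) c this B]
    have "\<bar>mean ?T ?f\<bar> \<le> (1 - 2 / real (card ?T)) * B" .
    also have "real (card ?T) = 2 ^ (?M * (2 * k))" by (simp only: card_tuples of_nat_power power_mult of_nat_numeral)
    finally show ?thesis using True unfolding eq by (simp add: B_def)
  qed
qed

declare tuples.simps(2) [simp del]

lemma mean_affine_odd: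
  fixes g :: "int \<Rightarrow> real"
  assumes g: "\<And>r h. g (r + 2 ^ w * h) = g r" and "odd c"
  shows "mean {0..<2 ^ w} (\<lambda>r. g (u + c * r)) = mean {0..<2 ^ w} g"
proof -
  let ?f = "\<lambda>r. (u + c * r) mod 2 ^ w"
  have inj: "inj_on ?f {0..<2 ^ w}"
  proof (rule inj_onI)
    fix r r' :: int
    assume r: "r \<in> {0..<2 ^ w}" "r' \<in> {0..<2 ^ w}" and eq: "?f r = ?f r'"
    from eq have "2 ^ w dvd c * (r - r')" by (simp add: mod_eq_dvd_iff algebra_simps)
    moreover have "coprime (2 ^ w) c" using \<open>odd c\<close> by simp
    ultimately have "2 ^ w dvd r - r'" by (simp add: coprime_dvd_mult_right_iff)
    then have "r mod 2 ^ w = r' mod 2 ^ w" by (simp add: mod_eq_dvd_iff)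
    with r show "r = r'" by simp
  qed
  have "?f ` {0..<2 ^ w} \<subseteq> {0..<2 ^ w}" by auto
  with inj have "bij_betw ?f {0..<2 ^ w} {0..<2 ^ w}"
    by (simp add: bij_betw_def endo_inj_surj)
  moreover have "g (?f r) = g (u + c * r)" for r
    using g[of "?f r" "(u + c * r) div 2 ^ w"] by (simp add: mult.commute)
  ultimately show ?thesis using mean_reindex[of ?f "{0..<2 ^ w}" "{0..<2 ^ w}" g] by simp
qed

lemma mean_pairs_affine_odd:
  fixes g :: "int \<Rightarrow> int \<Rightarrow> real"
  assumes "\<And>r s h. g (r + 2 ^ w * h) s = g r s" "\<And>r s h. g r (s + 2 ^ w * h) = g r s" and "odd c"
  shows "mean (pairs (2 ^ w)) (\<lambda>p. g (u + c * fst p) (u + c * snd p)) = mean (pairs (2 ^ w)) (\<lambda>p. g (fst p) (snd p))"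
proof -
  have "mean (pairs (2 ^ w)) (\<lambda>p. g (u + c * fst p) (u + c * snd p))
    = mean {0..<2 ^ w} (\<lambda>r. mean {0..<2 ^ w} (\<lambda>s. g (u + c * r) (u + c * s)))"
    by (simp add: mean_Times)
  also have "\<dots> = mean {0..<2 ^ w} (\<lambda>r. mean {0..<2 ^ w} (\<lambda>s. g (u + c * r) s))"
    by (simp only: mean_affine_odd[where c = c and g = "g x" for x, OF assms(2,3)])
  also have "\<dots> = mean {0..<2 ^ w} (\<lambda>r. mean {0..<2 ^ w} (\<lambda>s. g r s))"
    by (rule mean_affine_odd) (simp_all add: assms)
  finally show ?thesis by (simp add: mean_Times)
qed

definition reduce :: "nat \<Rightarrow> (int \<times> int) list \<Rightarrow> (int \<times> int) list" where
  "reduce w ss = map (\<lambda>p. (fst p mod 2 ^ w, snd p mod 2 ^ w)) ss"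

lemma reduce_Cons: "reduce w (p # ss) = (fst p mod 2 ^ w, snd p mod 2 ^ w) # reduce w ss"
  by (simp add: reduce_def)

lemma reduce_reduce [simp]: "reduce w (reduce w ss) = reduce w ss"
  by (simp add: reduce_def)

text \<open>
  Multiplication by an odd number permutes the residues modulo a power of two, so odd coefficients in
  front of uniformly distributed shifts can be dropped.
\<close>

lemma mean_dilate_odd:
  assumes "\<And>ss. H (reduce w ss) = H ss" and "\<And>c. c \<in> set cs \<Longrightarrow> odd c"
  shows "mean (tuples (replicate (length cs) (2 ^ w))) (\<lambda>rs. H (dilate cs rs))
    = mean (tuples (replicate (length cs) (2 ^ w))) H"
  using assms
proof (induction cs arbitrary: H)
  case Nil
  then show ?case by (simp add: mean_def)
next
  case (Cons c cs)
  let ?T = "tuples (replicate (length cs) (2 ^ w))"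
  have H: "H ((a, b) # ss) = H ((a', b') # ss')"
    if "a mod 2 ^ w = a' mod 2 ^ w" "b mod 2 ^ w = b' mod 2 ^ w" "reduce w ss = reduce w ss'" for a b a' b' ss ss'
    using that Cons.prems(1)[of "(a, b) # ss"] Cons.prems(1)[of "(a', b') # ss'"] by (simp add: reduce_Cons)
  have IH: "mean ?T (\<lambda>rs. H (p # dilate cs rs)) = mean ?T (\<lambda>rs. H (p # rs))" for p
  proof (cases p)
    case (Pair a b)
    show ?thesis unfolding Pair
      by (rule Cons.IH) (rule H, use Cons.prems(2) in simp_all)
  qed
  define g where "g a b = mean ?T (\<lambda>rs. H ((a, b) # rs))" for a b
  have "mean (tuples (replicate (length (c # cs)) (2 ^ w))) (\<lambda>rs. H (dilate (c # cs) rs))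
    = mean (pairs (2 ^ w)) (\<lambda>p. g (0 + c * fst p) (0 + c * snd p))"
    by (simp add: mean_tuples_Cons IH g_def)
  also have "\<dots> = mean (pairs (2 ^ w)) (\<lambda>p. g (fst p) (snd p))"
    by (rule mean_pairs_affine_odd) (use Cons.prems(2) in \<open>auto simp: g_def intro!: mean_cong H\<close>)
  finally show ?case by (simp add: mean_tuples_Cons g_def)
qed

lemma vertex_reduce: "vertex \<omega> (reduce w ss) mod 2 ^ w = vertex \<omega> ss mod 2 ^ w"
proof (induction ss arbitrary: \<omega>)
  case Nil then show ?case by (simp add: reduce_def)
next
  case (Cons p ss)
  show ?case
  proof (cases \<omega>)
    case (Cons b \<omega>')
    have "(q mod 2 ^ w + vertex \<omega>' (reduce w ss)) mod 2 ^ w = (q + vertex \<omega>' ss) mod 2 ^ w" for q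
      by (rule mod_add_cong) (simp_all add: Cons.IH)
    then show ?thesis by (simp add: Cons reduce_Cons)
  qed simp
qed

lemma cube_reduce: "cube (reduce w ss) (tm w) u = cube ss (tm w) u"
  unfolding cube_def by (rule prod.cong) (auto simp: reduce_def[of w ss, THEN arg_cong, of length]
    intro!: tm_cong mod_add_cong vertex_reduce)

lemma damp_periodic:
  "damp M c A p (x + 2 ^ (M * p) * h) y = damp M c A p x y"
  "damp M c A p x (y + 2 ^ (M * p) * h) = damp M c A p x y"
proof (induction p arbitrary: x y)
  case (Suc p)
  have e: "z + 2 ^ (M * Suc p) * h = z + 2 ^ M * (2 ^ (M * p) * h)" for z :: int
    by (simp add: power_add)
  have d: "(z + 2 ^ M * t) div 2 ^ M = z div 2 ^ M + t" "(z + 2 ^ M * t) mod 2 ^ M = z mod 2 ^ M" for z t :: int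
    by simp_all
  { case 1 show ?case unfolding e damp.simps d Suc.IH .. }
  { case 2 show ?case unfolding e damp.simps d Suc.IH .. }
qed auto

text \<open>
  For uniformly distributed base points the blocks are independent, and each shows the pattern with
  probability \<open>1 / 2 ^ (2 * M)\<close>.
\<close>

lemma mean_damp:
  assumes A: "A \<in> pairs (2 ^ M)"
  shows "mean (pairs (2 ^ (M * p))) (\<lambda>q. damp M c A p (fst q) (snd q)) = (1 - (1 - c) / 2 ^ (2 * M)) ^ p"
proof (induction p)
  case 0
  then show ?case by (simp add: mean_def)
next
  case (Suc p)
  have c: "real (card (pairs (2 ^ M))) = 2 ^ (2 * M)"
    by (simp add: card_cartesian_product power_add mult_2)
  have "(\<Sum>q\<in>pairs (2 ^ M). if q = A then c else 1) = (\<Sum>q\<in>pairs (2 ^ M). 1 + (if q = A then c - 1 else 0))"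
    by (rule sum.cong) auto
  also have "\<dots> = 2 ^ (2 * M) + (c - 1)"
    using A by (simp add: sum.distrib card_cartesian_product power_add mult_2)
  finally have first: "mean (pairs (2 ^ M)) (\<lambda>q. if q = A then c else 1) = 1 - (1 - c) / 2 ^ (2 * M)"
    unfolding mean_def c by (simp add: field_simps)
  have step: "damp M c A (Suc p) (fst q + 2 ^ M * fst r) (snd q + 2 ^ M * snd r)
      = (if q = A then c else 1) * damp M c A p (fst r) (snd r)" if "q \<in> pairs (2 ^ M)" for q r
    using that by auto
  have "mean (pairs (2 ^ (M * Suc p))) (\<lambda>q. damp M c A (Suc p) (fst q) (snd q))
    = mean (pairs (2 ^ M)) (\<lambda>q. mean (pairs (2 ^ (M * p)))
        (\<lambda>r. damp M c A (Suc p) (fst q + 2 ^ M * fst r) (snd q + 2 ^ M * snd r)))"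
    using mean_pairs_split[of M "M * p" "\<lambda>q. damp M c A (Suc p) (fst q) (snd q)"] by simp
  also have "\<dots> = mean (pairs (2 ^ M)) (\<lambda>q. mean (pairs (2 ^ (M * p)))
        (\<lambda>r. (if q = A then c else 1) * damp M c A p (fst r) (snd r)))"
    by (rule mean_cong, rule mean_cong, rule step)
  also have "\<dots> = mean (pairs (2 ^ M)) (\<lambda>q. (1 - (1 - c) / 2 ^ (2 * M)) ^ p * (if q = A then c else 1))"
    unfolding mean_cmult Suc.IH by (subst mult.commute) (rule mean_cmult)
  finally show ?case unfolding mean_cmult first by simp
qed

lemma vertex_dilate_mult:
  "vertex \<omega> (dilate (map (\<lambda>c. e * c) cs) rs) = e * vertex \<omega> (dilate cs rs)"
proof (induction cs arbitrary: \<omega> rs)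
  case (Cons c cs)
  then show ?case by (cases \<omega>; cases rs) (auto simp: algebra_simps)
qed simp

text \<open>
  If all shifts are multiples of \<open>2 ^ v\<close>, then the lowest \<open>v\<close> digits are the same at all vertices, and
  their signs cancel because the number of vertices is even.
\<close>

lemma cube_high_digits:
  assumes "cs \<noteq> []" "length rs = length cs"
  shows "cube (dilate (map (\<lambda>c. 2 ^ v * c) cs) rs) (tm (v + w)) u = cube (dilate cs rs) (tm w) (u div 2 ^ v)"
proof -
  have "cube (dilate (map (\<lambda>c. 2 ^ v * c) cs) rs) (tm (v + w)) u
    = (\<Prod>\<omega>\<in>bools (length cs). tm v u) * cube (dilate cs rs) (tm w) (u div 2 ^ v)"
    unfolding cube_def using assms by (simp add: vertex_dilate_mult tm_split prod.distrib)
  also have "(\<Prod>\<omega>\<in>bools (length cs). tm v u) = 1"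
    using tm_cases[of v u] assms by (auto simp: uminus_power_if)
  finally show ?thesis by simp
qed

text \<open>
  The first direction is used only with a short range of shifts, \<open>r < 2 ^ (M * p)\<close>: it makes the two base
  points uniformly distributed modulo \<open>2 ^ (M * p)\<close>. The other \<open>k\<close> directions run over complete residue
  systems and provide the average to which the block argument applies. Only the digits of the base
  points below \<open>M * p\<close> contribute to the decay, so the first direction may be shorter than the window.
\<close>

lemma mean_cube_decay:
  fixes k a m v p w0 :: nat
  defines "M \<equiv> m + m"
  assumes k: "1 \<le> k" "k \<le> 2 ^ a" and m: "m = a + 2" and w: "w = M * p + w0"
    and cs: "length cs = k" "\<And>c. c \<in> set (c0 # cs) \<Longrightarrow> odd c"
  shows "mean (tuples (2 ^ (M * p) # replicate k (2 ^ w)))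
      (\<lambda>rs. cube (dilate (map (\<lambda>c. 2 ^ v * c) (c0 # cs)) rs) (tm (v + w)) u)
    \<le> (1 - 2 / 2 ^ (M * (2 * k)) / 2 ^ (2 * M)) ^ p"
proof -
  define x where "x = u div 2 ^ v"
  define C where "C = 1 - 2 / (2::real) ^ (M * (2 * k))"
  define A where "A = (2 ^ m * (2 ^ a - int k), 2 ^ m * (2 ^ (a + 1) - int k))"
  let ?T = "tuples (replicate k (2 ^ w))"
  have A: "A \<in> pairs (2 ^ M)"
  proof -
    have "int k \<le> int (2 ^ a)" using k by linarith
    then have k': "int k \<le> 2 ^ a" by simp
    have "2 ^ m * t < (2::int) ^ M" if "t < 2 ^ m" for t
      using that by (simp add: M_def power_add)
    moreover have "2 ^ a - int k < 2 ^ m" "2 ^ (a + 1) - int k < 2 ^ m"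
    proof -
      have "(2::int) ^ m = 4 * 2 ^ a" "(2::int) ^ (a + 1) = 2 * 2 ^ a" "(0::int) < 2 ^ a" by (simp_all add: m power_add)
      then show "2 ^ a - int k < 2 ^ m" "2 ^ (a + 1) - int k < 2 ^ m" by linarith+
    qed
    moreover have "0 \<le> 2 ^ a - int k" "0 \<le> 2 ^ (a + 1) - int k"
      using k' zero_le_power[of "2::int" a] unfolding power_add power_one_right by linarith+
    then have "0 \<le> 2 ^ m * (2 ^ a - int k)" "0 \<le> 2 ^ m * (2 ^ (a + 1) - int k)"
      by (intro mult_nonneg_nonneg; simp)+
    ultimately show ?thesis
      unfolding A_def by (simp only: mem_Sigma_iff atLeastLessThan_iff of_nat_power of_nat_numeral)
  qed
  have inner: "\<bar>mean ?T (\<lambda>rs. cube (dilate cs rs) (tm w) y * cube (dilate cs rs) (tm w) z)\<bar> \<le> damp M C A p y z" for y z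
  proof -
    have "mean ?T (\<lambda>rs. cube (dilate cs rs) (tm w) y * cube (dilate cs rs) (tm w) z)
      = mean ?T (\<lambda>rs. cube rs (tm w) y * cube rs (tm w) z)"
      using mean_dilate_odd[of "\<lambda>ss. cube ss (tm w) y * cube ss (tm w) z" w cs] cs by (simp add: cube_reduce)
    also have "\<dots> = signed_average k (M * p + w0) (\<lambda>_. y) (\<lambda>_. z)"
      unfolding signed_average_def w[symmetric]
      by (rule mean_cong) (simp add: cube_def length_tuples prod.distrib)
    finally show ?thesis
      using signed_average_decay[OF k m, of y "\<lambda>_. y" z "\<lambda>_. z" p w0] by (simp add: M_def C_def A_def)
  qed
  have "mean (tuples (2 ^ (M * p) # replicate k (2 ^ w)))
      (\<lambda>rs. cube (dilate (map (\<lambda>c. 2 ^ v * c) (c0 # cs)) rs) (tm (v + w)) u)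
    = mean (tuples (2 ^ (M * p) # replicate k (2 ^ w))) (\<lambda>rs. cube (dilate (c0 # cs) rs) (tm w) x)"
    unfolding x_def by (rule mean_cong, rule cube_high_digits) (auto simp: cs dest: length_tuples)
  also have "\<dots> = mean (pairs (2 ^ (M * p))) (\<lambda>q. mean ?T (\<lambda>rs. cube (dilate cs rs) (tm w) (x + c0 * fst q)
      * cube (dilate cs rs) (tm w) (x + c0 * snd q)))"
    by (simp add: mean_tuples_Cons cube_Cons)
  also have "\<dots> \<le> mean (pairs (2 ^ (M * p))) (\<lambda>q. damp M C A p (x + c0 * fst q) (x + c0 * snd q))"
    by (rule mean_mono) (rule order_trans[OF abs_ge_self inner])
  also have "\<dots> = mean (pairs (2 ^ (M * p))) (\<lambda>q. damp M C A p (fst q) (snd q))"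
    by (rule mean_pairs_affine_odd) (use cs in \<open>auto simp: damp_periodic\<close>)
  also have "\<dots> = (1 - (1 - C) / 2 ^ (2 * M)) ^ p"
    by (rule mean_damp[OF A])
  finally show ?thesis by (simp add: C_def)
qed

section \<open>Removing digits\<close>

definition near :: "int \<Rightarrow> int \<Rightarrow> int \<Rightarrow> bool" where
  "near M \<delta> A \<longleftrightarrow> (\<exists>m. \<bar>A - m * M\<bar> \<le> \<delta>)"

lemma far_div:
  assumes "\<not> near M \<delta> A" "M > 0" "\<bar>t\<bar> \<le> \<delta>"
  shows "(A + t) div M = A div M"
proof -
  have "\<bar>A - (A div M) * M\<bar> > \<delta>" "\<bar>A - (A div M + 1) * M\<bar> > \<delta>"
    using assms(1) unfolding near_def by (meson not_le)+
  moreover have "A mod M = A - A div M * M" by (simp add: minus_div_mult_eq_mod)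
  moreover have "(A div M + 1) * M = A div M * M + M" by (simp add: distrib_right)
  moreover have "0 \<le> A mod M" "A mod M < M" using assms by auto
  ultimately have r: "0 \<le> A mod M + t" "A mod M + t < M" using assms(3) by linarith+
  have "A + t = (A mod M + t) + M * (A div M)" by simp
  then have "(A + t) div M = A div M + (A mod M + t) div M" using assms(2)
    by (metis add.commute div_mult_self2 less_irrefl)
  with r show ?thesis by simp
qed

text \<open>
  If one direction does not change \<open>G\<close>, then the vertices cancel in pairs along this direction.
\<close>

lemma cube_eq_1:
  assumes "i < length ss" "\<And>v. G v * G v = (1 :: real)"
    and "\<And>\<omega>. \<omega> \<in> bools (length ss) \<Longrightarrow>
      G (u + vertex \<omega> (ss[i := (0, 0)]) + fst (ss ! i)) = G (u + vertex \<omega> (ss[i := (0, 0)]) + snd (ss ! i))"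
  shows "cube ss G u = 1"
  using assms
proof (induction ss arbitrary: u i)
  case (Cons p ss)
  show ?case
  proof (cases i)
    case 0
    have "cube ss G (u + fst p) = cube ss G (u + snd p)"
      unfolding cube_def
    proof (rule prod.cong[OF refl])
      fix \<omega> assume "\<omega> \<in> bools (length ss)"
      then show "G (u + fst p + vertex \<omega> ss) = G (u + snd p + vertex \<omega> ss)"
        using Cons.prems(3)[of "False # \<omega>"] by (simp add: 0 bools_def ac_simps)
    qed
    moreover have "cube ss G v * cube ss G v = 1" for v
      unfolding cube_mult[symmetric] Cons.prems(2) by (simp add: cube_def)
    ultimately show ?thesis by (simp add: cube_Cons)
  next
    case (Suc j)
    have "cube ss G (u + fst p) = 1"
    proof (rule Cons.IH)
      fix \<omega> assume "\<omega> \<in> bools (length ss)"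
      then show "G (u + fst p + vertex \<omega> (ss[j := (0, 0)]) + fst (ss ! j)) = G (u + fst p + vertex \<omega> (ss[j := (0, 0)]) + snd (ss ! j))"
        using Cons.prems(3)[of "False # \<omega>"] by (simp add: Suc bools_def ac_simps)
    qed (use Cons.prems Suc in auto)
    moreover have "cube ss G (u + snd p) = 1"
    proof (rule Cons.IH)
      fix \<omega> assume "\<omega> \<in> bools (length ss)"
      then show "G (u + snd p + vertex \<omega> (ss[j := (0, 0)]) + fst (ss ! j)) = G (u + snd p + vertex \<omega> (ss[j := (0, 0)]) + snd (ss ! j))"
        using Cons.prems(3)[of "True # \<omega>"] by (simp add: Suc bools_def ac_simps)
    qed (use Cons.prems Suc in auto)
    ultimately show ?thesis by (simp add: cube_Cons)
  qed
qed simp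

text \<open>
  A direction \<open>K\<close> close to a multiple of \<open>2 ^ L\<close> shifts residues modulo \<open>2 ^ L\<close> only slightly. Unless some
  vertex lies near a multiple of \<open>2 ^ L'\<close>, no carry crosses position \<open>L'\<close>, so the digits from \<open>L'\<close> to \<open>L - 1\<close>
  are constant along this direction and disappear from the product.
\<close>

lemma truncate_window:
  fixes K t :: int
  assumes i: "i < length ss" "ss ! i = (K * r, K * r')" and K: "K = t * 2 ^ L + \<Delta>"
    and \<delta>: "\<bar>\<Delta> * r\<bar> \<le> \<delta>" "\<bar>\<Delta> * r'\<bar> \<le> \<delta>" and L: "L' \<le> L"
    and far: "\<And>\<omega>. \<omega> \<in> bools (length ss) \<Longrightarrow> \<not> near (2 ^ L') \<delta> (u + vertex \<omega> (ss[i := (0, 0)]))"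
  shows "cube ss (tm L) u = cube ss (tm L') u"
proof -
  define G where "G v = tm (L - L') (v div 2 ^ L')" for v
  have *: "G (A + K * s) = G A" if "\<not> near (2 ^ L') \<delta> A" "\<bar>\<Delta> * s\<bar> \<le> \<delta>" for A s
  proof -
    define A' where "A' = A + \<Delta> * s"
    have "A + K * s = A' + 2 ^ L' * (2 ^ (L - L') * (t * s))"
      using L by (simp add: K A'_def algebra_simps flip: power_add)
    then have "(A + K * s) div 2 ^ L' = (A + \<Delta> * s) div 2 ^ L' + 2 ^ (L - L') * (t * s)"
      unfolding A'_def[symmetric] by simp
    also have "(A + \<Delta> * s) div 2 ^ L' = A div 2 ^ L'" using that by (intro far_div) auto
    finally show ?thesis by (simp add: G_def tm_periodic)
  qed
  have "tm L = (\<lambda>v. tm L' v * G v)"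
    using tm_add[of L' "L - L'"] L by (intro ext) (simp add: G_def)
  then have "cube ss (tm L) u = cube ss (\<lambda>v. tm L' v * G v) u" by simp
  also have "\<dots> = cube ss (tm L') u * cube ss G u" by (rule cube_mult)
  also have "cube ss G u = 1"
    by (rule cube_eq_1[OF i(1)]) (simp_all add: i(2) * far \<delta> G_def[symmetric, abs_def] del: mult_minus_left, simp add: G_def)
  finally show ?thesis by simp
qed

lemma cube_affine:
  "cube (dilate cs rs) (\<lambda>v. F (v * d + b)) u = cube (dilate (map (\<lambda>c. c * d) cs) rs) F (u * d + b)"
proof (induction cs arbitrary: rs u)
  case (Cons c cs)
  then show ?case by (cases rs) (simp_all add: cube_Cons algebra_simps)
qed simp

lemma nth_dilate: "i < length cs \<Longrightarrow> i < length rs \<Longrightarrow> dilate cs rs ! i = (cs ! i * fst (rs ! i), cs ! i * snd (rs ! i))"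
  by (simp add: dilate_def split_def)

text \<open>
  All digits above \<open>lam 0\<close> are removed, direction \<open>i\<close> being responsible for those between \<open>lam i\<close> and
  \<open>lam (Suc i)\<close>. The points with an unwanted carry are counted by \<open>B\<close>, for every direction and vertex.
\<close>

lemma sum_truncate:
  fixes ds :: "(int \<times> nat) list" and lam :: "nat \<Rightarrow> nat" and \<delta> :: "nat \<Rightarrow> int" and B :: "nat \<Rightarrow> real" and d b :: int
  defines "q \<equiv> length ds"
  assumes rs: "rs \<in> tuples (map snd ds)"
    and dir: "\<And>i. i < q \<Longrightarrow> \<exists>t \<Delta>. fst (ds ! i) * d = t * 2 ^ lam (Suc i) + \<Delta> \<and> \<bar>\<Delta>\<bar> * int (snd (ds ! i)) \<le> \<delta> i"
    and lam: "\<And>i. i < q \<Longrightarrow> lam i \<le> lam (Suc i)"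
    and B: "\<And>i b'. i < q \<Longrightarrow> real (card {n. n < N \<and> near (2 ^ lam i) (\<delta> i) (int n * d + b')}) \<le> B i"
  shows "(\<Sum>n<N. cube (dilate (map (\<lambda>p. fst p * d) ds) rs) (tm (lam q)) (int n * d + b))
     \<le> (\<Sum>n<N. cube (dilate (map (\<lambda>p. fst p * d) ds) rs) (tm (lam 0)) (int n * d + b)) + 2 * 2 ^ q * (\<Sum>i<q. B i)"
proof -
  define ss where "ss = dilate (map (\<lambda>p. fst p * d) ds) rs"
  have len: "length rs = q" "length ss = q" using length_tuples[OF rs] by (simp_all add: q_def ss_def)
  define bad where "bad i \<omega> = {n. n < N \<and> near (2 ^ lam i) (\<delta> i) (int n * d + (b + vertex \<omega> (ss[i := (0, 0)])))}" for i \<omega>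
  \<comment> \<open>\<open>S\<close> collects the points with an unwanted carry for some direction and vertex.\<close>
  define S where "S = (\<Union>i<q. \<Union>\<omega>\<in>bools q. bad i \<omega>)"
  have "S \<subseteq> {..<N}" by (auto simp: S_def bad_def)
  then have fin: "finite S" by (rule finite_subset) simp
  have good: "cube ss (tm (lam j)) (int n * d + b) = cube ss (tm (lam 0)) (int n * d + b)"
    if n: "n < N" "n \<notin> S" and "j \<le> q" for n j
    using \<open>j \<le> q\<close>
  proof (induction j)
    case (Suc j)
    then have j: "j < q" by simp
    obtain t \<Delta> where t: "fst (ds ! j) * d = t * 2 ^ lam (Suc j) + \<Delta>" "\<bar>\<Delta>\<bar> * int (snd (ds ! j)) \<le> \<delta> j"
      using dir[OF j] by blast
    have r: "fst (rs ! j) \<in> {0..<int (snd (ds ! j))}" "snd (rs ! j) \<in> {0..<int (snd (ds ! j))}"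
      using nth_tuples[OF rs, of j] j by (auto simp: q_def)
    have small: "\<bar>\<Delta> * s\<bar> \<le> \<delta> j" if "s \<in> {0..<int (snd (ds ! j))}" for s
    proof -
      have "\<bar>\<Delta> * s\<bar> \<le> \<bar>\<Delta>\<bar> * int (snd (ds ! j))"
        unfolding abs_mult using that by (intro mult_left_mono) auto
      with t(2) show ?thesis by linarith
    qed
    have "cube ss (tm (lam (Suc j))) (int n * d + b) = cube ss (tm (lam j)) (int n * d + b)"
    proof (rule truncate_window[OF _ _ t(1)])
      show "ss ! j = (fst (ds ! j) * d * fst (rs ! j), fst (ds ! j) * d * snd (rs ! j))"
        using j len by (simp add: ss_def nth_dilate q_def)
      fix \<omega> assume "\<omega> \<in> bools (length ss)"
      then show "\<not> near (2 ^ lam j) (\<delta> j) (int n * d + b + vertex \<omega> (ss[j := (0, 0)]))"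
        using n j len unfolding S_def bad_def by (auto simp: add.assoc)
    qed (use j len small r lam in auto)
    with Suc show ?case by simp
  qed simp
  have "(\<Sum>n<N. cube ss (tm (lam q)) (int n * d + b))
     \<le> (\<Sum>n<N. cube ss (tm (lam 0)) (int n * d + b) + (if n \<in> S then 2 else 0))"
  proof (rule sum_mono)
    fix n assume "n \<in> {..<N}"
    moreover have "cube ss (tm (lam q)) (int n * d + b) \<le> 1" "- 1 \<le> cube ss (tm (lam 0)) (int n * d + b)"
      using abs_cube_tm[of ss "lam q" "int n * d + b"] abs_cube_tm[of ss "lam 0" "int n * d + b"] by linarith+
    ultimately show "cube ss (tm (lam q)) (int n * d + b) \<le> cube ss (tm (lam 0)) (int n * d + b) + (if n \<in> S then 2 else 0)"
      using good[of n q] by auto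
  qed
  also have "\<dots> = (\<Sum>n<N. cube ss (tm (lam 0)) (int n * d + b)) + 2 * real (card S)"
    using \<open>S \<subseteq> {..<N}\<close> by (simp add: sum.distrib sum.If_cases Int_absorb1)
  also have "real (card S) \<le> 2 ^ q * (\<Sum>i<q. B i)"
  proof -
    have "card S \<le> (\<Sum>i<q. \<Sum>\<omega>\<in>bools q. card (bad i \<omega>))"
      unfolding S_def by (rule order_trans[OF card_UN_le[OF finite_lessThan] sum_mono]) (rule card_UN_le, simp)
    then have "real (card S) \<le> (\<Sum>i<q. \<Sum>\<omega>\<in>bools q. real (card (bad i \<omega>)))"
      by (metis (mono_tags, lifting) of_nat_le_iff of_nat_sum sum.cong)
    also have "\<dots> \<le> (\<Sum>i<q. \<Sum>\<omega>\<in>bools q. B i)"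
      unfolding bad_def by (intro sum_mono B) simp
    finally show ?thesis by (simp add: sum_distrib_left)
  qed
  finally show ?thesis by (simp add: ss_def)
qed

text \<open>
  The estimate for one modulus \<open>d\<close>: van der Corput in all directions, removal of the digits above
  \<open>lam 0\<close>, and decay of the remaining cube averages. The exact power of two in \<open>K * d\<close> is prescribed so
  that all shifts are equidistributed on the same subgroup \<open>2 ^ v * \<int>\<close>.
\<close>

lemma progression_estimate:
  fixes k a m v p w w_rest N N' :: nat and K_first :: int and Ks :: "int list" and d b :: int and lam :: "nat \<Rightarrow> nat"
    and \<delta> :: "nat \<Rightarrow> int" and B :: "nat \<Rightarrow> real"
  defines "M \<equiv> m + m"
  defines "ds \<equiv> (K_first, 2 ^ (M * p)) # map (\<lambda>K. (K, 2 ^ w)) Ks"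
  defines "E \<equiv> 3 ^ Suc k * (\<Sum>(K, R)\<leftarrow>ds. 4 * real_of_int K * real R / real N)"
  assumes k: "1 \<le> k" "k \<le> 2 ^ a" and m: "m = a + 2" and w: "w = M * p + w_rest"
    and Ks: "length Ks = k" "\<And>K. K \<in> set (K_first # Ks) \<Longrightarrow> K \<ge> 0 \<and> 2 ^ v dvd K * d \<and> odd (K * d div 2 ^ v)"
    and N: "N' \<le> N" "N > 0" and E: "E \<le> 1"
    and dir: "\<And>i. i < Suc k \<Longrightarrow> \<exists>t \<Delta>. fst (ds ! i) * d = t * 2 ^ lam (Suc i) + \<Delta> \<and> \<bar>\<Delta>\<bar> * int (snd (ds ! i)) \<le> \<delta> i"
    and lam: "\<And>i. i < Suc k \<Longrightarrow> lam i \<le> lam (Suc i)" "lam 0 = v + w"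
    and B: "\<And>i b'. i < Suc k \<Longrightarrow> real (card {n. n < N' \<and> near (2 ^ lam i) (\<delta> i) (int n * d + b')}) \<le> B i"
  shows "((\<Sum>n<N'. tm (lam (Suc k)) (int n * d + b)) / real N) ^ (2 ^ Suc k)
    \<le> (1 - 2 / 2 ^ (M * (2 * k)) / 2 ^ (2 * M)) ^ p + 2 * 2 ^ Suc k * (\<Sum>i<Suc k. B i) / real N + E"
proof -
  define f where "f = (\<lambda>u. tm (lam (Suc k)) (u * d + b))"
  define C where "C = 1 - 2 / (2::real) ^ (M * (2 * k)) / 2 ^ (2 * M)"
  define cs where "cs = map (\<lambda>K. K * d div 2 ^ v) Ks"
  define W where "W = 2 * 2 ^ Suc k * (\<Sum>i<Suc k. B i)"
  let ?T = "tuples (map snd ds)"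
  let ?Ds = "map (\<lambda>p. fst p * d) ds"
  have len: "length ds = Suc k" using Ks by (simp add: ds_def)
  have T: "?T = tuples (2 ^ (M * p) # replicate k (2 ^ w))"
    using Ks by (simp add: ds_def comp_def map_replicate_const)
  have Ds: "?Ds = map (\<lambda>c. 2 ^ v * c) ((K_first * d div 2 ^ v) # cs)"
    using Ks(2) by (auto simp: ds_def cs_def comp_def)
  have ne: "finite ?T" "?T \<noteq> {}" by (auto intro!: tuples_nonempty simp: ds_def)
  have C0: "0 \<le> C ^ p"
  proof -
    have "2 / (2::real) ^ (M * (2 * k)) \<le> 1"
    proof -
      have "(2::real) ^ 1 \<le> 2 ^ (M * (2 * k))" using k m by (intro power_increasing) (auto simp: M_def)
      then show ?thesis by simp
    qed
    then have "2 / (2::real) ^ (M * (2 * k)) / 2 ^ (2 * M) \<le> 1 / 1"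
      by (intro frac_le) auto
    then show ?thesis by (simp add: C_def)
  qed
  have decay: "mean ?T (\<lambda>rs. cube (dilate ?Ds rs) (tm (lam 0)) u) \<le> C ^ p" for u
    unfolding Ds T lam(2) C_def M_def
    by (rule mean_cube_decay[OF k m]) (use w Ks in \<open>auto simp: M_def cs_def\<close>)
  have "((\<Sum>n<N'. f (int n)) / real N) ^ (2 ^ length ds)
    \<le> mean ?T (\<lambda>rs. (\<Sum>n<N'. cube (dilate (map fst ds) rs) f (int n)) / real N)
      + 3 ^ length ds * (\<Sum>(K, R)\<leftarrow>ds. 4 * real_of_int K * real R / real N)"
  proof (rule iterated_van_der_Corput[OF _ N])
    show "3 ^ length ds * (\<Sum>(K, R)\<leftarrow>ds. 4 * real_of_int K * real R / real N) \<le> 1"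
      using E by (simp only: E_def len)
  qed (use Ks(2) in \<open>auto simp: f_def ds_def\<close>)
  also have "\<dots> = mean ?T (\<lambda>rs. (\<Sum>n<N'. cube (dilate ?Ds rs) (tm (lam (Suc k))) (int n * d + b)) / real N) + E"
    by (simp add: f_def cube_affine comp_def E_def len)
  also have "mean ?T (\<lambda>rs. (\<Sum>n<N'. cube (dilate ?Ds rs) (tm (lam (Suc k))) (int n * d + b)) / real N)
    \<le> mean ?T (\<lambda>rs. (\<Sum>n<N'. cube (dilate ?Ds rs) (tm (lam 0)) (int n * d + b)) / real N + W / real N)"
  proof (rule mean_mono)
    fix rs assume rs: "rs \<in> ?T"
    have "(\<Sum>n<N'. cube (dilate ?Ds rs) (tm (lam (Suc k))) (int n * d + b))
      \<le> (\<Sum>n<N'. cube (dilate ?Ds rs) (tm (lam 0)) (int n * d + b)) + W"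
      using sum_truncate[OF rs, where lam = lam and \<delta> = \<delta> and B = B and d = d and b = b and N = N'] dir lam(1) B
      by (simp add: len W_def)
    then show "(\<Sum>n<N'. cube (dilate ?Ds rs) (tm (lam (Suc k))) (int n * d + b)) / real N
      \<le> (\<Sum>n<N'. cube (dilate ?Ds rs) (tm (lam 0)) (int n * d + b)) / real N + W / real N"
      by (simp add: add_divide_distrib[symmetric] divide_right_mono)
  qed
  also have "\<dots> = (\<Sum>n<N'. mean ?T (\<lambda>rs. cube (dilate ?Ds rs) (tm (lam 0)) (int n * d + b))) / real N + W / real N"
    unfolding mean_add mean_const[OF ne] mean_sum by (simp add: mean_def sum_divide_distrib mult.commute)
  also have "(\<Sum>n<N'. mean ?T (\<lambda>rs. cube (dilate ?Ds rs) (tm (lam 0)) (int n * d + b))) / real N \<le> real N' * C ^ p / real N"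
  proof -
    have "(\<Sum>n<N'. mean ?T (\<lambda>rs. cube (dilate ?Ds rs) (tm (lam 0)) (int n * d + b))) \<le> (\<Sum>n<N'. C ^ p)"
      by (rule sum_mono) (rule decay)
    then show ?thesis by (intro divide_right_mono) auto
  qed
  also have "real N' * C ^ p / real N \<le> C ^ p"
    using N C0 by (simp add: divide_simps mult_right_mono mult.commute)
  finally show ?thesis by (simp add: f_def len C_def W_def)
qed

section \<open>Counting near multiples of powers of two\<close>

lemma card_multiples_le:
  fixes q L H :: int
  assumes "q > 0" "L \<le> H"
  shows "finite {n. L \<le> n * q \<and> n * q \<le> H}"
    and "real (card {n. L \<le> n * q \<and> n * q \<le> H}) \<le> real_of_int (H - L) / real_of_int q + 1"
proof -
  have eq: "{n. L \<le> n * q \<and> n * q \<le> H} = {\<lceil>real_of_int L / real_of_int q\<rceil>..\<lfloor>real_of_int H / real_of_int q\<rfloor>}"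
    using assms(1) by (auto simp: ceiling_le_iff le_floor_iff field_simps simp flip: of_int_mult)
  show "finite {n. L \<le> n * q \<and> n * q \<le> H}" unfolding eq by simp
  have "real_of_int L / real_of_int q \<le> real_of_int H / real_of_int q"
    using assms by (simp add: divide_right_mono)
  then show "real (card {n. L \<le> n * q \<and> n * q \<le> H}) \<le> real_of_int (H - L) / real_of_int q + 1"
    unfolding eq using le_of_int_ceiling[of "real_of_int L / real_of_int q"] of_int_floor_le[of "real_of_int H / real_of_int q"]
    by (cases "0 \<le> \<lfloor>real_of_int H / real_of_int q\<rfloor> - \<lceil>real_of_int L / real_of_int q\<rceil> + 1")
       (simp_all only: card_atLeastAtMost_int of_nat_nat, simp_all add: diff_divide_distrib, linarith+)
qed

text \<open>
  Counting multiples of \<open>M\<close> first and then the points near each of them. This is the count of choice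
  when \<open>q\<close> is not large compared with \<open>\<delta>\<close>.
\<close>

lemma card_near_progression:
  fixes q M \<delta> b :: int
  assumes "q > 0" "M > 0" "0 \<le> \<delta>" "2 * \<delta> \<le> M"
  shows "real (card {n. n < N \<and> near M \<delta> (int n * q + b)})
    \<le> (real N * real_of_int q / real_of_int M + 2) * (2 * real_of_int \<delta> / real_of_int q + 1)"
proof -
  \<comment> \<open>\<open>J\<close> indexes the multiples of \<open>M\<close> that are relevant, \<open>I m\<close> the points near one of them.\<close>
  define J where "J = {m. b - \<delta> \<le> m * M \<and> m * M \<le> b + int N * q + \<delta>}"
  define I where "I m = {n. n < N \<and> \<bar>int n * q + b - m * M\<bar> \<le> \<delta>}" for m
  have Nq: "0 \<le> int N * q" using assms by simp
  have J: "finite J" "real (card J) \<le> real N * real_of_int q / real_of_int M + 2"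
  proof -
    have LH: "b - \<delta> \<le> b + int N * q + \<delta>" using assms Nq by linarith
    show "finite J" unfolding J_def by (rule card_multiples_le(1)[OF \<open>M > 0\<close> LH])
    have "2 * real_of_int \<delta> / real_of_int M \<le> 1" using assms by (simp add: field_simps)
    then show "real (card J) \<le> real N * real_of_int q / real_of_int M + 2"
      using card_multiples_le(2)[OF \<open>M > 0\<close> LH] unfolding J_def[symmetric]
      by (simp add: add_divide_distrib)
  qed
  have I: "real (card (I m)) \<le> 2 * real_of_int \<delta> / real_of_int q + 1" for m
  proof -
    let ?A = "{n. m * M - b - \<delta> \<le> n * q \<and> n * q \<le> m * M - b + \<delta>}"
    have LH: "m * M - b - \<delta> \<le> m * M - b + \<delta>" using assms by simp
    have "card (I m) \<le> card ?A"
      by (rule card_inj_on_le[where f = int]) (auto simp: I_def card_multiples_le(1)[OF \<open>q > 0\<close> LH])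
    then show ?thesis using card_multiples_le(2)[OF \<open>q > 0\<close> LH] by simp
  qed
  have "{n. n < N \<and> near M \<delta> (int n * q + b)} \<subseteq> (\<Union>m\<in>J. I m)"
  proof
    fix n assume "n \<in> {n. n < N \<and> near M \<delta> (int n * q + b)}"
    then obtain m where n: "n < N" "\<bar>int n * q + b - m * M\<bar> \<le> \<delta>" by (auto simp: near_def)
    have "0 \<le> int n * q" "int n * q \<le> int N * q" using n assms by (auto intro: mult_right_mono)
    then have "m \<in> J" using n unfolding J_def by (simp add: abs_le_iff)
    with n show "n \<in> (\<Union>m\<in>J. I m)" by (auto simp: I_def)
  qed
  then have "card {n. n < N \<and> near M \<delta> (int n * q + b)} \<le> card (\<Union>m\<in>J. I m)"
    by (rule card_mono[rotated]) (auto simp: J I_def)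
  also have "\<dots> \<le> (\<Sum>m\<in>J. card (I m))" by (rule card_UN_le) (rule J)
  finally have "real (card {n. n < N \<and> near M \<delta> (int n * q + b)}) \<le> (\<Sum>m\<in>J. real (card (I m)))"
    by (metis of_nat_le_iff of_nat_sum)
  also have "\<dots> \<le> (\<Sum>m\<in>J. 2 * real_of_int \<delta> / real_of_int q + 1)" by (rule sum_mono) (rule I)
  also have "\<dots> = real (card J) * (2 * real_of_int \<delta> / real_of_int q + 1)" by simp
  also have "\<dots> \<le> (real N * real_of_int q / real_of_int M + 2) * (2 * real_of_int \<delta> / real_of_int q + 1)"
    using J assms by (intro mult_right_mono) auto
  finally show ?thesis .
qed

text \<open>
  Over complete periods the numbers \<open>q * d\<close> are equidistributed on the multiples of \<open>gcd q M\<close>. A solution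
  \<open>d\<close> is determined by its quotient by the period \<open>M div g\<close> and the deviation of \<open>q * d\<close> from a multiple of \<open>M\<close>.
\<close>

lemma card_near_periods:
  fixes M c :: nat and q \<delta> :: int
  assumes "q > 0" "M > 0" "\<delta> \<ge> 0"
  defines "D \<equiv> M * c" and "g \<equiv> gcd q (int M)"
  shows "real (card {d. D \<le> d \<and> d < 2 * D \<and> near (int M) \<delta> (q * int d)}) \<le> real c * (2 * real_of_int \<delta> + real_of_int g)"
proof -
  have g: "g > 0" using assms by (simp add: g_def)
  define q1 where "q1 = q div g"
  define M1 where "M1 = int M div g"
  have q1: "q = g * q1" and M1: "int M = g * M1" by (simp_all add: q1_def M1_def g_def)
  have M1_pos: "M1 > 0" using g assms(2) M1 by (metis of_nat_0_less_iff zero_less_mult_pos)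
  have cop: "coprime q1 M1"
    unfolding q1_def M1_def g_def using assms by (intro div_gcd_coprime) auto
  define S where "S = {d. D \<le> d \<and> d < 2 * D \<and> near (int M) \<delta> (q * int d)}"
  \<comment> \<open>\<open>T\<close> consists of the possible deviations, divided by \<open>g\<close>.\<close>
  define T where "T = {t. - \<delta> \<le> t * g \<and> t * g \<le> \<delta>}"
  have \<delta>: "- \<delta> \<le> \<delta>" using assms by simp
  have T: "finite T" "real (card T) \<le> 2 * real_of_int \<delta> / real_of_int g + 1"
    using card_multiples_le[OF g \<delta>] by (simp_all add: T_def)
  have "\<exists>t\<in>T. \<exists>m. q1 * int d - m * M1 = t" if d: "d \<in> S" for d
  proof -
    obtain m where "\<bar>q * int d - m * int M\<bar> \<le> \<delta>" using d unfolding S_def near_def by blast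
    then have "\<bar>(q1 * int d - m * M1) * g\<bar> \<le> \<delta>" by (simp add: q1 M1 algebra_simps)
    then have "q1 * int d - m * M1 \<in> T" by (simp add: T_def abs_le_iff)
    then show ?thesis by blast
  qed
  then obtain t where t: "\<And>d. d \<in> S \<Longrightarrow> t d \<in> T \<and> (\<exists>m. q1 * int d - m * M1 = t d)" by metis
  let ?f = "\<lambda>d. (int d div M1, t d)"
  let ?I = "{g * int c..<2 * (g * int c)}"
  have D: "int D = g * int c * M1" using M1 by (simp add: D_def)
  have inj: "inj_on ?f S"
  proof (rule inj_onI)
    fix d d' assume d: "d \<in> S" "d' \<in> S" and eq: "?f d = ?f d'"
    obtain m m' where "q1 * int d - m * M1 = t d" "q1 * int d' - m' * M1 = t d'" using t d by meson
    with eq have "q1 * (int d - int d') = M1 * (m - m')" by (simp add: algebra_simps)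
    then have "M1 dvd q1 * (int d - int d')" by simp
    then have "M1 dvd int d - int d'" using cop coprime_commute coprime_dvd_mult_right_iff by blast
    then have "int d mod M1 = int d' mod M1" by (simp add: mod_eq_dvd_iff)
    moreover have "int d div M1 = int d' div M1" using eq by simp
    ultimately have "M1 * (int d div M1) + int d mod M1 = M1 * (int d' div M1) + int d' mod M1" by (simp only:)
    then have "int d = int d'" by (simp only: mult_div_mod_eq)
    then show "d = d'" by simp
  qed
  have sub: "?f ` S \<subseteq> ?I \<times> T"
  proof (rule image_subsetI)
    fix d assume d: "d \<in> S"
    then have "int D \<le> int d" "int d < 2 * int D" by (auto simp: S_def)
    then have l: "g * int c * M1 \<le> int d" and u: "int d < 2 * (g * int c) * M1" by (simp_all add: D)
    have "g * int c \<le> int d div M1" using zdiv_mono1[OF l M1_pos] M1_pos by simp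
    moreover have "int d div M1 < 2 * (g * int c)"
    proof -
      have "M1 * (int d div M1) \<le> int d"
        using mult_div_mod_eq[of M1 "int d"] pos_mod_sign[OF M1_pos, of "int d"] by linarith
      then have "M1 * (int d div M1) < M1 * (2 * (g * int c))" using u by (simp add: mult.commute)
      then show ?thesis using M1_pos by simp
    qed
    ultimately show "?f d \<in> ?I \<times> T" using t d by simp
  qed
  have "card S \<le> card (?I \<times> T)" by (rule card_inj_on_le[OF inj sub]) (simp add: T)
  also have "\<dots> = nat (g * int c) * card T" by (simp add: card_cartesian_product)
  finally have "real (card S) \<le> real (nat (g * int c) * card T)" by (rule of_nat_mono)
  also have "\<dots> = real (nat (g * int c)) * real (card T)" by (rule of_nat_mult)
  also have "\<dots> \<le> real (nat (g * int c)) * (2 * real_of_int \<delta> / real_of_int g + 1)"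
    using T by (intro mult_left_mono) auto
  also have "\<dots> = real c * (2 * real_of_int \<delta> + real_of_int g)"
    using g by (simp add: field_simps)
  finally show ?thesis by (simp add: S_def)
qed

text \<open>
  Differences of two solutions are solutions of the homogeneous problem. The right-hand side does not
  depend on \<open>b\<close>; this is how the maximum over residue classes is controlled before averaging over \<open>d\<close>.
\<close>

lemma card_near_le_differences:
  fixes d M \<delta> b :: int
  shows "card {n. n < N \<and> near M \<delta> (int n * d + b)} \<le> 1 + 2 * card {h. 1 \<le> h \<and> h < N \<and> near M (2 * \<delta>) (int h * d)}"
proof -
  define S where "S = {n. n < N \<and> near M \<delta> (int n * d + b)}"
  define H where "H = {h. 1 \<le> h \<and> h < N \<and> near M (2 * \<delta>) (int h * d)}"
  have fin: "finite H" unfolding H_def by simp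
  show ?thesis
  proof (cases "S = {}")
    case False
    then obtain n0 where n0: "n0 \<in> S" by blast
    have diff: "x - y \<in> H" if xy: "x \<in> S" "y \<in> S" "y < x" for x y
    proof -
      obtain m m' where m: "\<bar>int x * d + b - m * M\<bar> \<le> \<delta>" "\<bar>int y * d + b - m' * M\<bar> \<le> \<delta>"
        using xy by (auto simp: S_def near_def)
      have "int (x - y) * d - (m - m') * M = (int x * d + b - m * M) - (int y * d + b - m' * M)"
        using xy by (simp add: of_nat_diff algebra_simps)
      with m have "\<bar>int (x - y) * d - (m - m') * M\<bar> \<le> 2 * \<delta>" by linarith
      then show ?thesis using xy unfolding H_def near_def S_def by auto
    qed
    have "S \<subseteq> insert n0 ((\<lambda>h. n0 + h) ` H \<union> (\<lambda>h. n0 - h) ` H)"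
    proof
      fix n assume n: "n \<in> S"
      consider "n = n0" | "n0 < n" | "n < n0" by linarith
      then show "n \<in> insert n0 ((\<lambda>h. n0 + h) ` H \<union> (\<lambda>h. n0 - h) ` H)"
      proof cases
        case 2
        then have "n = n0 + (n - n0)" "n - n0 \<in> H" using diff n n0 by auto
        then show ?thesis by blast
      next
        case 3
        then have "n = n0 - (n0 - n)" "n0 - n \<in> H" using diff n n0 by auto
        then show ?thesis by blast
      qed simp
    qed
    then have "card S \<le> card (insert n0 ((\<lambda>h. n0 + h) ` H \<union> (\<lambda>h. n0 - h) ` H))"
      using fin by (intro card_mono) auto
    also have "\<dots> \<le> Suc (card ((\<lambda>h. n0 + h) ` H \<union> (\<lambda>h. n0 - h) ` H))" by (rule card_insert_le_m1) simp_all
    also have "card ((\<lambda>h. n0 + h) ` H \<union> (\<lambda>h. n0 - h) ` H) \<le> card H + card H"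
      by (rule order_trans[OF card_Un_le add_mono]) (intro card_image_le fin)+
    finally show ?thesis unfolding S_def H_def by simp
  qed (simp add: S_def[symmetric])
qed

lemma power_two_dvd_mult:
  fixes q d :: int
  assumes "2 ^ (s + P) dvd q * d" "\<not> 2 ^ P dvd d"
  shows "2 ^ Suc s dvd q"
  using assms
proof (induction P arbitrary: d)
  case (Suc P)
  show ?case
  proof (cases "even d")
    case True
    then obtain d' where d': "d = 2 * d'" by (elim evenE)
    have "2 * 2 ^ (s + P) dvd 2 * (q * d')" using Suc.prems(1) by (simp add: d' mult_ac)
    then have "2 ^ (s + P) dvd q * d'" by (simp only: dvd_mult_cancel_left) simp
    moreover have "\<not> 2 ^ P dvd d'" using Suc.prems(2) by (simp add: d')
    ultimately show ?thesis by (rule Suc.IH)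
  next
    case False
    then have "coprime (2 ^ (s + Suc P)) d" by simp
    then have "2 ^ (s + Suc P) dvd q" using Suc.prems(1) by (simp add: coprime_dvd_mult_left_iff)
    moreover have "(2::int) ^ Suc s dvd 2 ^ (s + Suc P)" by (rule le_imp_power_dvd) simp
    ultimately show ?thesis by (rule dvd_trans[rotated])
  qed
qed simp

lemma card_multiples_nat:
  assumes "r > 0"
  shows "real (card {h. 1 \<le> h \<and> h < N \<and> r dvd h}) \<le> real N / real r"
proof -
  have "{h. 1 \<le> h \<and> h < N \<and> r dvd h} \<subseteq> (\<lambda>j. r * j) ` {1..N div r}"
  proof
    fix h assume h: "h \<in> {h. 1 \<le> h \<and> h < N \<and> r dvd h}"
    then obtain j where "h = r * j" by (auto elim: dvdE)
    with h assms show "h \<in> (\<lambda>j. r * j) ` {1..N div r}"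
      by (auto simp: less_eq_div_iff_mult_less_eq mult.commute)
  qed
  then have "card {h. 1 \<le> h \<and> h < N \<and> r dvd h} \<le> card {1..N div r}"
    by (rule surj_card_le[rotated]) simp
  then have "real (card {h. 1 \<le> h \<and> h < N \<and> r dvd h}) \<le> real (N div r)" by simp
  also have "\<dots> \<le> real N / real r" by (rule of_nat_div_le_of_nat)
  finally show ?thesis .
qed

lemma gcd_power_two_cases:
  fixes q :: int
  assumes "gcd q (2 ^ L) > 2 ^ e"
  shows "2 ^ Suc e dvd q"
proof -
  have "gcd q (2 ^ L) dvd 2 ^ L" by simp
  then obtain j where j: "gcd q (2 ^ L) = 2 ^ j"
    using divides_primepow_weak[of "2::int" "gcd q (2 ^ L)" L] by auto
  with assms have "e < j" by (simp add: power_strict_increasing_iff)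
  then have "(2::int) ^ Suc e dvd 2 ^ j" by (intro le_imp_power_dvd) simp
  also have "2 ^ j dvd q" using j by (metis gcd_dvd1)
  finally show ?thesis .
qed

text \<open>
  Exchange the sums and count \<open>d\<close> for fixed \<open>h\<close>. The count is poor only when \<open>h\<close> has a large
  common divisor with \<open>2 ^ L\<close>, which is rare among \<open>h < N\<close>.
\<close>

lemma sum_card_near:
  fixes L c e N :: nat
  defines "D \<equiv> 2 ^ L * c"
  shows "(\<Sum>d\<in>{D..<2 * D}. real (card {h. 1 \<le> h \<and> h < N \<and> near (2 ^ L) (2 ^ e) (int h * int d)}))
    \<le> real D * real N * (3 * 2 ^ e / 2 ^ L + 1 / 2 ^ e)"
proof -
  let ?n = "\<lambda>h d. near (2 ^ L) (2 ^ e) (int h * int d)"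
  have card_sum: "real (card {x. x \<in> A \<and> Q x}) = (\<Sum>x\<in>A. if Q x then 1 else 0)"
    if "finite A" for A :: "nat set" and Q
    using that by (simp add: sum.If_cases Collect_conj_eq)
  have "(\<Sum>d\<in>{D..<2 * D}. real (card {h. 1 \<le> h \<and> h < N \<and> ?n h d}))
      = (\<Sum>d\<in>{D..<2 * D}. \<Sum>h\<in>{1..<N}. if ?n h d then 1 else 0)"
    using card_sum[of "{1..<N}"] by simp
  also have "\<dots> = (\<Sum>h\<in>{1..<N}. \<Sum>d\<in>{D..<2 * D}. if ?n h d then 1 else 0)" by (rule sum.swap)
  also have "\<dots> = (\<Sum>h\<in>{1..<N}. real (card {d. D \<le> d \<and> d < 2 * D \<and> ?n h d}))"
    using card_sum[of "{D..<2 * D}"] by (simp add: conj_assoc)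
  also have "\<dots> \<le> (\<Sum>h\<in>{1..<N}. real c * (3 * 2 ^ e) + (if 2 ^ e dvd h then real D else 0))"
  proof (rule sum_mono)
    fix h assume h: "h \<in> {1..<N}"
    have triv: "card {d. D \<le> d \<and> d < 2 * D \<and> ?n h d} \<le> card {D..<2 * D}"
      by (rule card_mono) auto
    show "real (card {d. D \<le> d \<and> d < 2 * D \<and> ?n h d}) \<le> real c * (3 * 2 ^ e) + (if 2 ^ e dvd h then real D else 0)"
    proof (cases "gcd (int h) (2 ^ L) > 2 ^ e")
      case True
      then have "2 ^ Suc e dvd int h" by (rule gcd_power_two_cases)
      then have "2 ^ e dvd int h" by (metis dvd_trans le_imp_power_dvd le_SucI order_refl)
      then have "2 ^ e dvd h" by (metis int_dvd_int_iff of_nat_numeral of_nat_power)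
      then show ?thesis using triv by (simp add: add_increasing)
    next
      case False
      then have "real_of_int (gcd (int h) (2 ^ L)) \<le> 2 ^ e"
        by (metis not_less of_int_le_iff of_int_numeral of_int_power)
      then have "2 * 2 ^ e + real_of_int (gcd (int h) (2 ^ L)) \<le> 3 * 2 ^ e" by linarith
      then have "real c * (2 * 2 ^ e + real_of_int (gcd (int h) (2 ^ L))) \<le> real c * (3 * 2 ^ e)"
        by (rule mult_left_mono) simp
      with card_near_periods[of "int h" "2 ^ L" "2 ^ e" c] h
      have "real (card {d. D \<le> d \<and> d < 2 * D \<and> ?n h d}) \<le> real c * (3 * 2 ^ e)" unfolding D_def by simp
      then show ?thesis by (simp add: add_increasing2)
    qed
  qed
  also have "\<dots> = real (N - 1) * (real c * (3 * 2 ^ e)) + real D * real (card {h. 1 \<le> h \<and> h < N \<and> 2 ^ e dvd h})"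
  proof -
    have "(\<Sum>h\<in>{1..<N}. if 2 ^ e dvd h then real D else 0) = real D * (\<Sum>h\<in>{1..<N}. if 2 ^ e dvd h then 1 else 0)"
      by (simp add: sum_distrib_left if_distrib cong: if_cong)
    then show ?thesis using card_sum[of "{1..<N}" "\<lambda>h. 2 ^ e dvd h"] by (simp add: sum.distrib)
  qed
  also have "\<dots> \<le> real N * (real c * (3 * 2 ^ e)) + real D * (real N / 2 ^ e)"
    using card_multiples_nat[of "2 ^ e" N] by (intro add_mono mult_right_mono mult_left_mono) auto
  also have "\<dots> = real D * real N * (3 * 2 ^ e / 2 ^ L + 1 / 2 ^ e)"
    by (simp add: D_def field_simps)
  finally show ?thesis .
qed

lemma card_exists_multiple:
  fixes R :: "int \<Rightarrow> nat \<Rightarrow> bool"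
  assumes "finite A" "P \<le> \<tau>"
    and R: "\<And>q. 1 \<le> q \<Longrightarrow> q \<le> 2 ^ \<tau> \<Longrightarrow> 2 ^ P dvd q \<Longrightarrow> real (card {d \<in> A. R q d}) \<le> X"
  shows "real (card {d \<in> A. \<exists>q. 1 \<le> q \<and> q \<le> 2 ^ \<tau> \<and> 2 ^ P dvd q \<and> R q d}) \<le> 2 ^ (\<tau> - P) * X"
proof -
  let ?Q = "(\<lambda>j. 2 ^ P * int j) ` {1..2 ^ (\<tau> - P)}"
  have \<tau>: "(2::int) ^ \<tau> = 2 ^ P * 2 ^ (\<tau> - P)" using \<open>P \<le> \<tau>\<close> by (simp flip: power_add)
  have Q: "1 \<le> q \<and> q \<le> 2 ^ \<tau> \<and> 2 ^ P dvd q" if "q \<in> ?Q" for q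
  proof -
    from that obtain j where j: "q = 2 ^ P * int j" "1 \<le> j" "j \<le> 2 ^ (\<tau> - P)" by auto
    then have "int j \<le> 2 ^ (\<tau> - P)" by (metis of_nat_le_iff of_nat_numeral of_nat_power)
    then have "q \<le> 2 ^ \<tau>" unfolding \<tau> j by (intro mult_left_mono) auto
    moreover have "1 * 1 \<le> (2::int) ^ P * int j" using j by (intro mult_mono) auto
    ultimately show ?thesis using j by simp
  qed
  have "{d \<in> A. \<exists>q. 1 \<le> q \<and> q \<le> 2 ^ \<tau> \<and> 2 ^ P dvd q \<and> R q d} \<subseteq> (\<Union>q\<in>?Q. {d \<in> A. R q d})"
  proof clarify
    fix d q assume d: "d \<in> A" "1 \<le> q" "q \<le> 2 ^ \<tau>" "2 ^ P dvd q" "R q d"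
    then obtain i where i: "q = 2 ^ P * i" unfolding dvd_def by blast
    have "0 < 2 ^ P * i" using d(2) unfolding i by linarith
    then have "i \<ge> 1" by (simp add: zero_less_mult_iff)
    moreover have "i \<le> 2 ^ (\<tau> - P)" using d(3) unfolding i \<tau> by simp
    ultimately have "q = 2 ^ P * int (nat i)" "nat i \<in> {1..2 ^ (\<tau> - P)}"
      using i by (auto simp: nat_le_iff)
    then show "d \<in> (\<Union>q\<in>?Q. {d \<in> A. R q d})" using d by blast
  qed
  then have "card {d \<in> A. \<exists>q. 1 \<le> q \<and> q \<le> 2 ^ \<tau> \<and> 2 ^ P dvd q \<and> R q d} \<le> card (\<Union>q\<in>?Q. {d \<in> A. R q d})"
    using assms by (intro card_mono) auto
  also have "\<dots> \<le> (\<Sum>q\<in>?Q. card {d \<in> A. R q d})" by (rule card_UN_le) simp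
  finally have "real (card {d \<in> A. \<exists>q. 1 \<le> q \<and> q \<le> 2 ^ \<tau> \<and> 2 ^ P dvd q \<and> R q d}) \<le> real (\<Sum>q\<in>?Q. card {d \<in> A. R q d})"
    by (rule of_nat_mono)
  also have "\<dots> = (\<Sum>q\<in>?Q. real (card {d \<in> A. R q d}))" by (rule of_nat_sum)
  also have "\<dots> \<le> (\<Sum>q\<in>?Q. X)" using Q R by (intro sum_mono) blast
  also have "\<dots> = 2 ^ (\<tau> - P) * X" by (simp add: card_image inj_on_def)
  finally show ?thesis .
qed

text \<open>
  Only few \<open>d\<close> possess a highly even multiplier \<open>q\<close> with \<open>q * d\<close> near a multiple of \<open>2 ^ L\<close>: there are
  \<open>2 ^ (\<tau> - P)\<close> candidates \<open>q\<close>, and each works for a proportion of about \<open>2 ^ (- \<tau>)\<close> of the \<open>d\<close>. If the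
  common divisor of \<open>q\<close> and \<open>2 ^ L\<close> exceeds the allowed distance, then \<open>2 ^ L\<close> divides \<open>q * d\<close>, which is
  incompatible with the bounds on the powers of two in \<open>q\<close> and \<open>d\<close>.
\<close>

lemma card_bad_multiplier_low:
  fixes L c \<tau> P :: nat
  defines "D \<equiv> 2 ^ L * c"
  assumes "\<tau> + P \<le> L" "P \<le> \<tau>"
  shows "real (card {d \<in> {D..<2 * D}. \<exists>q. 1 \<le> q \<and> q \<le> 2 ^ \<tau> \<and> 2 ^ P dvd q \<and>
      \<not> 2 ^ P dvd d \<and> near (2 ^ L) (2 ^ (L - \<tau>)) (q * int d)}) \<le> 3 * real D / 2 ^ P"
proof -
  have "real (card {d \<in> {D..<2 * D}. \<exists>q. 1 \<le> q \<and> q \<le> 2 ^ \<tau> \<and> 2 ^ P dvd q \<and>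
      (\<not> 2 ^ P dvd d \<and> near (2 ^ L) (2 ^ (L - \<tau>)) (q * int d))}) \<le> 2 ^ (\<tau> - P) * (real c * (3 * 2 ^ (L - \<tau>)))"
  proof (rule card_exists_multiple)
    fix q :: int assume q: "1 \<le> q" "q \<le> 2 ^ \<tau>" "2 ^ P dvd q"
    show "real (card {d \<in> {D..<2 * D}. \<not> 2 ^ P dvd d \<and> near (2 ^ L) (2 ^ (L - \<tau>)) (q * int d)}) \<le> real c * (3 * 2 ^ (L - \<tau>))"
    proof (cases "gcd q (2 ^ L) > 2 ^ (L - \<tau>)")
      case True
      have e: "{d \<in> {D..<2 * D}. \<not> 2 ^ P dvd d \<and> near (2 ^ L) (2 ^ (L - \<tau>)) (q * int d)} = {}"
      proof (rule ccontr)
        assume "\<not> ?thesis"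
        then obtain d m where d: "\<not> 2 ^ P dvd d" "\<bar>q * int d - m * 2 ^ L\<bar> \<le> 2 ^ (L - \<tau>)"
          by (auto simp: near_def)
        have "gcd q (2 ^ L) dvd q * int d - m * 2 ^ L" by simp
        moreover have "\<bar>q * int d - m * 2 ^ L\<bar> < gcd q (2 ^ L)" using d True by linarith
        ultimately have "q * int d - m * 2 ^ L = 0" by (metis abs_of_nonneg dvd_imp_le_int gcd_ge_0_int not_le)
        then have "2 ^ L dvd q * int d" by (metis dvd_triv_right eq_iff_diff_eq_0)
        moreover have "(2::int) ^ (\<tau> + P) dvd 2 ^ L" using assms by (intro le_imp_power_dvd)
        ultimately have "2 ^ (\<tau> + P) dvd q * int d" by (rule dvd_trans[rotated])
        moreover have "\<not> 2 ^ P dvd int d" using d(1) by (metis int_dvd_int_iff of_nat_numeral of_nat_power)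
        ultimately have "2 ^ Suc \<tau> dvd q" by (rule power_two_dvd_mult)
        then have "2 ^ Suc \<tau> \<le> q" using q by (intro zdvd_imp_le) auto
        then show False using q zero_less_power[of "2::int" \<tau>] by simp
      qed
      show ?thesis unfolding e by simp
    next
      case False
      then have "real_of_int (gcd q (2 ^ L)) \<le> 2 ^ (L - \<tau>)"
        by (metis not_less of_int_le_iff of_int_numeral of_int_power)
      then have "2 * 2 ^ (L - \<tau>) + real_of_int (gcd q (2 ^ L)) \<le> 3 * 2 ^ (L - \<tau>)" by linarith
      then have "real c * (2 * 2 ^ (L - \<tau>) + real_of_int (gcd q (2 ^ L))) \<le> real c * (3 * 2 ^ (L - \<tau>))"
        by (rule mult_left_mono) simp
      with card_near_periods[of q "2 ^ L" "2 ^ (L - \<tau>)" c] q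
      have "real (card {d. D \<le> d \<and> d < 2 * D \<and> near (2 ^ L) (2 ^ (L - \<tau>)) (q * int d)}) \<le> real c * (3 * 2 ^ (L - \<tau>))"
        unfolding D_def by simp
      moreover have "card {d \<in> {D..<2 * D}. \<not> 2 ^ P dvd d \<and> near (2 ^ L) (2 ^ (L - \<tau>)) (q * int d)}
        \<le> card {d. D \<le> d \<and> d < 2 * D \<and> near (2 ^ L) (2 ^ (L - \<tau>)) (q * int d)}"
        by (rule card_mono) auto
      ultimately show ?thesis by simp
    qed
  qed (use assms in auto)
  also have "2 ^ (\<tau> - P) * (real c * (3 * 2 ^ (L - \<tau>))) = 3 * real D / 2 ^ P"
    using assms by (simp add: D_def power_diff field_simps)
  finally show ?thesis by (simp add: conj_assoc)
qed

text \<open>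
  The same for \<open>2 ^ L\<close> larger than the moduli, where a dyadic block does not contain complete periods.
  A small \<open>q\<close> cannot occur, since \<open>q * d\<close> would lie strictly between \<open>0\<close> and \<open>2 ^ L\<close>, away from both; for the
  other \<open>q\<close> counting multiples in an interval is precise enough.
\<close>

lemma card_bad_multiplier_top:
  fixes L \<tau> P D :: nat
  assumes "2 * \<tau> \<le> L" "P \<le> \<tau>" "1 \<le> \<tau>" "2 ^ (L - \<tau>) < D"
  shows "real (card {d \<in> {D..<2 * D}. \<exists>q. 1 \<le> q \<and> q \<le> 2 ^ \<tau> \<and> 2 ^ P dvd q \<and>
      near (2 ^ L) (2 ^ (L - \<tau>)) (q * int d)}) \<le> 27 * real D / 2 ^ P"
proof -
  define \<delta> where "\<delta> = (2::int) ^ (L - \<tau>)"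
  have L: "(2::int) ^ L = 2 ^ \<tau> * \<delta>" using assms unfolding \<delta>_def by (simp flip: power_add)
  have L': "(2::real) ^ L = 2 ^ \<tau> * real_of_int \<delta>" using assms unfolding \<delta>_def by (simp flip: power_add)
  have \<delta>0: "\<delta> > 0" by (simp add: \<delta>_def)
  have "(2::int) ^ 1 \<le> 2 ^ \<tau>" using assms by (intro power_increasing) auto
  then have \<delta>2: "2 * \<delta> \<le> 2 ^ L" unfolding L using \<delta>0 by (intro mult_right_mono) auto
  have "(2::int) ^ \<tau> \<le> \<delta>" unfolding \<delta>_def using assms by (intro power_increasing) auto
  have \<delta>D: "\<delta> < int D"
  proof -
    have "int (2 ^ (L - \<tau>)) < int D" using assms(4) by (simp only: of_nat_less_iff)
    then show ?thesis by (simp add: \<delta>_def)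
  qed
  have "real (card {d \<in> {D..<2 * D}. \<exists>q. 1 \<le> q \<and> q \<le> 2 ^ \<tau> \<and> 2 ^ P dvd q \<and>
      near (2 ^ L) \<delta> (q * int d)}) \<le> 2 ^ (\<tau> - P) * (27 * real D / 2 ^ \<tau>)"
  proof (rule card_exists_multiple)
    fix q :: int assume q: "1 \<le> q" "q \<le> 2 ^ \<tau>" "2 ^ P dvd q"
    let ?S = "{d \<in> {D..<2 * D}. near (2 ^ L) \<delta> (q * int d)}"
    show "real (card ?S) \<le> 27 * real D / 2 ^ \<tau>"
    proof (cases "?S = {}")
      case False
      then obtain d m where d: "D \<le> d" "d < 2 * D" "\<bar>q * int d - m * 2 ^ L\<bar> \<le> \<delta>" by (auto simp: near_def)
      have "1 * int D \<le> q * int d" using q d by (intro mult_mono) auto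
      then have "m * 2 ^ L > 0" using d(3) \<delta>D by linarith
      then have "m \<ge> 1" by (simp add: zero_less_mult_iff)
      then have "1 * 2 ^ L \<le> m * 2 ^ L" by (intro mult_right_mono) auto
      then have "2 ^ L - \<delta> \<le> q * int d" using d(3) by linarith
      also have "q * int d \<le> q * (2 * int D)" using q d by (intro mult_left_mono) auto
      finally have "2 ^ L \<le> 4 * q * int D" using \<delta>2 by linarith
      then have "real_of_int (2 ^ L) \<le> real_of_int (4 * q * int D)" by (simp only: of_int_le_iff)
      then have c1: "1 \<le> 4 * (real D * real_of_int q / 2 ^ L)" by (simp add: field_simps)
      have c2: "1 \<le> real_of_int \<delta> / real_of_int q"
        using \<open>2 ^ \<tau> \<le> \<delta>\<close> q by simp
      have "card ?S \<le> card {n. n < D \<and> near (2 ^ L) \<delta> (int n * q + q * int D)}"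
      proof (rule card_inj_on_le[where f = "\<lambda>d. d - D"])
        show "inj_on (\<lambda>d. d - D) ?S" by (auto simp: inj_on_def)
        show "(\<lambda>d. d - D) ` ?S \<subseteq> {n. n < D \<and> near (2 ^ L) \<delta> (int n * q + q * int D)}"
          by (auto simp: of_nat_diff algebra_simps)
      qed simp
      then have "real (card ?S) \<le> (real D * real_of_int q / 2 ^ L + 2) * (2 * real_of_int \<delta> / real_of_int q + 1)"
        using card_near_progression[of q "2 ^ L" \<delta> D "q * int D"] q \<delta>0 \<delta>2 by simp
      also have "\<dots> \<le> (9 * (real D * real_of_int q / 2 ^ L)) * (3 * (real_of_int \<delta> / real_of_int q))"
      proof (rule mult_mono)
        have "y + 2 \<le> 9 * y" if "1 \<le> 4 * y" for y :: real using that by linarith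
        from this[OF c1] show "real D * real_of_int q / 2 ^ L + 2 \<le> 9 * (real D * real_of_int q / 2 ^ L)" .
        have "2 * y + 1 \<le> 3 * y" if "1 \<le> y" for y :: real using that by linarith
        from this[OF c2] show "2 * real_of_int \<delta> / real_of_int q + 1 \<le> 3 * (real_of_int \<delta> / real_of_int q)" by simp
      qed (use q \<delta>0 in auto)
      also have "\<dots> = 27 * real D / 2 ^ \<tau>" using q \<delta>0 unfolding L' by (simp add: field_simps)
      finally show ?thesis .
    next
      case True
      show ?thesis unfolding True by simp
    qed
  qed (use assms in auto)
  also have "2 ^ (\<tau> - P) * (27 * real D / 2 ^ \<tau>) = 27 * real D / 2 ^ P"
    using assms by (simp add: power_diff field_simps)
  finally show ?thesis by (simp add: \<delta>_def)
qed

section \<open>Moduli in a dyadic block\<close>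

text \<open>
  Missing factors 2 can be supplied to reach the valuation \<open>v\<close> exactly.
\<close>

lemma exists_power_two_multiplier:
  fixes n :: int
  assumes "\<not> 2 ^ v dvd n"
  shows "\<exists>j\<le>v. 2 ^ v dvd 2 ^ j * n \<and> odd (2 ^ j * n div 2 ^ v)"
  using assms
proof (induction v arbitrary: n)
  case (Suc v)
  show ?case
  proof (cases "even n")
    case True
    then obtain n' where n: "n = 2 * n'" by (elim evenE)
    with Suc.prems have "\<not> 2 ^ v dvd n'" by simp
    from Suc.IH[OF this] obtain j c where j: "j \<le> v" "2 ^ j * n' = 2 ^ v * c" "odd (2 ^ j * n' div 2 ^ v)"
      unfolding dvd_def by blast
    then have "2 ^ j * n = 2 ^ Suc v * c" "odd c" by (simp_all add: n)
    then have "2 ^ Suc v dvd 2 ^ j * n \<and> odd (2 ^ j * n div 2 ^ Suc v)" by simp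
    with j(1) show ?thesis using le_SucI by blast
  next
    case False
    then show ?thesis by (intro exI[of _ "Suc v"]) simp
  qed
qed simp

lemma Dirichlet_multiplier:
  fixes d :: int
  assumes "\<tau> \<le> L"
  shows "\<exists>q h. 1 \<le> q \<and> q \<le> 2 ^ \<tau> \<and> \<bar>q * d - h * 2 ^ L\<bar> \<le> 2 ^ (L - \<tau>)"
proof -
  have pos: "0 < (2::nat) ^ \<tau>" by simp
  obtain h q where q: "0 < q" "q \<le> int (2 ^ \<tau>)" "\<bar>of_int q * (real_of_int d / 2 ^ L) - of_int h\<bar> < 1 / real (2 ^ \<tau>)"
    by (rule Dirichlet_approx[OF pos, of "real_of_int d / 2 ^ L"]) (rule that)
  have "real_of_int \<bar>q * d - h * 2 ^ L\<bar> = \<bar>of_int q * (real_of_int d / 2 ^ L) - of_int h\<bar> * 2 ^ L"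
    by (simp add: abs_mult_pos left_diff_distrib)
  also have "\<dots> \<le> 1 / real (2 ^ \<tau>) * 2 ^ L" using q(3) by (intro mult_right_mono) auto
  also have "\<dots> = real_of_int (2 ^ (L - \<tau>))" using assms by (simp add: field_simps flip: power_add)
  finally have "\<bar>q * d - h * 2 ^ L\<bar> \<le> 2 ^ (L - \<tau>)" by (simp only: of_int_le_iff)
  then show ?thesis using q by (intro exI[of _ q] exI[of _ h]) auto
qed

text \<open>
  The digit positions bounding the blocks removed by the directions, for moduli of size \<open>2 ^ \<Lambda>\<close>; \<open>2 ^ P\<close> is
  a small power of \<open>x\<close>. The final window has \<open>5 * P\<close> digits: \<open>2 * P\<close> for the common power of two in the shifts
  and \<open>3 * P\<close> for the cube average. Intermediate steps remove \<open>P\<close> digits each. The topmost direction is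
  a power of two times \<open>d\<close> and removes everything above \<open>\<Lambda> + 6 * P + 1\<close>.
\<close>

definition window :: "nat \<Rightarrow> nat \<Rightarrow> nat \<Rightarrow> nat \<Rightarrow> nat \<Rightarrow> nat" where
  "window k P \<Lambda> L i = (if i = 0 then 5 * P else if i < k then (7 + i) * P else if i = k then \<Lambda> + 6 * P + 1 else L)"

text \<open>
  The multiplier for block \<open>i\<close> is at most \<open>2 ^ precision\<close> in size. Of these digits of approximation,
  \<open>2 * P\<close> are lost when the power of two is adjusted, \<open>3 * P\<close> (in the bottom block \<open>P\<close>) to the range of
  the shifts and \<open>P\<close> to make carries rare; the rest is the number of digits removed. The step below the topmost one also bridges
  the gap between \<open>\<Lambda> + 6 * P + 1\<close> and the largest intermediate position, which is at most \<open>\<Lambda>\<close>.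
\<close>

definition precision :: "nat \<Rightarrow> nat \<Rightarrow> nat \<Rightarrow> nat \<Rightarrow> nat" where
  "precision k P \<Lambda> i = (if Suc i < k then 7 * P else 12 * P + 1 + \<Lambda> mod P)"

text \<open>
  The exceptional moduli: \<open>d\<close> itself or a multiplier found for it could be too highly divisible by 2.
\<close>

definition resonant :: "nat \<Rightarrow> nat \<Rightarrow> nat \<Rightarrow> nat \<Rightarrow> nat \<Rightarrow> bool" where
  "resonant k P \<Lambda> L d \<longleftrightarrow> 2 ^ P dvd d \<or> (\<exists>i<k. \<exists>q. 1 \<le> q \<and> q \<le> 2 ^ precision k P \<Lambda> i \<and> 2 ^ P dvd q \<and>
     \<not> 2 ^ P dvd d \<and> near (2 ^ window k P \<Lambda> L (Suc i)) (2 ^ (window k P \<Lambda> L (Suc i) - precision k P \<Lambda> i)) (q * int d))"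

context
  fixes k P \<Lambda> L :: nat
  assumes k: "14 \<le> k" "k + 6 = \<Lambda> div P" and P: "1 \<le> P" and L: "\<Lambda> + 6 * P + 1 \<le> L"
begin

abbreviation "lam \<equiv> window k P \<Lambda> L"
abbreviation "prec \<equiv> precision k P \<Lambda>"

lemma \<Lambda>_eq: "\<Lambda> = (k + 6) * P + \<Lambda> mod P" "\<Lambda> mod P < P"
  using k P div_mult_mod_eq[of \<Lambda> P] by auto

lemma window_step:
  assumes "i < k"
  shows "prec i \<le> lam (Suc i)" "lam (Suc i) - prec i = (if i = 0 then P else lam i - 6 * P)"
    "prec i \<le> 13 * P" "P \<le> prec i" "5 * P \<le> lam i" "lam i \<le> \<Lambda>" "lam i \<le> lam (Suc i)" "i \<noteq> 0 \<Longrightarrow> 6 * P \<le> lam i"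
proof -
  define r where "r = \<Lambda> mod P"
  then have r: "\<Lambda> mod P = r" "r < P" and \<Lambda>: "\<Lambda> = k * P + 6 * P + r"
    using \<Lambda>_eq by (simp_all only: add_mult_distrib)
  have i: "i * P + P \<le> k * P"
    using mult_right_mono[of "Suc i" k P] assms by simp
  have k14: "14 * P \<le> k * P" using k by (intro mult_right_mono) auto
  consider "Suc i < k" | "Suc i = k" using assms by linarith
  then have "prec i \<le> lam (Suc i) \<and> lam (Suc i) - prec i = (if i = 0 then P else lam i - 6 * P) \<and>
      prec i \<le> 13 * P \<and> P \<le> prec i \<and> 5 * P \<le> lam i \<and> lam i \<le> \<Lambda> \<and> lam i \<le> lam (Suc i) \<and> (i \<noteq> 0 \<longrightarrow> 6 * P \<le> lam i)"
  proof cases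
    case 1
    then show ?thesis
      using i k14 r(2) \<Lambda> P by (auto simp: window_def precision_def add_mult_distrib)
  next
    case 2
    have "k * P = i * P + P" unfolding 2[symmetric] by simp
    moreover have "prec i = 12 * P + 1 + r" using 2 r(1) by (simp add: precision_def)
    moreover have "lam (Suc i) = \<Lambda> + 6 * P + 1" "lam i = 7 * P + i * P" "i \<noteq> 0"
      using 2 k(1) by (auto simp: window_def add_mult_distrib)
    ultimately show ?thesis using r(2) \<Lambda> by simp
  qed
  then show "prec i \<le> lam (Suc i)" "lam (Suc i) - prec i = (if i = 0 then P else lam i - 6 * P)"
    "prec i \<le> 13 * P" "P \<le> prec i" "5 * P \<le> lam i" "lam i \<le> \<Lambda>" "lam i \<le> lam (Suc i)" "i \<noteq> 0 \<Longrightarrow> 6 * P \<le> lam i"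
    by blast+
qed

text \<open>
  Dirichlet's approximation theorem gives \<open>q\<close>; for a non-resonant \<open>d\<close> neither \<open>q\<close> nor \<open>d\<close> is divisible by
  \<open>2 ^ P\<close>, so multiplying by a power of two at most \<open>2 ^ (2 * P)\<close> makes \<open>2 ^ (2 * P)\<close> the exact power in \<open>K * d\<close>.
\<close>

lemma direction_exists:
  assumes i: "i < k" and d: "\<not> resonant k P \<Lambda> L d"
  shows "\<exists>K t \<Delta>. 0 \<le> K \<and> K \<le> 2 ^ (15 * P) \<and> 2 ^ (2 * P) dvd K * int d \<and> odd (K * int d div 2 ^ (2 * P)) \<and>
    K * int d = t * 2 ^ lam (Suc i) + \<Delta> \<and> \<bar>\<Delta>\<bar> \<le> 2 ^ (2 * P + (lam (Suc i) - prec i))"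
proof -
  let ?L = "lam (Suc i)" and ?\<tau> = "prec i"
  obtain q h where q: "1 \<le> q" "q \<le> 2 ^ ?\<tau>" "\<bar>q * int d - h * 2 ^ ?L\<bar> \<le> 2 ^ (?L - ?\<tau>)"
    using Dirichlet_multiplier[OF window_step(1)[OF i]] by blast
  have d': "\<not> 2 ^ P dvd d" using d by (simp add: resonant_def)
  have "near (2 ^ ?L) (2 ^ (?L - ?\<tau>)) (q * int d)" using q(3) by (auto simp: near_def)
  then have q2: "\<not> 2 ^ P dvd q" using d d' i q(1,2) unfolding resonant_def by blast
  have d2: "\<not> 2 ^ P dvd int d" using d' by (metis int_dvd_int_iff of_nat_numeral of_nat_power)
  have "\<not> 2 ^ (2 * P) dvd q * int d"
  proof
    assume "2 ^ (2 * P) dvd q * int d"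
    then have "2 ^ (P + P) dvd q * int d" by (simp add: mult_2)
    then have "2 ^ Suc P dvd q" using d2 by (rule power_two_dvd_mult)
    then show False using q2 by (metis dvd_trans le_SucI le_imp_power_dvd order_refl)
  qed
  then obtain j where j: "j \<le> 2 * P" "2 ^ (2 * P) dvd 2 ^ j * (q * int d)" "odd (2 ^ j * (q * int d) div 2 ^ (2 * P))"
    using exists_power_two_multiplier by blast
  have j2: "(2::int) ^ j \<le> 2 ^ (2 * P)" using j(1) by (intro power_increasing) auto
  have "2 ^ j * q \<le> 2 ^ (2 * P) * 2 ^ ?\<tau>" using j2 q by (intro mult_mono) auto
  also have "\<dots> \<le> (2::int) ^ (15 * P)"
    using window_step(3)[OF i] by (simp flip: power_add)
  finally have K: "2 ^ j * q \<le> 2 ^ (15 * P)" .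
  have "\<bar>2 ^ j * (q * int d - h * 2 ^ ?L)\<bar> \<le> 2 ^ (2 * P) * 2 ^ (?L - ?\<tau>)"
    unfolding abs_mult using j2 q by (intro mult_mono) auto
  then have \<Delta>: "\<bar>2 ^ j * (q * int d - h * 2 ^ ?L)\<bar> \<le> 2 ^ (2 * P + (?L - ?\<tau>))" by (simp add: power_add)
  show ?thesis
    by (intro exI[of _ "2 ^ j * q"] exI[of _ "2 ^ j * h"] exI[of _ "2 ^ j * (q * int d - h * 2 ^ ?L)"])
       (use K \<Delta> q j in \<open>auto simp: algebra_simps\<close>)
qed

lemma top_direction_exists:
  assumes "\<not> 2 ^ P dvd d" "d < 2 ^ Suc \<Lambda>"
  shows "\<exists>K. 0 \<le> K \<and> K \<le> 2 ^ (15 * P) \<and> 2 ^ (2 * P) dvd K * int d \<and> odd (K * int d div 2 ^ (2 * P)) \<and>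
    \<bar>K * int d\<bar> \<le> 2 ^ (2 * P + Suc \<Lambda>)"
proof -
  have "\<not> 2 ^ P dvd int d" using assms(1) by (metis int_dvd_int_iff of_nat_numeral of_nat_power)
  then have "\<not> 2 ^ (2 * P) dvd int d" by (metis dvd_trans le_add1 le_imp_power_dvd mult_2)
  then obtain j where j: "j \<le> 2 * P" "2 ^ (2 * P) dvd 2 ^ j * int d" "odd (2 ^ j * int d div 2 ^ (2 * P))"
    using exists_power_two_multiplier by blast
  have j2: "(2::int) ^ j \<le> 2 ^ (2 * P)" using j(1) by (intro power_increasing) auto
  also have "\<dots> \<le> 2 ^ (15 * P)" by (intro power_increasing) auto
  finally have K: "(2::int) ^ j \<le> 2 ^ (15 * P)" .
  have "int d \<le> int (2 ^ Suc \<Lambda>)" using assms(2) by linarith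
  then have "int d \<le> 2 ^ Suc \<Lambda>" by simp
  then have "2 ^ j * int d \<le> 2 ^ (2 * P) * 2 ^ Suc \<Lambda>" using j2 by (intro mult_mono) auto
  then have "\<bar>2 ^ j * int d\<bar> \<le> 2 ^ (2 * P + Suc \<Lambda>)" by (simp add: power_add abs_mult)
  with K j show ?thesis by (intro exI[of _ "2 ^ j"]) auto
qed

text \<open>
  The directions are listed from the bottom block to the top. Carries at the intermediate positions
  are bounded through differences, with \<open>T i\<close> still depending on \<open>d\<close>; at the topmost position, which
  exceeds the size of \<open>d\<close>, they are counted directly.
\<close>

lemma nonresonant_estimate:
  fixes a m p N N' d :: nat and b :: int
  defines "M \<equiv> m + m"
  defines "T \<equiv> (\<lambda>i. card {h. 1 \<le> h \<and> h < N \<and> near (2 ^ lam i) (2 ^ (lam i - P + 1)) (int h * int d)})"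
  assumes a: "k \<le> 2 ^ a" and m: "m = a + 2" and Mp: "P = M * p"
    and d: "\<not> resonant k P \<Lambda> L d" "2 ^ \<Lambda> \<le> d" "d < 2 ^ Suc \<Lambda>"
    and N: "N' \<le> N" "2 ^ (20 * P) \<le> real N" and P_large: "3 ^ Suc k * (4 * (real k + 1)) \<le> 2 ^ P"
  shows "((\<Sum>n<N'. tm L (int n * int d + b)) / real N) ^ (2 ^ Suc k)
    \<le> (1 - 2 / 2 ^ (M * (2 * k)) / 2 ^ (2 * M)) ^ p
      + 2 * 2 ^ Suc k * ((\<Sum>i<k. 1 + 2 * real (T i)) + 15 * real N / 2 ^ P) / real N + 1 / 2 ^ P"
proof -
  have "\<forall>i<k. \<exists>K. 0 \<le> K \<and> K \<le> 2 ^ (15 * P) \<and> 2 ^ (2 * P) dvd K * int d \<and> odd (K * int d div 2 ^ (2 * P)) \<and>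
    (\<exists>t \<Delta>. K * int d = t * 2 ^ lam (Suc i) + \<Delta> \<and> \<bar>\<Delta>\<bar> \<le> 2 ^ (2 * P + (lam (Suc i) - prec i)))"
    using direction_exists[OF _ d(1)] by meson
  then obtain \<kappa> where \<kappa>: "\<And>i. i < k \<Longrightarrow> 0 \<le> \<kappa> i \<and> \<kappa> i \<le> 2 ^ (15 * P) \<and> 2 ^ (2 * P) dvd \<kappa> i * int d \<and> odd (\<kappa> i * int d div 2 ^ (2 * P)) \<and>
    (\<exists>t \<Delta>. \<kappa> i * int d = t * 2 ^ lam (Suc i) + \<Delta> \<and> \<bar>\<Delta>\<bar> \<le> 2 ^ (2 * P + (lam (Suc i) - prec i)))"
    by metis
  obtain Kt where Kt: "0 \<le> Kt" "Kt \<le> 2 ^ (15 * P)" "2 ^ (2 * P) dvd Kt * int d" "odd (Kt * int d div 2 ^ (2 * P))"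
    "\<bar>Kt * int d\<bar> \<le> 2 ^ (2 * P + Suc \<Lambda>)"
    using top_direction_exists[OF _ d(3)] d(1) unfolding resonant_def by blast
  \<comment> \<open>The bottom direction has the short range of shifts and therefore is the first entry of \<open>ds\<close>.\<close>
  define Ks where "Ks = map \<kappa> [1..<k] @ [Kt]"
  define ds :: "(int \<times> nat) list" where "ds = (\<kappa> 0, 2 ^ P) # map (\<lambda>K. (K, 2 ^ (3 * P))) Ks"
  define B where "B i = (if i < k then 1 + 2 * real (T i) else 15 * real N / 2 ^ P)" for i
  have len: "length Ks = k" using k by (simp add: Ks_def)
  have ds_nth: "ds ! i = (if i = 0 then (\<kappa> 0, 2 ^ P) else if i < k then (\<kappa> i, 2 ^ (3 * P)) else (Kt, 2 ^ (3 * P)))" if "i < Suc k" for i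
    using that k len by (auto simp: ds_def nth_Cons Ks_def nth_append split: nat.splits)
  have Ks_set: "K \<ge> 0 \<and> K \<le> 2 ^ (15 * P) \<and> 2 ^ (2 * P) dvd K * int d \<and> odd (K * int d div 2 ^ (2 * P))" if "K \<in> set (\<kappa> 0 # Ks)" for K
    using that \<kappa> Kt k by (auto simp: Ks_def)
  have N0: "N > 0"
  proof (rule ccontr)
    assume "\<not> N > 0"
    then have "(2::real) ^ (20 * P) \<le> 0" using N by simp
    then show False using zero_less_power[of "2::real" "20 * P"] by linarith
  qed
  have pow_le: "(2::real) ^ (c * P) \<le> real N" if "c \<le> 20" for c
    using that N(2) by (meson order_trans power_increasing mult_le_mono1 one_le_numeral)
  define E where "E = 3 ^ Suc k * (\<Sum>(K, R)\<leftarrow>ds. 4 * real_of_int K * real R / real N)"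
  have E: "E \<le> 1 / 2 ^ P"
  proof -
    have bnd: "4 * real_of_int K * real R / real N \<le> 4 / 2 ^ (2 * P)" if KR: "(K, R) \<in> set ds" for K R
    proof -
      have "R \<le> 2 ^ (3 * P)" using KR by (auto simp: ds_def)
      then have "real R \<le> real (2 ^ (3 * P))" by (rule of_nat_mono)
      then have R: "real R \<le> 2 ^ (3 * P)" by simp
      have "K \<in> set (\<kappa> 0 # Ks)" using KR by (auto simp: ds_def)
      then have "0 \<le> K" "K \<le> 2 ^ (15 * P)" using Ks_set by blast+
      then have "real_of_int 0 \<le> real_of_int K" "real_of_int K \<le> real_of_int (2 ^ (15 * P))"
        by (simp_all only: of_int_le_iff)
      then have K: "0 \<le> real_of_int K" "real_of_int K \<le> 2 ^ (15 * P)" by simp_all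
      have "real_of_int K * real R * 2 ^ (2 * P) \<le> 2 ^ (15 * P) * 2 ^ (3 * P) * 2 ^ (2 * P)"
        using K R by (intro mult_right_mono mult_mono) auto
      also have "\<dots> \<le> real N" using N(2) by (simp flip: power_add)
      finally show ?thesis using N0 by (simp add: field_simps)
    qed
    have "(\<Sum>(K, R)\<leftarrow>ds. 4 * real_of_int K * real R / real N) \<le> (\<Sum>x\<leftarrow>ds. 4 / 2 ^ (2 * P))"
      by (rule sum_list_mono) (use bnd in auto)
    also have "\<dots> = (real k + 1) * (4 / 2 ^ (2 * P))" using len by (subst sum_list_triv) (simp add: ds_def)
    finally have "E \<le> 3 ^ Suc k * ((real k + 1) * (4 / 2 ^ (2 * P)))" unfolding E_def by (intro mult_left_mono) auto
    also have "\<dots> = 3 ^ Suc k * (4 * (real k + 1)) / 2 ^ (2 * P)" by simp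
    also have "\<dots> \<le> 2 ^ P / 2 ^ (2 * P)" using P_large by (intro divide_right_mono) auto
    also have "\<dots> = 1 / 2 ^ P" by (simp add: mult_2 power_add)
    finally show ?thesis .
  qed
  have dir: "\<exists>t \<Delta>. fst (ds ! i) * int d = t * 2 ^ lam (Suc i) + \<Delta> \<and> \<bar>\<Delta>\<bar> * int (snd (ds ! i)) \<le> 2 ^ (lam i - P)"
    if i: "i < Suc k" for i
  proof (cases "i < k")
    case True
    then obtain t \<Delta> where t: "\<kappa> i * int d = t * 2 ^ lam (Suc i) + \<Delta>" "\<bar>\<Delta>\<bar> \<le> 2 ^ (2 * P + (lam (Suc i) - prec i))"
      using \<kappa> by blast
    define R where "R = (if i = 0 then P else 3 * P)"
    have "\<bar>\<Delta>\<bar> * 2 ^ R \<le> 2 ^ (2 * P + (lam (Suc i) - prec i)) * 2 ^ R" using t(2) by (rule mult_right_mono) simp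
    also have "\<dots> = 2 ^ (lam i - P)"
    proof -
      have "2 * P + (lam (Suc i) - prec i) + R = lam i - P"
        using window_step(2,5,8)[OF True] by (auto simp: R_def window_def)
      then show ?thesis by (simp flip: power_add)
    qed
    finally show "\<exists>t \<Delta>. fst (ds ! i) * int d = t * 2 ^ lam (Suc i) + \<Delta> \<and>
      \<bar>\<Delta>\<bar> * int (snd (ds ! i)) \<le> 2 ^ (lam i - P)"
      using t(1) True ds_nth[OF i] by (intro exI[of _ t] exI[of _ \<Delta>]) (auto simp: R_def split: if_splits)
  next
    case False
    then have ik: "i = k" using i by simp
    have "\<bar>Kt * int d\<bar> * 2 ^ (3 * P) \<le> 2 ^ (2 * P + Suc \<Lambda>) * 2 ^ (3 * P)" using Kt(5) by (rule mult_right_mono) simp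
    also have "\<dots> = 2 ^ (lam k - P)" using k P by (simp add: window_def flip: power_add)
    finally show "\<exists>t \<Delta>. fst (ds ! i) * int d = t * 2 ^ lam (Suc i) + \<Delta> \<and>
      \<bar>\<Delta>\<bar> * int (snd (ds ! i)) \<le> 2 ^ (lam i - P)"
      using k ik ds_nth[OF i] by (intro exI[of _ 0] exI[of _ "Kt * int d"]) auto
  qed
  have "((\<Sum>n<N'. tm (lam (Suc k)) (int n * int d + b)) / real N) ^ (2 ^ Suc k)
    \<le> (1 - 2 / 2 ^ ((m + m) * (2 * k)) / 2 ^ (2 * (m + m))) ^ p + 2 * 2 ^ Suc k * (\<Sum>i<Suc k. B i) / real N
      + 3 ^ Suc k * (\<Sum>(K, R)\<leftarrow>(\<kappa> 0, 2 ^ ((m + m) * p)) # map (\<lambda>K. (K, 2 ^ (3 * P))) Ks. 4 * real_of_int K * real R / real N)"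
  proof (rule progression_estimate[where \<delta> = "\<lambda>i. 2 ^ (lam i - P)" and v = "2 * P" and a = a and lam = lam
      and B = B and k = k and m = m and p = p and w = "3 * P" and Ks = Ks and d = "int d" and b = b and N = N and N' = N' and K_first = "\<kappa> 0" and w_rest = "2 * P"])
    have PM: "(m + m) * p = P" using Mp by (simp add: M_def)
    show "1 \<le> k" "k \<le> 2 ^ a" "m = a + 2" using k a m by auto
    show "3 * P = (m + m) * p + 2 * P" unfolding PM by simp
    show "length Ks = k" by (rule len)
    show "0 \<le> K \<and> 2 ^ (2 * P) dvd K * int d \<and> odd (K * int d div 2 ^ (2 * P))" if "K \<in> set (\<kappa> 0 # Ks)" for K
      using Ks_set[OF that] by blast
    show "N' \<le> N" "N > 0" by fact+
    have "1 / (2::real) ^ P \<le> 1" by simp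
    then show "3 ^ Suc k * (\<Sum>(K, R)\<leftarrow>(\<kappa> 0, 2 ^ ((m + m) * p)) # map (\<lambda>K. (K, 2 ^ (3 * P))) Ks. 4 * real_of_int K * real R / real N) \<le> 1"
      using E unfolding PM E_def ds_def by linarith
    show "lam 0 = 2 * P + 3 * P" by (simp add: window_def)
    fix i assume i: "i < Suc k"
    show "lam i \<le> lam (Suc i)"
      using window_step(7)[of i] i L k by (cases "i < k") (auto simp: window_def)
    show "\<exists>t \<Delta>. fst (((\<kappa> 0, (2::nat) ^ ((m + m) * p)) # map (\<lambda>K. (K, (2::nat) ^ (3 * P))) Ks) ! i) * int d = t * 2 ^ lam (Suc i) + \<Delta> \<and>
        \<bar>\<Delta>\<bar> * int (snd (((\<kappa> 0, 2 ^ ((m + m) * p)) # map (\<lambda>K. (K, 2 ^ (3 * P))) Ks) ! i)) \<le> 2 ^ (lam i - P)"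
      using dir[OF i] unfolding PM ds_def .
    fix b'
    show "real (card {n. n < N' \<and> near (2 ^ lam i) (2 ^ (lam i - P)) (int n * int d + b')}) \<le> B i"
    proof -
      have "card {n. n < N' \<and> near (2 ^ lam i) (2 ^ (lam i - P)) (int n * int d + b')}
        \<le> card {n. n < N \<and> near (2 ^ lam i) (2 ^ (lam i - P)) (int n * int d + b')}" (is "?c' \<le> ?c")
        using N(1) by (intro card_mono) auto
      also have "real ?c \<le> B i"
      proof (cases "i < k")
        case True
        have "?c \<le> 1 + 2 * T i"
          using card_near_le_differences[of N "2 ^ lam i" "2 ^ (lam i - P)" "int d" b'] by (simp add: T_def)
        then have "real ?c \<le> real (1 + 2 * T i)" by (rule of_nat_mono)
        then show ?thesis using True by (simp add: B_def)
      next
        case False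
        then have ik: "i = k" using i by simp
        have lk: "lam k = \<Lambda> + 6 * P + 1" using k by (simp add: window_def)
        have "(2::nat) ^ \<Lambda> > 0" by simp
        then have d0: "d > 0" using d(2) by linarith
        have "(2::int) ^ (lam k - P + 1) \<le> 2 ^ lam k" using P lk by (intro power_increasing) auto
        then have \<delta>: "2 * (2::int) ^ (lam k - P) \<le> 2 ^ lam k" by simp
        have "real ?c \<le> (real N * real d / 2 ^ lam k + 2) * (2 * 2 ^ (lam k - P) / real d + 1)"
          using card_near_progression[of "int d" "2 ^ lam k" "2 ^ (lam k - P)" N b'] d0 \<delta> by (simp add: ik)
        also have "\<dots> \<le> (real N / 2 ^ (6 * P) + 2) * (5 * 2 ^ (5 * P))"
        proof (rule mult_mono)
          have "real d \<le> real (2 ^ Suc \<Lambda>)" using d(3) by (intro of_nat_mono) simp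
          then have "real d \<le> 2 ^ Suc \<Lambda>" by simp
          then have "real N * real d / 2 ^ lam k \<le> real N * 2 ^ Suc \<Lambda> / 2 ^ lam k"
            by (intro divide_right_mono mult_left_mono) auto
          also have "\<dots> = real N / 2 ^ (6 * P)" by (simp add: lk power_add)
          finally show "real N * real d / 2 ^ lam k + 2 \<le> real N / 2 ^ (6 * P) + 2" by simp
          have "real (2 ^ \<Lambda>) \<le> real d" using d(2) by (rule of_nat_mono)
          then have "2 * 2 ^ (lam k - P) / real d \<le> 2 * 2 ^ (lam k - P) / 2 ^ \<Lambda>"
            using d0 by (intro divide_left_mono) auto
          also have "\<dots> = 4 * 2 ^ (5 * P)"
          proof -
            have "lam k - P = \<Lambda> + (5 * P + 1)" using lk by simp
            then show ?thesis by (simp add: power_add)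
          qed
          finally have "2 * 2 ^ (lam k - P) / real d \<le> 4 * 2 ^ (5 * P)" .
          moreover have "(1::real) \<le> 2 ^ (5 * P)" by simp
          ultimately show "2 * 2 ^ (lam k - P) / real d + 1 \<le> 5 * 2 ^ (5 * P)" by linarith
        qed auto
        also have "\<dots> = 5 * real N * (2 ^ (5 * P) / 2 ^ (6 * P)) + 10 * 2 ^ (5 * P)" by (simp add: algebra_simps)
        also have "2 ^ (5 * P) / 2 ^ (6 * P) = 1 / (2::real) ^ P"
          by (simp add: field_simps flip: power_add)
        also have "10 * 2 ^ (5 * P) \<le> 10 * (real N / 2 ^ P)"
          using pow_le[of 6] by (simp add: field_simps flip: power_add)
        finally show ?thesis using ik by (simp add: B_def)
      qed
      finally show ?thesis by simp
    qed
  qed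
  also have "lam (Suc k) = L" by (simp add: window_def)
  also have "(\<Sum>i<Suc k. B i) = (\<Sum>i<k. 1 + 2 * real (T i)) + 15 * real N / 2 ^ P" by (simp add: B_def)
  finally show ?thesis using E Mp unfolding E_def ds_def M_def by (simp add: add.assoc)
qed

end

context
  fixes k P \<Lambda> L :: nat
  assumes k: "14 \<le> k" "k + 6 = \<Lambda> div P" and P: "1 \<le> P" and L: "\<Lambda> + 6 * P + 1 \<le> L"
begin

lemma card_resonant:
  "real (card {d \<in> {2 ^ \<Lambda>..<2 * 2 ^ \<Lambda>}. resonant k P \<Lambda> L d}) \<le> (29 + 3 * real k) * 2 ^ \<Lambda> / 2 ^ P"
proof -
  note step = window_step[OF k P L]
  let ?D = "2 ^ \<Lambda> :: nat"
  let ?R = "\<lambda>i d. \<exists>q. 1 \<le> q \<and> q \<le> 2 ^ precision k P \<Lambda> i \<and> 2 ^ P dvd q \<and>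
     \<not> 2 ^ P dvd d \<and> near (2 ^ window k P \<Lambda> L (Suc i)) (2 ^ (window k P \<Lambda> L (Suc i) - precision k P \<Lambda> i)) (q * int d)"
  define A where "A i = {d \<in> {?D..<2 * ?D}. ?R i d}" for i
  define A0 where "A0 = {d \<in> {?D..<2 * ?D}. 2 ^ P dvd d}"
  have A: "real (card (A i)) \<le> (if Suc i < k then 3 else 27) * 2 ^ \<Lambda> / 2 ^ P" if i: "i < k" for i
  proof (cases "Suc i < k")
    case True
    have le: "window k P \<Lambda> L (Suc i) \<le> \<Lambda>" using step(6)[OF True] .
    have "P \<le> window k P \<Lambda> L (Suc i) - precision k P \<Lambda> i"
    proof (cases "i = 0")
      case False
      then have "window k P \<Lambda> L i = 7 * P + i * P" using i by (simp add: window_def add_mult_distrib)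
      then show ?thesis using step(2)[OF i] False by simp
    qed (use step(2)[OF i] in simp)
    then have "precision k P \<Lambda> i + P \<le> window k P \<Lambda> L (Suc i)" using step(1)[OF i] by linarith
    from card_bad_multiplier_low[OF this step(4)[OF i], of "2 ^ (\<Lambda> - window k P \<Lambda> L (Suc i))"] le True
    show ?thesis by (simp add: A_def flip: power_add)
  next
    case False
    then have ik: "k = Suc i" using i by simp
    have w: "window k P \<Lambda> L (Suc i) = \<Lambda> + 6 * P + 1" using k ik by (simp add: window_def)
    have \<Lambda>: "20 * P \<le> \<Lambda>" "k * P + 6 * P \<le> \<Lambda>"
    proof -
      have "(k + 6) * P \<le> \<Lambda>" unfolding k(2) by simp
      moreover have "20 * P \<le> (k + 6) * P" using k by (intro mult_right_mono) auto
      ultimately show "20 * P \<le> \<Lambda>" by linarith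
      show "k * P + 6 * P \<le> \<Lambda>" using \<open>(k + 6) * P \<le> \<Lambda>\<close> by (simp add: add_mult_distrib)
    qed
    have i0: "i \<noteq> 0" using k ik by simp
    have "window k P \<Lambda> L i = 7 * P + i * P" using i i0 by (simp add: window_def add_mult_distrib)
    then have "window k P \<Lambda> L (Suc i) - precision k P \<Lambda> i = k * P" using step(2)[OF i] i0 ik by simp
    moreover have "k * P < \<Lambda>" using \<Lambda> P by linarith
    ultimately have "(2::nat) ^ (window k P \<Lambda> L (Suc i) - precision k P \<Lambda> i) < ?D"
      by (simp only: power_strict_increasing_iff)
    moreover have "2 * precision k P \<Lambda> i \<le> window k P \<Lambda> L (Suc i)" "1 \<le> precision k P \<Lambda> i"
      using step(3,4)[OF i] w \<Lambda> P by auto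
    ultimately have *: "real (card {d \<in> {?D..<2 * ?D}. \<exists>q. 1 \<le> q \<and> q \<le> 2 ^ precision k P \<Lambda> i \<and> 2 ^ P dvd q \<and>
       near (2 ^ window k P \<Lambda> L (Suc i)) (2 ^ (window k P \<Lambda> L (Suc i) - precision k P \<Lambda> i)) (q * int d)})
       \<le> 27 * real ?D / 2 ^ P" (is "real (card ?B) \<le> _")
      using card_bad_multiplier_top[OF _ step(4)[OF i]] by blast
    have "card (A i) \<le> card ?B" unfolding A_def by (rule card_mono) auto
    then have "real (card (A i)) \<le> real (card ?B)" by (rule of_nat_mono)
    with * show ?thesis using False by simp
  qed
  have A0: "real (card A0) \<le> 2 * 2 ^ \<Lambda> / 2 ^ P"
  proof -
    have "card A0 \<le> card {h. 1 \<le> h \<and> h < 2 * ?D \<and> 2 ^ P dvd h}"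
      unfolding A0_def by (rule card_mono) (auto simp: Suc_le_eq intro: dvd_pos_nat)
    then have "real (card A0) \<le> real (card {h. 1 \<le> h \<and> h < 2 * ?D \<and> 2 ^ P dvd h})" by (rule of_nat_mono)
    also have "\<dots> \<le> real (2 * ?D) / real (2 ^ P)" by (rule card_multiples_nat) simp
    finally show ?thesis by simp
  qed
  have fin: "finite (A i)" for i unfolding A_def by simp
  have "{d \<in> {?D..<2 * ?D}. resonant k P \<Lambda> L d} = A0 \<union> (\<Union>i<k. A i)"
    unfolding resonant_def A_def A0_def by blast
  then have "card {d \<in> {?D..<2 * ?D}. resonant k P \<Lambda> L d} \<le> card A0 + card (\<Union>i<k. A i)"
    by (simp only: card_Un_le)
  also have "card (\<Union>i<k. A i) \<le> (\<Sum>i<k. card (A i))" by (rule card_UN_le) simp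
  finally have "real (card {d \<in> {?D..<2 * ?D}. resonant k P \<Lambda> L d}) \<le> real (card A0 + (\<Sum>i<k. card (A i)))"
    by (simp only: of_nat_mono)
  also have "\<dots> = real (card A0) + (\<Sum>i<k. real (card (A i)))" by simp
  also have "\<dots> \<le> 2 * 2 ^ \<Lambda> / 2 ^ P + (\<Sum>i<k. (3 + (if i = k - 1 then 27 else 0)) * 2 ^ \<Lambda> / 2 ^ P)"
  proof (intro add_mono A0 sum_mono)
    fix i assume "i \<in> {..<k}"
    then have i: "i < k" by simp
    have "(if Suc i < k then 3 else 27) \<le> (3 + (if i = k - 1 then 27 else 0) :: real)" using i by auto
    then have "(if Suc i < k then 3 else 27) * 2 ^ \<Lambda> / 2 ^ P \<le> (3 + (if i = k - 1 then 27 else 0) :: real) * 2 ^ \<Lambda> / 2 ^ P"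
      by (intro divide_right_mono mult_right_mono) auto
    with A[OF i] show "real (card (A i)) \<le> (3 + (if i = k - 1 then 27 else 0)) * 2 ^ \<Lambda> / 2 ^ P" by linarith
  qed
  also have "\<dots> = 2 * 2 ^ \<Lambda> / 2 ^ P + (\<Sum>i<k. 3 + (if i = k - 1 then 27 else 0)) * 2 ^ \<Lambda> / 2 ^ P"
    by (simp only: sum_divide_distrib sum_distrib_right)
  also have "(\<Sum>i<k. 3 + (if i = k - 1 then 27 else 0) :: real) = 3 * real k + 27"
    using k(1) by (simp add: sum.distrib)
  also have "2 * 2 ^ \<Lambda> / 2 ^ P + (3 * real k + 27) * 2 ^ \<Lambda> / 2 ^ P = (29 + 3 * real k) * 2 ^ \<Lambda> / 2 ^ P"
    by (simp add: field_simps)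
  finally show ?thesis .
qed

text \<open>
  The average over the block of moduli. The maximal sums are raised to the power \<open>2 ^ Suc k\<close> by Jensen's
  inequality, so that the estimates for individual moduli and the trivial bound for resonant ones can
  simply be added.
\<close>

lemma dyadic_estimate:
  fixes a m p N :: nat and S :: "nat \<Rightarrow> real"
  defines "M \<equiv> m + m"
  assumes a: "k \<le> 2 ^ a" and m: "m = a + 2" and Mp: "P = M * p"
    and N: "2 ^ (20 * P) \<le> real N" and P_large: "3 ^ Suc k * (4 * (real k + 1)) \<le> 2 ^ P"
    and S: "\<And>d. 2 ^ \<Lambda> \<le> d \<Longrightarrow> d < 2 * 2 ^ \<Lambda> \<Longrightarrow> \<exists>N' b. N' \<le> N \<and> S d = \<bar>\<Sum>n<N'. tm L (int n * int d + b)\<bar>"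
  shows "(mean {2 ^ \<Lambda>..<2 * 2 ^ \<Lambda>} (\<lambda>d. S d / real N)) ^ (2 ^ Suc k)
    \<le> (1 - 2 / 2 ^ (M * (2 * k)) / 2 ^ (2 * M)) ^ p + (30 + 3 * real k + 30 * 2 ^ Suc k * (real k + 1)) / 2 ^ P"
proof -
  note step = window_step[OF k P L]
  let ?D = "2 ^ \<Lambda> :: nat"
  let ?I = "{?D..<2 * ?D}"
  define T where "T i d = card {h. 1 \<le> h \<and> h < N \<and> near (2 ^ window k P \<Lambda> L i) (2 ^ (window k P \<Lambda> L i - P + 1)) (int h * int d)}" for i d
  define C where "C = (1 - 2 / (2::real) ^ (M * (2 * k)) / 2 ^ (2 * M)) ^ p"
  define W where "W = 2 * 2 ^ Suc k / real N"
  have pow1: "(1::real) \<le> 2 ^ (20 * P)" by simp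
  have N0: "real N > 0" using N pow1 by linarith
  have W0: "W \<ge> 0" using N0 by (simp add: W_def)
  have card_I: "real (card ?I) = 2 ^ \<Lambda>" by simp
  have C0: "C \<ge> 0"
  proof -
    have "(2::real) ^ 1 \<le> 2 ^ (M * (2 * k))" using k m by (intro power_increasing) (auto simp: M_def)
    then have "2 / (2::real) ^ (M * (2 * k)) \<le> 1" by simp
    then have "2 / (2::real) ^ (M * (2 * k)) / 2 ^ (2 * M) \<le> 1 / 1" by (intro frac_le) auto
    then show ?thesis by (simp add: C_def)
  qed
  have "(mean ?I (\<lambda>d. S d / real N)) ^ (2 ^ Suc k) \<le> mean ?I (\<lambda>d. (S d / real N) ^ (2 ^ Suc k))"
    by (rule mean_power)
  also have "\<dots> \<le> mean ?I (\<lambda>d. (if resonant k P \<Lambda> L d then 1 else 0) + (W * (\<Sum>i<k. 1 + 2 * real (T i d))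
      + (C + W * (15 * real N / 2 ^ P) + 1 / 2 ^ P)))"
  proof (rule mean_mono)
    fix d assume "d \<in> ?I"
    then have d: "?D \<le> d" "d < 2 * ?D" by auto
    obtain N' b where N': "N' \<le> N" "S d = \<bar>\<Sum>n<N'. tm L (int n * int d + b)\<bar>" using S[OF d] by blast
    have rest: "0 \<le> W * (\<Sum>i<k. 1 + 2 * real (T i d))" "0 \<le> C + W * (15 * real N / 2 ^ P) + 1 / 2 ^ P"
      using W0 C0 by (auto intro!: mult_nonneg_nonneg sum_nonneg add_nonneg_nonneg)
    show "(S d / real N) ^ (2 ^ Suc k) \<le> (if resonant k P \<Lambda> L d then 1 else 0) + (W * (\<Sum>i<k. 1 + 2 * real (T i d))
      + (C + W * (15 * real N / 2 ^ P) + 1 / 2 ^ P))"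
    proof (cases "resonant k P \<Lambda> L d")
      case True
      have "S d \<le> (\<Sum>n<N'. \<bar>tm L (int n * int d + b)\<bar>)" unfolding N' by (rule sum_abs)
      also have "\<dots> \<le> real N" using N' by simp
      finally have "S d / real N \<le> 1" using N0 by simp
      moreover have "0 \<le> S d / real N" using N' by simp
      ultimately have "(S d / real N) ^ (2 ^ Suc k) \<le> 1" by (intro power_le_one) auto
      with True rest show ?thesis by simp
    next
      case False
      have "(S d / real N) ^ (2 ^ Suc k) = ((\<Sum>n<N'. tm L (int n * int d + b)) / real N) ^ (2 ^ Suc k)"
        unfolding N'(2) by (simp add: power_divide power_even_abs)
      also have "\<dots> \<le> C + 2 * 2 ^ Suc k * ((\<Sum>i<k. 1 + 2 * real (T i d)) + 15 * real N / 2 ^ P) / real N + 1 / 2 ^ P"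
        unfolding C_def M_def T_def
        by (rule nonresonant_estimate[OF k P L a m _ False _ _ N'(1) N P_large]) (use Mp d in \<open>auto simp: M_def\<close>)
      also have "\<dots> = W * (\<Sum>i<k. 1 + 2 * real (T i d)) + (C + W * (15 * real N / 2 ^ P) + 1 / 2 ^ P)"
        by (simp add: W_def field_simps)
      finally show ?thesis using False by simp
    qed
  qed
  also have "\<dots> = mean ?I (\<lambda>d. if resonant k P \<Lambda> L d then 1 else 0) + (W * (\<Sum>i<k. mean ?I (\<lambda>d. 1 + 2 * real (T i d)))
      + (C + W * (15 * real N / 2 ^ P) + 1 / 2 ^ P))"
    by (simp only: mean_add mean_cmult mean_sum[symmetric]) (simp add: mean_const)
  also have "mean ?I (\<lambda>d. if resonant k P \<Lambda> L d then 1 else 0) \<le> (29 + 3 * real k) / 2 ^ P"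
  proof -
    have "(\<Sum>d\<in>?I. if resonant k P \<Lambda> L d then 1 else 0) = real (card {d \<in> ?I. resonant k P \<Lambda> L d})"
      by (simp add: sum.If_cases Int_def)
    also have "\<dots> \<le> (29 + 3 * real k) * 2 ^ \<Lambda> / 2 ^ P" by (rule card_resonant)
    finally show ?thesis unfolding mean_def card_I by (simp add: field_simps)
  qed
  also have "(\<Sum>i<k. mean ?I (\<lambda>d. 1 + 2 * real (T i d))) \<le> (\<Sum>i<k. 15 * real N / 2 ^ P)"
  proof (rule sum_mono)
    fix i assume "i \<in> {..<k}"
    then have i: "i < k" by simp
    let ?l = "window k P \<Lambda> L i"
    let ?e = "?l - P + 1"
    have l: "?l \<le> \<Lambda>" "5 * P \<le> ?l" using step(5,6)[OF i] by auto
    have D: "?D = 2 ^ ?l * 2 ^ (\<Lambda> - ?l)" using l by (simp flip: power_add)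
    have "(\<Sum>d\<in>?I. real (T i d)) \<le> real ?D * real N * (3 * 2 ^ ?e / 2 ^ ?l + 1 / 2 ^ ?e)"
      using sum_card_near[where L = ?l and c = "2 ^ (\<Lambda> - ?l)" and N = N and e = ?e] by (simp only: T_def D)
    then have "(\<Sum>d\<in>?I. real (T i d)) / real ?D \<le> real N * (3 * 2 ^ ?e / 2 ^ ?l + 1 / 2 ^ ?e)"
      by (simp add: divide_le_eq mult_ac)
    also have "\<dots> \<le> real N * (6 / 2 ^ P + 1 / 2 ^ P)"
    proof (intro mult_left_mono add_mono)
      have "2 ^ ?e * 2 ^ P = 2 * (2::real) ^ ?l" using l P by (simp flip: power_add power_Suc)
      then show "3 * 2 ^ ?e / 2 ^ ?l \<le> 6 / (2::real) ^ P" by (simp add: field_simps)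
      have "(2::real) ^ P \<le> 2 ^ ?e" using l by (intro power_increasing) auto
      then show "1 / 2 ^ ?e \<le> 1 / (2::real) ^ P" by (intro divide_left_mono) auto
    qed simp
    finally have "mean ?I (\<lambda>d. real (T i d)) \<le> 7 * real N / 2 ^ P"
      unfolding mean_def card_I by (simp add: add_divide_distrib[symmetric] mult.commute)
    moreover have "1 \<le> real N / 2 ^ P"
    proof -
      have "(2::real) ^ P \<le> 2 ^ (20 * P)" by (intro power_increasing) auto
      with N have "2 ^ P \<le> real N" by linarith
      then show ?thesis by simp
    qed
    moreover have "mean ?I (\<lambda>d. 1 + 2 * real (T i d)) = 1 + 2 * mean ?I (\<lambda>d. real (T i d))"
      unfolding mean_add mean_cmult by (simp add: mean_const)
    ultimately show "mean ?I (\<lambda>d. 1 + 2 * real (T i d)) \<le> 15 * real N / 2 ^ P" by linarith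
  qed
  finally have "(mean ?I (\<lambda>d. S d / real N)) ^ (2 ^ Suc k) \<le> (29 + 3 * real k) / 2 ^ P
      + (W * (\<Sum>i<k. 15 * real N / 2 ^ P) + (C + W * (15 * real N / 2 ^ P) + 1 / 2 ^ P))"
    using W0 by (simp add: mult_left_mono)
  also have "\<dots> = C + (30 + 3 * real k + 30 * 2 ^ Suc k * (real k + 1)) / 2 ^ P"
    using N0 by (simp add: W_def add_divide_distrib algebra_simps)
  finally show ?thesis by (simp add: C_def)
qed

end

section \<open>Small moduli\<close>

lemma power_two_factor:
  fixes d :: nat
  assumes "0 < d"
  shows "\<exists>v. 2 ^ v dvd int d \<and> odd (int d div 2 ^ v) \<and> 2 ^ v \<le> d"
  using assms
proof (induction d rule: less_induct)
  case (less d)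
  show ?case
  proof (cases "even d")
    case True
    then obtain d' where d: "d = 2 * d'" by (elim evenE)
    with less.prems less.IH[of d'] obtain v where v: "2 ^ v dvd int d'" "odd (int d' div 2 ^ v)" "2 ^ v \<le> d'"
      by auto
    then show ?thesis by (intro exI[of _ "Suc v"]) (auto simp: d)
  qed (use less.prems in \<open>auto intro!: exI[of _ 0]\<close>)
qed

text \<open>
  For moduli below a small power of \<open>x\<close> the range of summation contains complete residue systems modulo a
  power of two well above \<open>d\<close>. Two van der Corput steps with \<open>K = 1\<close> suffice, for every \<open>d\<close>: a short one
  removing the high digits and a long one providing the average.
\<close>

lemma small_modulus_estimate:
  fixes a m p P \<Lambda> L N N' d :: nat and b :: int
  defines "M \<equiv> m + m"
  assumes m: "m = a + 2" and Mp: "P = M * p" and P: "1 \<le> P"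
    and d: "2 ^ \<Lambda> \<le> d" "d < 2 ^ Suc \<Lambda>" and \<Lambda>: "\<Lambda> < 20 * P"
    and N: "N' \<le> N" "2 ^ (31 * P) \<le> real N" and L: "N * d \<le> 2 ^ L" "50 * P \<le> L"
  shows "((\<Sum>n<N'. tm L (int n * int d + b)) / real N) ^ 4
    \<le> (1 - 2 / 2 ^ (M * 2) / 2 ^ (2 * M)) ^ p + 129 / 2 ^ P"
proof -
  have "(2::nat) ^ \<Lambda> > 0" by simp
  then have d0: "d > 0" using d(1) by linarith
  obtain v where v: "2 ^ v dvd int d" "odd (int d div 2 ^ v)" "2 ^ v \<le> d"
    using power_two_factor[OF d0] by blast
  have "(2::nat) ^ v < 2 ^ Suc \<Lambda>" using v(3) d(2) by linarith
  then have "v < Suc \<Lambda>" by (simp only: power_strict_increasing_iff)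
  then have v\<Lambda>: "v \<le> \<Lambda>" by simp
  \<comment> \<open>The window leaves \<open>2 * P\<close> digits above \<open>d\<close>: \<open>P\<close> for the short shifts and \<open>P\<close> to make carries rare.\<close>
  define l where "l = \<Lambda> + 1 + 2 * P"
  define w where "w = l - v"
  \<comment> \<open>The long direction removes no digits: its window already is all of the \<open>L\<close> digits.\<close>
  define lam where "lam i = (if i = 0 then l else L)" for i :: nat
  define \<delta> where "\<delta> i = (if i = 0 then (2::int) ^ (l - P) else 2 ^ (\<Lambda> + 1 + w))" for i :: nat
  define B where "B i = (if i = 0 then 15 * real N / 2 ^ P else real N / 2 ^ P)" for i :: nat
  have w: "w = P + (w - P)" "w \<le> 23 * P" "v + w = l" using v\<Lambda> \<Lambda> P by (auto simp: w_def l_def)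
  have lL: "l \<le> L" "l \<le> 23 * P" using \<Lambda> L(2) P by (auto simp: l_def)
  have N0: "real N > 0" using N(2) zero_less_power[of "2::real" "31 * P"] by linarith
  have dr: "real d \<le> 2 ^ Suc \<Lambda>" "2 ^ \<Lambda> \<le> real d"
  proof -
    have "real d \<le> real (2 ^ Suc \<Lambda>)" using d(2) by (intro of_nat_mono) simp
    then show "real d \<le> 2 ^ Suc \<Lambda>" by simp
    have "real (2 ^ \<Lambda>) \<le> real d" using d(1) by (rule of_nat_mono)
    then show "2 ^ \<Lambda> \<le> real d" by simp
  qed
  have pow_N: "(2::real) ^ e * 2 ^ P \<le> real N" if "e \<le> 30 * P" for e
  proof -
    have "(2::real) ^ (e + P) \<le> 2 ^ (31 * P)" using that by (intro power_increasing) auto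
    with N(2) show ?thesis unfolding power_add by linarith
  qed
  define E where "E = 3 ^ Suc 1 * (\<Sum>(K, R)\<leftarrow>[(1::int, 2 ^ P), (1, 2 ^ w)]. 4 * real_of_int K * real R / real N)"
  have E: "E \<le> 1 / 2 ^ P"
  proof -
    have *: "36 * (s + t) \<le> 128 * u" if "s \<le> u" "t \<le> u" "0 < u" for s t u :: real
    proof -
      have "36 * (s + t) \<le> 36 * (u + u)" using that by (intro mult_left_mono add_mono) auto
      also have "\<dots> \<le> 128 * u" using that(3) by simp
      finally show ?thesis .
    qed
    have "36 * (2 ^ P + 2 ^ w) \<le> 128 * (2::real) ^ (23 * P)"
      by (rule *) (use w in \<open>auto intro: power_increasing\<close>)
    also have "\<dots> = 2 ^ (7 + 23 * P)" by (simp add: power_add)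
    finally have "36 * (2 ^ P + 2 ^ w) * 2 ^ P \<le> 2 ^ (7 + 23 * P) * (2::real) ^ P" by (rule mult_right_mono) simp
    also have "\<dots> \<le> real N" using P by (intro pow_N) simp
    finally show ?thesis using N0 unfolding E_def by (simp add: field_simps)
  qed
  have "((\<Sum>n<N'. tm (lam (Suc 1)) (int n * int d + b)) / real N) ^ (2 ^ Suc 1)
    \<le> (1 - 2 / 2 ^ ((m + m) * (2 * 1)) / 2 ^ (2 * (m + m))) ^ p + 2 * 2 ^ Suc 1 * (\<Sum>i<Suc 1. B i) / real N
      + 3 ^ Suc 1 * (\<Sum>(K, R)\<leftarrow>(1, 2 ^ ((m + m) * p)) # map (\<lambda>K. (K, 2 ^ w)) [1]. 4 * real_of_int K * real R / real N)"
  proof (rule progression_estimate[where \<delta> = \<delta> and v = v and a = a and lam = lam and B = B and k = 1 and m = m and p = p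
        and w = w and Ks = "[1]" and d = "int d" and b = b and N = N and N' = N' and K_first = 1 and w_rest = "w - P"])
    have PM: "(m + m) * p = P" using Mp by (simp add: M_def)
    show "w = (m + m) * p + (w - P)" using w(1) unfolding PM .
    have "1 / (2::real) ^ P \<le> 1" by simp
    then show "3 ^ Suc 1 * (\<Sum>(K, R)\<leftarrow>(1, 2 ^ ((m + m) * p)) # map (\<lambda>K. (K, 2 ^ w)) [1]. 4 * real_of_int K * real R / real N) \<le> 1"
      using E unfolding PM E_def list.map by linarith
    show "lam 0 = v + w" using w by (simp add: lam_def)
    fix i :: nat assume i: "i < Suc 1"
    then have i01: "i = 0 \<or> i = 1" by linarith
    show "lam i \<le> lam (Suc i)" using lL by (simp add: lam_def)
    have "int d \<le> int (2 ^ Suc \<Lambda>)" using d(2) by linarith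
    then have di: "int d \<le> 2 ^ Suc \<Lambda>" by simp
    have dd: "int d * 2 ^ P \<le> 2 ^ (l - P)" "int d * 2 ^ w \<le> 2 ^ (\<Lambda> + 1 + w)"
    proof -
      have "int d * 2 ^ P \<le> 2 ^ Suc \<Lambda> * 2 ^ P" using di by (rule mult_right_mono) simp
      also have "\<dots> = 2 ^ (l - P)" by (simp add: l_def flip: power_add power_Suc)
      finally show "int d * 2 ^ P \<le> 2 ^ (l - P)" .
      have "int d * 2 ^ w \<le> 2 ^ Suc \<Lambda> * 2 ^ w" using di by (rule mult_right_mono) simp
      then show "int d * 2 ^ w \<le> 2 ^ (\<Lambda> + 1 + w)" by (simp add: power_add)
    qed
    show "\<exists>t \<Delta>. fst (((1, (2::nat) ^ ((m + m) * p)) # map (\<lambda>K. (K, (2::nat) ^ w)) [1]) ! i) * int d = t * 2 ^ lam (Suc i) + \<Delta> \<and>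
        \<bar>\<Delta>\<bar> * int (snd (((1::int, 2 ^ ((m + m) * p)) # map (\<lambda>K. (K, 2 ^ w)) [1]) ! i)) \<le> \<delta> i"
      using i01
    proof
      assume "i = 0"
      then show ?thesis using dd by - (rule exI[of _ 0], rule exI[of _ "int d"], simp add: \<delta>_def PM)
    next
      assume "i = 1"
      then show ?thesis using dd by - (rule exI[of _ 0], rule exI[of _ "int d"], simp add: \<delta>_def PM)
    qed
    fix b'
    have "card {n. n < N' \<and> near (2 ^ lam i) (\<delta> i) (int n * int d + b')} \<le> card {n. n < N \<and> near (2 ^ lam i) (\<delta> i) (int n * int d + b')}"
      using N(1) by (intro card_mono) auto
    then have "real (card {n. n < N' \<and> near (2 ^ lam i) (\<delta> i) (int n * int d + b')}) \<le> real (card {n. n < N \<and> near (2 ^ lam i) (\<delta> i) (int n * int d + b')})"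
      by (rule of_nat_mono)
    also have "\<dots> \<le> (real N * real_of_int (int d) / real_of_int (2 ^ lam i) + 2) * (2 * real_of_int (\<delta> i) / real_of_int (int d) + 1)"
    proof (rule card_near_progression)
      have "(2::int) ^ Suc (l - P) \<le> 2 ^ l" "(2::int) ^ Suc (\<Lambda> + 1 + w) \<le> 2 ^ L"
        using P w lL \<Lambda> L(2) by (auto intro!: power_increasing simp: l_def simp del: power_Suc)
      then show "2 * \<delta> i \<le> 2 ^ lam i" using i01 by (auto simp: \<delta>_def lam_def)
    qed (use d0 in \<open>auto simp: \<delta>_def\<close>)
    also have "\<dots> \<le> B i"
      using i01
    proof
      assume 0: "i = 0"
      have "real N * real d / 2 ^ l \<le> real N * 2 ^ Suc \<Lambda> / 2 ^ l"
        using dr by (intro divide_right_mono mult_left_mono) auto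
      also have "\<dots> = real N / (2 ^ P * 2 ^ P)"
      proof -
        have "l = Suc \<Lambda> + (P + P)" by (simp add: l_def)
        then have "(2::real) ^ l = 2 ^ Suc \<Lambda> * (2 ^ P * 2 ^ P)" by (simp only: power_add)
        then show ?thesis by simp
      qed
      finally have f1: "real N * real d / 2 ^ l + 2 \<le> real N / (2 ^ P * 2 ^ P) + 2" by simp
      have "2 * 2 ^ (l - P) / real d \<le> 2 * 2 ^ (l - P) / 2 ^ \<Lambda>" using dr d0 by (intro divide_left_mono) auto
      also have "\<dots> = 4 * 2 ^ P"
      proof -
        have "l - P = \<Lambda> + (P + 1)" by (simp add: l_def)
        then show ?thesis by (simp add: power_add)
      qed
      finally have "2 * 2 ^ (l - P) / real d \<le> 4 * 2 ^ P" .
      moreover have "(1::real) \<le> 2 ^ P" by simp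
      ultimately have f2: "2 * 2 ^ (l - P) / real d + 1 \<le> 5 * 2 ^ P" by linarith
      have "(real N * real d / 2 ^ l + 2) * (2 * 2 ^ (l - P) / real d + 1) \<le> (real N / (2 ^ P * 2 ^ P) + 2) * (5 * 2 ^ P)"
        using f1 f2 by (intro mult_mono) auto
      also have "\<dots> = 5 * (real N / 2 ^ P) + 10 * 2 ^ P" by (simp add: field_simps)
      also have "10 * 2 ^ P \<le> 10 * (real N / 2 ^ P)" using pow_N[of P] by (simp add: field_simps)
      finally show ?thesis by (simp add: 0 lam_def \<delta>_def B_def)
    next
      assume 1: "i = 1"
      have "real (N * d) \<le> real (2 ^ L)" using L(1) by (rule of_nat_mono)
      then have f1: "real N * real d / 2 ^ L + 2 \<le> 3" by (simp add: divide_le_eq)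
      have "2 * 2 ^ (\<Lambda> + 1 + w) / real d \<le> 2 * 2 ^ (\<Lambda> + 1 + w) / 2 ^ \<Lambda>" using dr d0 by (intro divide_left_mono) auto
      also have "\<dots> = 4 * 2 ^ w" by (simp add: power_add)
      finally have "2 * 2 ^ (\<Lambda> + 1 + w) / real d \<le> 4 * 2 ^ w" .
      moreover have "(1::real) \<le> 2 ^ w" by simp
      ultimately have f2: "2 * 2 ^ (\<Lambda> + 1 + w) / real d + 1 \<le> 5 * 2 ^ w" by linarith
      have "(real N * real d / 2 ^ L + 2) * (2 * 2 ^ (\<Lambda> + 1 + w) / real d + 1) \<le> 3 * (5 * 2 ^ w)"
        using f1 f2 by (intro mult_mono) auto
      also have "\<dots> \<le> 2 ^ (4 + w)" by (simp add: power_add)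
      also have "\<dots> \<le> real N / 2 ^ P" using pow_N[of "4 + w"] w(2) P by (simp add: field_simps)
      finally show ?thesis by (simp add: 1 lam_def \<delta>_def B_def)
    qed
    finally show "real (card {n. n < N' \<and> near (2 ^ lam i) (\<delta> i) (int n * int d + b')}) \<le> B i" .
  qed (use m N(1) N0 v in auto)
  also have "lam (Suc 1) = L" by (simp add: lam_def)
  also have "(\<Sum>i<Suc 1. B i) = 16 * real N / 2 ^ P" by (simp add: B_def lessThan_Suc)
  finally have "((\<Sum>n<N'. tm L (int n * int d + b)) / real N) ^ (2 ^ Suc 1)
    \<le> (1 - 2 / 2 ^ ((m + m) * (2 * 1)) / 2 ^ (2 * (m + m))) ^ p + 2 * 2 ^ Suc 1 * (16 * real N / 2 ^ P) / real N + 1 / 2 ^ P"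
    using E Mp unfolding E_def M_def by (simp add: add.assoc)
  moreover have "2 * 2 ^ Suc 1 * (16 * real N / 2 ^ P) / real N + 1 / 2 ^ P = 129 / 2 ^ P"
    using N0 by (simp add: field_simps)
  moreover have "(2::nat) ^ Suc 1 = 4" "2 * (1::nat) = 2" by simp_all
  ultimately show ?thesis unfolding M_def by (simp only: add.assoc)
qed

section \<open>Blocks of moduli\<close>

lemma max_over_attained:
  assumes "finite (f ` I)" "I \<noteq> {}"
  shows "\<exists>i\<in>I. max_over I f = f i"
proof -
  have "Max (f ` I) \<in> f ` I" using assms by (intro Max_in) auto
  then obtain i where "i \<in> I" "Max (f ` I) = f i" by (rule imageE)
  then show ?thesis using assms by (intro bexI[of _ i]) (simp_all add: max_over_def)
qed

lemma le_max_over: "finite (f ` I) \<Longrightarrow> i \<in> I \<Longrightarrow> f i \<le> max_over I f"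
  unfolding max_over_def by auto

lemma finite_image_real_cutoff:
  fixes G :: "real \<Rightarrow> 'b" and F :: "nat set \<Rightarrow> 'b"
  assumes "\<And>y. G y = F {n. real n < y}"
  shows "finite (G ` {0..x})"
  using finite_image_partial_sums[of F x] assms by (simp add: image_def)

definition progression_max :: "real \<Rightarrow> nat \<Rightarrow> real" where
  "progression_max x d = max_over {0..x} (\<lambda>y. max_over {..<d} (\<lambda>a.
     \<bar>\<Sum>n | real n < y \<and> [n = a] (mod d). (-1) ^ binary_digit_sum n\<bar>))"

lemma finite_progression_image:
  "finite ((\<lambda>y. max_over {..<d} (\<lambda>a. \<bar>\<Sum>n | real n < y \<and> [n = a] (mod d). (-1) ^ binary_digit_sum n\<bar>)) ` {0..x})"
  by (rule finite_image_real_cutoff[where F = "\<lambda>A. max_over {..<d} (\<lambda>a. \<bar>\<Sum>n | n \<in> A \<and> [n = a] (mod d). (-1) ^ binary_digit_sum n\<bar>)"])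
     simp

text \<open>
  Parametrising the residue class by \<open>n = j * d + a\<close> turns the cut-off \<open>y\<close> into a cut-off for \<open>j\<close>.
\<close>

lemma sum_progression:
  fixes f :: "nat \<Rightarrow> real"
  assumes "0 < d" "a < d"
  shows "(\<Sum>n | real n < y \<and> [n = a] (mod d). f n) = (\<Sum>j<nat \<lceil>(y - real a) / real d\<rceil>. f (j * d + a))"
proof -
  have iff: "real (j * d + a) < y \<longleftrightarrow> j < nat \<lceil>(y - real a) / real d\<rceil>" for j
  proof -
    have "real (j * d + a) < y \<longleftrightarrow> real j < (y - real a) / real d" using assms by (simp add: field_simps)
    also have "\<dots> \<longleftrightarrow> int j < \<lceil>(y - real a) / real d\<rceil>" by (simp add: less_ceiling_iff)
    also have "\<dots> \<longleftrightarrow> j < nat \<lceil>(y - real a) / real d\<rceil>" by linarith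
    finally show ?thesis .
  qed
  have "{n. real n < y \<and> [n = a] (mod d)} = (\<lambda>j. j * d + a) ` {..<nat \<lceil>(y - real a) / real d\<rceil>}"
  proof (intro equalityI subsetI)
    fix n assume n: "n \<in> {n. real n < y \<and> [n = a] (mod d)}"
    then have "n mod d = a mod d" by (simp add: Cong.cong_def)
    then have "n mod d = a" using assms by simp
    then have e: "n = (n div d) * d + a" using div_mult_mod_eq[of n d] by simp
    have "n div d < nat \<lceil>(y - real a) / real d\<rceil>" using n iff[of "n div d"] unfolding e[symmetric] by blast
    then show "n \<in> (\<lambda>j. j * d + a) ` {..<nat \<lceil>(y - real a) / real d\<rceil>}"
      using e by (intro image_eqI[of _ _ "n div d"]) auto
  next
    fix n assume "n \<in> (\<lambda>j. j * d + a) ` {..<nat \<lceil>(y - real a) / real d\<rceil>}"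
    then obtain j where j: "n = j * d + a" "j < nat \<lceil>(y - real a) / real d\<rceil>" by blast
    have "real n < y" unfolding j(1) using j(2) iff by blast
    moreover have "[n = a] (mod d)" by (simp add: j(1) Cong.cong_def)
    ultimately show "n \<in> {n. real n < y \<and> [n = a] (mod d)}" by blast
  qed
  moreover have "inj_on (\<lambda>j. j * d + a) A" for A using assms by (auto simp: inj_on_def)
  ultimately show ?thesis by (simp add: sum.reindex)
qed

lemma progression_max_attained:
  assumes "0 < d" "0 \<le> x"
  shows "\<exists>N' a. N' \<le> nat \<lceil>x / real d\<rceil> \<and> a < d \<and>
    progression_max x d = \<bar>\<Sum>j<N'. (-1) ^ binary_digit_sum (j * d + a)\<bar>"
proof -
  obtain y where y: "y \<in> {0..x}" "progression_max x d =
      max_over {..<d} (\<lambda>a. \<bar>\<Sum>n | real n < y \<and> [n = a] (mod d). (-1) ^ binary_digit_sum n\<bar>)"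
    unfolding progression_max_def using max_over_attained[OF finite_progression_image] assms by fastforce
  obtain a where a: "a < d" "max_over {..<d} (\<lambda>a. \<bar>\<Sum>n | real n < y \<and> [n = a] (mod d). (-1) ^ binary_digit_sum n\<bar>)
      = \<bar>\<Sum>n | real n < y \<and> [n = a] (mod d). (-1) ^ binary_digit_sum n :: real\<bar>"
    using max_over_attained[of "\<lambda>a. \<bar>\<Sum>n | real n < y \<and> [n = a] (mod d). (-1) ^ binary_digit_sum n :: real\<bar>" "{..<d}"] assms by fastforce
  have "(y - real a) / real d \<le> x / real d" using y by (intro divide_right_mono) auto
  then have "nat \<lceil>(y - real a) / real d\<rceil> \<le> nat \<lceil>x / real d\<rceil>" by (intro nat_mono ceiling_mono)
  then show ?thesis using a(1) unfolding y(2) a(2) sum_progression[OF assms(1) a(1)] by blast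
qed

lemma progression_max_bounds:
  assumes "0 < d" "0 \<le> x"
  shows "0 \<le> progression_max x d" "progression_max x d \<le> x / real d + 1"
proof -
  obtain N' a where N': "N' \<le> nat \<lceil>x / real d\<rceil>" "progression_max x d = \<bar>\<Sum>j<N'. (-1) ^ binary_digit_sum (j * d + a)\<bar>"
    using progression_max_attained[OF assms] by blast
  show "0 \<le> progression_max x d" unfolding N' by simp
  have "\<bar>\<Sum>j<N'. (-1) ^ binary_digit_sum (j * d + a) :: real\<bar> \<le> (\<Sum>j<N'. \<bar>(-1) ^ binary_digit_sum (j * d + a) :: real\<bar>)"
    by (rule sum_abs)
  also have "\<dots> = real N'" by (simp add: power_abs)
  also have "\<dots> \<le> real (nat \<lceil>x / real d\<rceil>)" using N' by simp
  also have "\<dots> \<le> x / real d + 1" using assms by (simp add: of_nat_nat)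
  finally show "progression_max x d \<le> x / real d + 1" unfolding N' .
qed

text \<open>
  Both ranges of moduli together, with constants depending only on a bound \<open>h\<close> for the number of
  directions.
\<close>

lemma block_bound:
  fixes h p \<Lambda> :: nat and x :: real
  defines "M \<equiv> (h + 2) + (h + 2)"
  defines "P \<equiv> M * p" and "N \<equiv> nat \<lceil>x / 2 ^ \<Lambda>\<rceil>"
  assumes h: "1 \<le> h" and p: "1 \<le> p" and x: "1 \<le> x"
    and P_large: "3 ^ Suc h * (4 * (real h + 1)) \<le> 2 ^ P" and \<Lambda>: "\<Lambda> \<le> h * P" and N: "2 ^ (31 * P) \<le> real N"
  shows "(mean {2 ^ \<Lambda>..<2 * 2 ^ \<Lambda>} (\<lambda>d. progression_max x d / real N)) ^ (2 ^ Suc h)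
    \<le> (1 - 2 / 2 ^ (M * (2 * h)) / 2 ^ (2 * M)) ^ p + (30 + 3 * real h + 30 * 2 ^ Suc h * (real h + 1)) / 2 ^ P"
proof -
  let ?I = "{2 ^ \<Lambda>..<2 * 2 ^ \<Lambda>} :: nat set"
  define c where "c k = 1 - 2 / (2::real) ^ (M * (2 * k)) / 2 ^ (2 * M)" for k
  define C where "C k = 30 + 3 * real k + 30 * 2 ^ Suc k * (real k + 1)" for k
  \<comment> \<open>So many digits that truncation changes none of the signs in the sums.\<close>
  define L where "L = N * 2 ^ Suc \<Lambda> + \<Lambda> + 50 * P + 1"
  define X where "X = mean ?I (\<lambda>d. progression_max x d / real N)"
  have P: "1 \<le> P" using p by (simp add: P_def M_def)
  have N0: "real N > 0" using N zero_less_power[of "2::real" "31 * P"] by linarith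
  have ne: "finite ?I" "?I \<noteq> {}" by auto
  have sel: "\<exists>N' b. N' \<le> N \<and> progression_max x d = \<bar>\<Sum>n<N'. tm L (int n * int d + b)\<bar>"
    and Nd: "N * d \<le> 2 ^ L" if d: "2 ^ \<Lambda> \<le> d" "d < 2 * 2 ^ \<Lambda>" for d
  proof -
    have "(2::nat) ^ \<Lambda> > 0" by simp
    then have d0: "d > 0" using d(1) by linarith
    have "real (2 ^ \<Lambda>) \<le> real d" using d(1) by (rule of_nat_mono)
    then have "x / real d \<le> x / 2 ^ \<Lambda>" using x d0 by (intro divide_left_mono) auto
    then have le: "nat \<lceil>x / real d\<rceil> \<le> N" unfolding N_def by (intro nat_mono ceiling_mono)
    have "N * d \<le> N * 2 ^ Suc \<Lambda>" using d by (intro mult_left_mono) auto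
    also have "\<dots> \<le> L" by (simp add: L_def)
    also have "\<dots> < 2 ^ L" by (rule less_exp)
    finally show NdL: "N * d \<le> 2 ^ L" by simp
    obtain N' a where N': "N' \<le> nat \<lceil>x / real d\<rceil>" "a < d" "progression_max x d = \<bar>\<Sum>j<N'. (-1) ^ binary_digit_sum (j * d + a)\<bar>"
      using progression_max_attained[OF d0, of x] x by auto
    have "(-1) ^ binary_digit_sum (j * d + a) = tm L (int j * int d + int a)" if "j < N'" for j
    proof -
      have "j * d + a < j * d + d" using N'(2) by simp
      also have "\<dots> = Suc j * d" by simp
      also have "\<dots> \<le> N * d"
      proof (rule mult_right_mono)
        have "N' \<le> N" by (rule order_trans[OF N'(1) le])
        with that show "Suc j \<le> N" by simp
      qed simp
      finally have "j * d + a < 2 ^ L" using NdL by linarith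
      from tm_digit_sum[OF this] show ?thesis by simp
    qed
    then have "progression_max x d = \<bar>\<Sum>n<N'. tm L (int n * int d + int a)\<bar>" unfolding N'(3) by simp
    then show "\<exists>N' b. N' \<le> N \<and> progression_max x d = \<bar>\<Sum>n<N'. tm L (int n * int d + b)\<bar>"
      using N'(1) le by (meson order_trans)
  qed
  have X01: "0 \<le> X" "X \<le> 1"
  proof -
    have bnd: "0 \<le> progression_max x d / real N \<and> progression_max x d / real N \<le> 1" if d: "d \<in> ?I" for d
    proof -
      obtain N' b where N': "N' \<le> N" "progression_max x d = \<bar>\<Sum>n<N'. tm L (int n * int d + b)\<bar>" using sel[of d] d by auto
      have "\<bar>\<Sum>n<N'. tm L (int n * int d + b)\<bar> \<le> (\<Sum>n<N'. \<bar>tm L (int n * int d + b)\<bar>)" by (rule sum_abs)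
      also have "\<dots> \<le> real N" using N' by simp
      finally show ?thesis using N' N0 by simp
    qed
    have "mean ?I (\<lambda>_. 0) \<le> X" "X \<le> mean ?I (\<lambda>_. 1)" unfolding X_def by (rule mean_mono; use bnd in blast)+
    then show "0 \<le> X" "X \<le> 1" unfolding mean_const[OF ne] .
  qed
  have c_nonneg: "0 \<le> c k" and c_mono: "c k \<le> c h" if "1 \<le> k" "k \<le> h" for k
  proof -
    have e: "(2::real) ^ 1 \<le> 2 ^ (M * (2 * k))" using that by (intro power_increasing) (auto simp: M_def)
    then have "2 / (2::real) ^ (M * (2 * k)) \<le> 1" by simp
    then have "2 / (2::real) ^ (M * (2 * k)) / 2 ^ (2 * M) \<le> 1 / 1" by (intro frac_le) auto
    then show "0 \<le> c k" by (simp add: c_def)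
    have "(2::real) ^ (M * (2 * k)) \<le> 2 ^ (M * (2 * h))" using that by (intro power_increasing) auto
    then have "2 / (2::real) ^ (M * (2 * h)) / 2 ^ (2 * M) \<le> 2 / 2 ^ (M * (2 * k)) / 2 ^ (2 * M)"
      by (intro divide_right_mono divide_left_mono) auto
    then show "c k \<le> c h" by (simp add: c_def)
  qed
  have C_mono: "C k \<le> C h" if "k \<le> h" for k
  proof -
    have "(2::real) ^ Suc k \<le> 2 ^ Suc h" using that by (intro power_increasing) auto
    then have "2 ^ Suc k * (real k + 1) \<le> 2 ^ Suc h * (real h + 1)" using that by (intro mult_mono) auto
    then show ?thesis using that by (simp add: C_def)
  qed
  have hh: "h \<le> 2 ^ h" using less_exp[of h] by simp
  have "X ^ (2 ^ Suc h) \<le> c h ^ p + C h / 2 ^ P"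
  proof (cases "\<Lambda> < 20 * P")
    case True
    have pt: "(progression_max x d / real N) ^ 4 \<le> c h ^ p + C h / 2 ^ P" if d: "d \<in> ?I" for d
    proof -
      obtain N' b where N': "N' \<le> N" "progression_max x d = \<bar>\<Sum>n<N'. tm L (int n * int d + b)\<bar>" using sel[of d] d by auto
      have "(progression_max x d / real N) ^ 4 = ((\<Sum>n<N'. tm L (int n * int d + b)) / real N) ^ 4"
        unfolding N'(2) by (simp add: power_divide power_even_abs)
      also have "\<dots> \<le> (1 - 2 / 2 ^ (M * 2) / 2 ^ (2 * M)) ^ p + 129 / 2 ^ P"
        unfolding M_def
        by (rule small_modulus_estimate[OF refl _ P _ _ True N'(1) N]) (use d Nd L_def in \<open>auto simp: P_def M_def\<close>)
      also have "\<dots> = c 1 ^ p + 129 / 2 ^ P" by (simp add: c_def)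
      also have "\<dots> \<le> c h ^ p + C h / 2 ^ P"
      proof (intro add_mono power_mono divide_right_mono)
        have "129 \<le> C 1" by (simp add: C_def)
        also have "\<dots> \<le> C h" by (rule C_mono[OF h])
        finally show "129 \<le> C h" .
      qed (use c_mono[OF order_refl h] c_nonneg[OF order_refl h] in auto)
      finally show ?thesis .
    qed
    have "(4::nat) = 2 ^ 2" by simp
    also have "\<dots> \<le> 2 ^ Suc h" using h by (intro power_increasing) auto
    finally have "X ^ (2 ^ Suc h) \<le> X ^ 4" using X01 by (intro power_decreasing) auto
    also have "\<dots> \<le> mean ?I (\<lambda>d. (progression_max x d / real N) ^ 4)"
      using mean_power[of ?I "\<lambda>d. progression_max x d / real N" 2] by (simp add: X_def)
    also have "\<dots> \<le> mean ?I (\<lambda>_. c h ^ p + C h / 2 ^ P)" by (rule mean_mono) (rule pt)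
    finally show ?thesis unfolding mean_const[OF ne] .
  next
    case False
    define k where "k = \<Lambda> div P - 6"
    have "20 \<le> \<Lambda> div P" using False P by (simp add: less_eq_div_iff_mult_less_eq)
    then have k: "14 \<le> k" "k + 6 = \<Lambda> div P" by (auto simp: k_def)
    have "\<Lambda> div P \<le> h" using \<Lambda> P by (metis div_le_mono div_mult_self_is_m less_eq_Suc_le One_nat_def)
    then have kh: "k \<le> h" using k by simp
    have N20: "2 ^ (20 * P) \<le> real N"
    proof -
      have "(2::real) ^ (20 * P) \<le> 2 ^ (31 * P)" by (intro power_increasing) auto
      with N show ?thesis by linarith
    qed
    have large: "3 ^ Suc k * (4 * (real k + 1)) \<le> 2 ^ P"
    proof -
      have "(3::real) ^ Suc k * (4 * (real k + 1)) \<le> 3 ^ Suc h * (4 * (real h + 1))"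
        using kh by (intro mult_mono power_increasing) auto
      with P_large show ?thesis by linarith
    qed
    have "X ^ (2 ^ Suc h) \<le> X ^ (2 ^ Suc k)"
      using X01 kh by (intro power_decreasing power_increasing) auto
    also have "\<dots> \<le> (1 - 2 / 2 ^ (((h + 2) + (h + 2)) * (2 * k)) / 2 ^ (2 * ((h + 2) + (h + 2)))) ^ p
      + (30 + 3 * real k + 30 * 2 ^ Suc k * (real k + 1)) / 2 ^ P"
      unfolding X_def
    proof (rule dyadic_estimate[OF k P _ _ refl _ N20 large, where L = L])
      show "\<Lambda> + 6 * P + 1 \<le> L" by (simp add: L_def)
      show "k \<le> 2 ^ h" by (rule le_trans[OF kh hh])
      show "P = (h + 2 + (h + 2)) * p" by (simp add: P_def M_def)
    qed (rule sel)
    also have "\<dots> = c k ^ p + C k / 2 ^ P" by (simp add: c_def C_def M_def)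
    also have "\<dots> \<le> c h ^ p + C h / 2 ^ P"
      using c_mono[of k] c_nonneg[of k] C_mono[of k] k kh by (intro add_mono power_mono divide_right_mono) auto
    finally show ?thesis .
  qed
  then show ?thesis by (simp add: X_def c_def C_def)
qed

section \<open>Summation over all moduli\<close>

lemma two_powr_log: "0 < x \<Longrightarrow> 2 powr (a * log 2 x) = x powr a"
  by (simp add: powr_def log_def)

text \<open>
  Choosing \<open>2 ^ P\<close> to be about \<open>x powr \<kappa>\<close> bounds the number of directions by a constant \<open>h\<close>. This fixes
  the block length \<open>M\<close> and hence the rate \<open>c\<close>, and the number \<open>p\<close> of blocks is proportional to \<open>log 2 x\<close>.
\<close>

lemma block_decay:
  assumes \<epsilon>: "0 < \<epsilon>" "\<epsilon> \<le> (1::real)"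
  shows "\<exists>\<eta>>0. \<exists>C>0. \<exists>x0\<ge>1. \<forall>x\<ge>x0. \<forall>\<Lambda>::nat. 2 ^ \<Lambda> \<le> x powr (1 - \<epsilon>) \<longrightarrow>
    (\<Sum>d\<in>{2 ^ \<Lambda>..<2 * 2 ^ \<Lambda>}. progression_max x d) \<le> C * x powr (1 - \<eta>)"
proof -
  \<comment> \<open>The factor 31 makes \<open>2 ^ (31 * P) \<le> x powr \<epsilon> \<le> N\<close>, the room needed by the small moduli.\<close>
  define \<kappa> where "\<kappa> = \<epsilon> / 31"
  define h where "h = nat \<lceil>2 / \<kappa>\<rceil>"
  define M where "M = (h + 2) + (h + 2)"
  define c where "c = 1 - 2 / (2::real) ^ (M * (2 * h)) / 2 ^ (2 * M)"
  define C where "C = 30 + 3 * real h + 30 * 2 ^ Suc h * (real h + 1)"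
  define K where "K = (2::nat) ^ Suc h"
  define \<eta>1 where "\<eta>1 = - (\<kappa> * log 2 c / (2 * real M))"
  define \<eta>2 where "\<eta>2 = min \<eta>1 (\<kappa> / 2)"
  define A where "A = (3::real) ^ Suc h * (4 * (real h + 1))"
  define x0 where "x0 = max (2 powr (2 * real M / \<kappa>)) (A powr (2 / \<kappa>))"
  have \<kappa>: "\<kappa> > 0" using \<epsilon> by (simp add: \<kappa>_def)
  have h2: "2 / \<kappa> \<le> real h" unfolding h_def by linarith
  have "0 < 2 / \<kappa>" using \<kappa> by simp
  with h2 have h1: "1 \<le> h" by (cases h) auto
  have M: "real M > 0" by (simp add: M_def)
  have c: "0 < c" "c < 1"
  proof -
    have "(2::real) ^ 1 \<le> 2 ^ (M * (2 * h))" using h1 M by (intro power_increasing) auto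
    then have "2 / (2::real) ^ (M * (2 * h)) \<le> 1" by simp
    then have "2 / (2::real) ^ (M * (2 * h)) / 2 ^ (2 * M) \<le> 1 / 2 ^ (2 * M)" by (intro divide_right_mono) auto
    also have "\<dots> < 1" using M by simp
    finally show "0 < c" by (simp add: c_def)
    show "c < 1" by (simp add: c_def)
  qed
  have \<eta>1: "\<eta>1 > 0" using \<kappa> c M by (simp add: \<eta>1_def divide_less_0_iff mult_less_0_iff)
  have \<eta>2: "\<eta>2 > 0" using \<eta>1 \<kappa> by (simp add: \<eta>2_def)
  have K: "real K > 0" "K > 0" by (simp_all add: K_def)
  have C0: "C > 0" by (simp add: C_def add_pos_nonneg)
  have "(1::real) \<le> 3 ^ Suc h" by (rule one_le_power) simp
  then have "(1::real) * 1 \<le> 3 ^ Suc h * (4 * (real h + 1))" by (intro mult_mono) auto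
  then have A1: "1 \<le> A" by (simp add: A_def)
  have "1 \<le> 2 powr (2 * real M / \<kappa>)" using M \<kappa> by (intro ge_one_powr_ge_zero) auto
  then have x0_ge: "1 \<le> x0" by (simp add: x0_def)
  have main: "(\<Sum>d\<in>{2 ^ \<Lambda>..<2 * 2 ^ \<Lambda>}. progression_max x d) \<le> 2 * (1 + C) powr (1 / real K) * x powr (1 - \<eta>2 / real K)"
    if x0: "x0 \<le> x" and \<Lambda>: "2 ^ \<Lambda> \<le> x powr (1 - \<epsilon>)" for x and \<Lambda> :: nat
  proof -
    have x1: "1 \<le> x" using x0_ge x0 by simp
    then have xpos: "0 < x" by simp
    define l where "l = log 2 x"
    have xl: "2 powr (a * l) = x powr a" for a unfolding l_def using xpos by (rule two_powr_log)
    have l0: "0 \<le> l" using x1 by (simp add: l_def)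
    have l: "2 * real M / \<kappa> \<le> l"
    proof -
      have "2 powr (2 * real M / \<kappa>) \<le> x" using x0 by (simp add: x0_def)
      then show ?thesis unfolding l_def using xpos by (simp add: le_log_iff)
    qed
    define t where "t = \<kappa> * l / real M"
    have t: "2 \<le> t" using l \<kappa> M by (simp add: t_def field_simps)
    define p where "p = nat \<lfloor>t\<rfloor>"
    have p: "real p \<le> t" "t / 2 \<le> real p" "1 \<le> p" using t unfolding p_def by linarith+
    define P where "P = M * p"
    have P: "real P \<le> \<kappa> * l" "\<kappa> * l / 2 \<le> real P"
    proof -
      have "real M * real p \<le> real M * t" "real M * (t / 2) \<le> real M * real p" using p M by (auto intro: mult_left_mono)
      moreover have "real M * t = \<kappa> * l" using M by (simp add: t_def)
      ultimately show "real P \<le> \<kappa> * l" "\<kappa> * l / 2 \<le> real P" by (simp_all add: P_def)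
    qed
    have pow: "(2::real) ^ n = 2 powr real n" for n by (simp add: powr_realpow)
    have P2: "x powr (\<kappa> / 2) \<le> 2 ^ P"
    proof -
      have "x powr (\<kappa> / 2) = 2 powr (\<kappa> / 2 * l)" by (rule xl[symmetric])
      also have "\<dots> \<le> 2 powr real P" using P by (intro powr_mono) auto
      finally show ?thesis unfolding pow .
    qed
    have large: "A \<le> 2 ^ P"
    proof -
      have "A = (A powr (2 / \<kappa>)) powr (\<kappa> / 2)" using A1 \<kappa> by (simp add: powr_powr)
      also have "\<dots> \<le> x powr (\<kappa> / 2)" using x0 \<kappa> by (intro powr_mono2) (auto simp: x0_def)
      finally show ?thesis using P2 by linarith
    qed
    have \<Lambda>x: "2 ^ \<Lambda> \<le> x"
    proof -
      have "x powr (1 - \<epsilon>) \<le> x powr 1" using x1 \<epsilon> by (intro powr_mono) auto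
      with \<Lambda> x1 show ?thesis by simp
    qed
    have \<Lambda>h: "\<Lambda> \<le> h * P"
    proof -
      have "2 powr real \<Lambda> \<le> x" using \<Lambda>x by (simp add: powr_realpow)
      then have "real \<Lambda> \<le> l" unfolding l_def using xpos by (simp add: le_log_iff)
      also have "l = 2 / \<kappa> * (\<kappa> * l / 2)" using \<kappa> by simp
      also have "\<dots> \<le> real h * real P" using h2 P \<kappa> l0 by (intro mult_mono) auto
      finally have "real \<Lambda> \<le> real (h * P)" by simp
      then show ?thesis by (simp only: of_nat_le_iff)
    qed
    define N where "N = nat \<lceil>x / 2 ^ \<Lambda>\<rceil>"
    have Nx: "x / 2 ^ \<Lambda> \<le> real N" "real N \<le> x / 2 ^ \<Lambda> + 1"
    proof -
      have "0 \<le> x / 2 ^ \<Lambda>" using xpos by simp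
      then show "x / 2 ^ \<Lambda> \<le> real N" "real N \<le> x / 2 ^ \<Lambda> + 1" unfolding N_def by linarith+
    qed
    have N31: "2 ^ (31 * P) \<le> real N"
    proof -
      have "(2::real) ^ (31 * P) = 2 powr (31 * real P)" unfolding pow by simp
      also have "\<dots> \<le> 2 powr (\<epsilon> * l)" using P by (intro powr_mono) (auto simp: \<kappa>_def)
      also have "\<dots> = x powr \<epsilon>" by (rule xl)
      also have "\<dots> = x / x powr (1 - \<epsilon>)" using xpos by (simp add: powr_diff)
      also have "\<dots> \<le> x / 2 ^ \<Lambda>" using \<Lambda> xpos by (intro divide_left_mono) auto
      finally show ?thesis using Nx by linarith
    qed
    have N0: "real N > 0" using N31 zero_less_power[of "2::real" "31 * P"] by linarith
    define X where "X = mean {2 ^ \<Lambda>..<2 * 2 ^ \<Lambda>} (\<lambda>d. progression_max x d / real N)"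
    have "X ^ K \<le> c ^ p + C / 2 ^ P"
      unfolding X_def K_def c_def C_def M_def N_def P_def
      by (rule block_bound[OF h1 p(3) x1]) (use large \<Lambda>h N31 in \<open>simp_all only: A_def P_def M_def N_def\<close>)
    also have "c ^ p \<le> x powr (- \<eta>2)"
    proof -
      have "c ^ p = c powr real p" using c by (simp add: powr_realpow)
      also have "\<dots> \<le> c powr (t / 2)" using c p by (intro powr_mono') auto
      also have "\<dots> = 2 powr (log 2 c * (t / 2))" using c by (simp add: powr_def log_def)
      also have "log 2 c * (t / 2) = - \<eta>1 * l" by (simp add: t_def \<eta>1_def mult_ac)
      also have "2 powr (- \<eta>1 * l) = x powr (- \<eta>1)" by (rule xl)
      also have "\<dots> \<le> x powr (- \<eta>2)" using x1 by (intro powr_mono) (auto simp: \<eta>2_def)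
      finally show ?thesis .
    qed
    also have "C / 2 ^ P \<le> C * x powr (- \<eta>2)"
    proof -
      have "C / 2 ^ P \<le> C / x powr (\<kappa> / 2)" using P2 C0 xpos by (intro divide_left_mono) auto
      also have "\<dots> = C * x powr (- (\<kappa> / 2))" by (simp add: powr_minus_divide)
      also have "\<dots> \<le> C * x powr (- \<eta>2)" using x1 C0 by (intro mult_left_mono powr_mono) (auto simp: \<eta>2_def)
      finally show ?thesis .
    qed
    finally have XK: "X ^ K \<le> (1 + C) * x powr (- \<eta>2)" by (simp add: algebra_simps)
    have X: "X \<le> (1 + C) powr (1 / real K) * x powr (- (\<eta>2 / real K))"
    proof (cases "X > 0")
      case True
      have "X = (X ^ K) powr (1 / real K)" using True K by (simp add: powr_powr flip: powr_realpow)
      also have "\<dots> \<le> ((1 + C) * x powr (- \<eta>2)) powr (1 / real K)" using XK True by (intro powr_mono2) auto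
      also have "\<dots> = (1 + C) powr (1 / real K) * x powr (- (\<eta>2 / real K))"
        using C0 by (simp add: powr_mult powr_powr)
      finally show ?thesis .
    next
      case False
      have "0 \<le> (1 + C) powr (1 / real K) * x powr (- (\<eta>2 / real K))" by simp
      with False show ?thesis by linarith
    qed
    have "(\<Sum>d\<in>{2 ^ \<Lambda>..<2 * 2 ^ \<Lambda>}. progression_max x d) = X * (real N * 2 ^ \<Lambda>)"
      using N0 by (simp add: X_def mean_def sum_divide_distrib[symmetric])
    also have "\<dots> \<le> ((1 + C) powr (1 / real K) * x powr (- (\<eta>2 / real K))) * (2 * x)"
    proof -
      have "real N * 2 ^ \<Lambda> \<le> (x / 2 ^ \<Lambda> + 1) * 2 ^ \<Lambda>" using Nx by (intro mult_right_mono) auto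
      also have "\<dots> = x + 2 ^ \<Lambda>" by (simp add: algebra_simps)
      finally have "real N * 2 ^ \<Lambda> \<le> 2 * x" using \<Lambda>x by linarith
      then have "X * (real N * 2 ^ \<Lambda>) \<le> ((1 + C) powr (1 / real K) * x powr (- (\<eta>2 / real K))) * (real N * 2 ^ \<Lambda>)"
        using X by (intro mult_right_mono) auto
      also have "\<dots> \<le> ((1 + C) powr (1 / real K) * x powr (- (\<eta>2 / real K))) * (2 * x)"
        using \<open>real N * 2 ^ \<Lambda> \<le> 2 * x\<close> by (intro mult_left_mono) auto
      finally show ?thesis .
    qed
    also have "\<dots> = 2 * (1 + C) powr (1 / real K) * x powr (1 - \<eta>2 / real K)"
      using powr_add[of x 1 "- (\<eta>2 / real K)"] xpos by simp
    finally show ?thesis .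
  qed
  have "0 < \<eta>2 / real K" "0 < 2 * (1 + C) powr (1 / real K)" using \<eta>2 K C0 by simp_all
  with x0_ge main show ?thesis by blast
qed

lemma card_real_below: "finite {d::nat. 1 \<le> d \<and> real d \<le> z}" "real (card {d::nat. 1 \<le> d \<and> real d \<le> z}) \<le> max 0 z"
proof -
  have sub: "{d::nat. 1 \<le> d \<and> real d \<le> z} \<subseteq> {1..nat \<lfloor>z\<rfloor>}" by (auto simp: le_nat_floor)
  then show "finite {d::nat. 1 \<le> d \<and> real d \<le> z}" by (rule finite_subset) simp
  have "card {d::nat. 1 \<le> d \<and> real d \<le> z} \<le> card {1..nat \<lfloor>z\<rfloor>}" by (rule card_mono[OF _ sub]) simp
  then have "real (card {d::nat. 1 \<le> d \<and> real d \<le> z}) \<le> real (nat \<lfloor>z\<rfloor>)" by simp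
  also have "\<dots> \<le> max 0 z" by linarith
  finally show "real (card {d::nat. 1 \<le> d \<and> real d \<le> z}) \<le> max 0 z" .
qed

text \<open>
  There are at most \<open>log 2 x + 1\<close> dyadic blocks.
\<close>

lemma sum_progression_max_dyadic:
  fixes x z B :: real
  assumes x: "1 \<le> x" and z: "1 \<le> z" "z \<le> x"
    and B: "\<And>\<Lambda>::nat. 2 ^ \<Lambda> \<le> z \<Longrightarrow> (\<Sum>d\<in>{2 ^ \<Lambda>..<2 * 2 ^ \<Lambda>}. progression_max x d) \<le> B"
  shows "(\<Sum>d | 1 \<le> d \<and> real d \<le> z. progression_max x d) \<le> (log 2 x + 1) * B"
proof -
  let ?S = "{d::nat. 1 \<le> d \<and> real d \<le> z}"
  define n where "n = nat \<lfloor>log 2 x\<rfloor>"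
  have l0: "0 \<le> log 2 x" using x by simp
  have "\<exists>e. 2 ^ e \<le> d \<and> d < 2 * 2 ^ e" if "1 \<le> d" for d :: nat
    using ex_power_ivl1[of 2 d] that by auto
  then obtain g :: "nat \<Rightarrow> nat" where g: "\<And>d. 1 \<le> d \<Longrightarrow> 2 ^ g d \<le> d \<and> d < 2 * 2 ^ g d" by metis
  have nonneg: "0 \<le> progression_max x d" if "1 \<le> d" for d
    using progression_max_bounds(1)[of d x] that x by simp
  have pow_z: "2 ^ g d \<le> z" if "d \<in> ?S" for d
  proof -
    have "real (2 ^ g d) \<le> real d" using g[of d] that by (intro of_nat_mono) simp
    also have "\<dots> \<le> z" using that by simp
    finally show ?thesis by simp
  qed
  have "g ` ?S \<subseteq> {..n}"
  proof
    fix e assume "e \<in> g ` ?S"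
    then obtain d where d: "d \<in> ?S" "e = g d" by blast
    have "2 powr real e \<le> x" using pow_z[OF d(1)] z d by (simp add: powr_realpow)
    then have "real e \<le> log 2 x" using x by (simp add: le_log_iff)
    then show "e \<in> {..n}" by (simp add: n_def le_nat_floor)
  qed
  then have "(\<Sum>d\<in>?S. progression_max x d) = (\<Sum>e\<le>n. \<Sum>d\<in>{d \<in> ?S. g d = e}. progression_max x d)"
    by (intro sum.group[symmetric] card_real_below(1)) auto
  also have "\<dots> \<le> (\<Sum>e\<le>n. B)"
  proof (rule sum_mono)
    fix e
    have B0: "0 \<le> B"
    proof -
      have "0 \<le> (\<Sum>d\<in>{2 ^ 0..<2 * 2 ^ 0}. progression_max x d)" by (intro sum_nonneg nonneg) simp
      also have "\<dots> \<le> B" using z by (intro B) simp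
      finally show ?thesis .
    qed
    show "(\<Sum>d\<in>{d \<in> ?S. g d = e}. progression_max x d) \<le> B"
    proof (cases "{d \<in> ?S. g d = e} = {}")
      case True
      then show ?thesis using B0 by (simp only: sum.empty)
    next
      case False
      then obtain d where "d \<in> ?S" "g d = e" by blast
      then have e: "2 ^ e \<le> z" using pow_z by blast
      have "(\<Sum>d\<in>{d \<in> ?S. g d = e}. progression_max x d) \<le> (\<Sum>d\<in>{2 ^ e..<2 * 2 ^ e}. progression_max x d)"
      proof (rule sum_mono2)
        show "{d \<in> ?S. g d = e} \<subseteq> {2 ^ e..<2 * 2 ^ e}" using g by auto
        fix d assume "d \<in> {2 ^ e..<2 * 2 ^ e} - {d \<in> ?S. g d = e}"
        then have "2 ^ e \<le> d" by simp
        moreover have "(1::nat) \<le> 2 ^ e" by simp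
        ultimately show "0 \<le> progression_max x d" by (intro nonneg) linarith
      qed simp
      also have "\<dots> \<le> B" by (rule B[OF e])
      finally show ?thesis .
    qed
  qed
  also have "\<dots> = (real n + 1) * B" by simp
  also have "\<dots> \<le> (log 2 x + 1) * B"
  proof (rule mult_right_mono)
    show "real n + 1 \<le> log 2 x + 1" using l0 unfolding n_def by linarith
    have "0 \<le> (\<Sum>d\<in>{2 ^ 0..<2 * 2 ^ 0}. progression_max x d)" by (intro sum_nonneg nonneg) simp
    also have "\<dots> \<le> B" using z by (intro B) simp
    finally show "0 \<le> B" .
  qed
  finally show ?thesis .
qed

text \<open>
  Half of the exponent saved on each block pays for the number of blocks; for bounded \<open>x\<close> the trivial
  bound is sufficient.
\<close>

lemma progression_max_sum_decay:
  fixes \<epsilon> :: real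
  assumes "0 < \<epsilon>"
  shows "\<exists>\<eta>>0. \<exists>C>0. \<forall>x\<ge>1. (\<Sum>d | 1 \<le> d \<and> real d \<le> x powr (1 - \<epsilon>). progression_max x d) \<le> C * x powr (1 - \<eta>)"
proof -
  define \<epsilon>' where "\<epsilon>' = min \<epsilon> 1"
  have \<epsilon>': "0 < \<epsilon>'" "\<epsilon>' \<le> 1" using assms by (auto simp: \<epsilon>'_def)
  obtain \<eta>0 C0 x0 where \<eta>0: "\<eta>0 > 0" and C0: "C0 > 0" and x0: "x0 \<ge> 1" and
    block: "\<And>x \<Lambda>. x0 \<le> x \<Longrightarrow> 2 ^ \<Lambda> \<le> x powr (1 - \<epsilon>') \<Longrightarrow>
      (\<Sum>d\<in>{2 ^ \<Lambda>..<2 * 2 ^ \<Lambda>}. progression_max x d) \<le> C0 * x powr (1 - \<eta>0)"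
    using block_decay[OF \<epsilon>'] by blast
  define \<eta>' where "\<eta>' = min \<eta>0 1"
  define \<eta> where "\<eta> = \<eta>' / 2"
  have \<eta>: "0 < \<eta>" "\<eta> \<le> 1" "\<eta>' = \<eta> + \<eta>" "\<eta>' \<le> \<eta>0" using \<eta>0 by (auto simp: \<eta>_def \<eta>'_def)
  define C where "C = (1 / (\<eta> * ln 2) + 1) * C0 + x0 * (x0 + 1)"
  have large: "(\<Sum>d | 1 \<le> d \<and> real d \<le> x powr (1 - \<epsilon>'). progression_max x d) \<le> (1 / (\<eta> * ln 2) + 1) * C0 * x powr (1 - \<eta>)"
    if x: "x0 \<le> x" for x
  proof -
    have x1: "1 \<le> x" using x x0 by simp
    have "x powr (1 - \<epsilon>') \<le> x powr 1" using x1 \<epsilon>' by (intro powr_mono) auto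
    then have z: "1 \<le> x powr (1 - \<epsilon>')" "x powr (1 - \<epsilon>') \<le> x"
      using x1 \<epsilon>' by (auto intro: ge_one_powr_ge_zero)
    have "(\<Sum>d | 1 \<le> d \<and> real d \<le> x powr (1 - \<epsilon>'). progression_max x d) \<le> (log 2 x + 1) * (C0 * x powr (1 - \<eta>0))"
      by (rule sum_progression_max_dyadic[OF x1 z block[OF x]])
    also have "\<dots> \<le> ((1 / (\<eta> * ln 2) + 1) * x powr \<eta>) * (C0 * x powr (1 - \<eta>'))"
    proof (intro mult_mono mult_left_mono powr_mono)
      have "log 2 x \<le> x powr \<eta> / \<eta> / ln 2" unfolding log_def using ln_powr_bound[OF x1 \<eta>(1)] by (intro divide_right_mono) auto
      moreover have "1 \<le> x powr \<eta>" using x1 \<eta> by (intro ge_one_powr_ge_zero) auto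
      ultimately show "log 2 x + 1 \<le> (1 / (\<eta> * ln 2) + 1) * x powr \<eta>" by (simp add: algebra_simps)
    qed (use x1 \<eta> C0 in auto)
    also have "\<dots> = (1 / (\<eta> * ln 2) + 1) * C0 * (x powr \<eta> * x powr (1 - \<eta>'))" by simp
    also have "x powr \<eta> * x powr (1 - \<eta>') = x powr (1 - \<eta>)" by (simp add: \<eta>(3) flip: powr_add)
    finally show ?thesis .
  qed
  have small: "(\<Sum>d | 1 \<le> d \<and> real d \<le> x powr (1 - \<epsilon>'). progression_max x d) \<le> x0 * (x0 + 1) * x powr (1 - \<eta>)"
    if x: "1 \<le> x" "x < x0" for x
  proof -
    let ?S = "{d::nat. 1 \<le> d \<and> real d \<le> x powr (1 - \<epsilon>')}"
    have "x powr (1 - \<epsilon>') \<le> x powr 1" using x \<epsilon>' by (intro powr_mono) auto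
    then have "real (card ?S) \<le> x0" using card_real_below(2)[of "x powr (1 - \<epsilon>')"] x by simp
    have "(\<Sum>d\<in>?S. progression_max x d) \<le> (\<Sum>d\<in>?S. x0 + 1)"
    proof (rule sum_mono)
      fix d assume d: "d \<in> ?S"
      then have "progression_max x d \<le> x / real d + 1" using x by (intro progression_max_bounds) auto
      also have "x / real d \<le> x / 1" using d x by (intro divide_left_mono) auto
      finally show "progression_max x d \<le> x0 + 1" using x by simp
    qed
    also have "\<dots> = real (card ?S) * (x0 + 1)" by simp
    also have "\<dots> \<le> x0 * (x0 + 1)" using \<open>real (card ?S) \<le> x0\<close> x0 by (intro mult_right_mono) auto
    finally have "(\<Sum>d\<in>?S. progression_max x d) \<le> x0 * (x0 + 1) * 1" by simp
    also have "\<dots> \<le> x0 * (x0 + 1) * x powr (1 - \<eta>)"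
      using x0 x \<eta> by (intro mult_left_mono ge_one_powr_ge_zero) auto
    finally show ?thesis .
  qed
  have C: "0 < C" using \<eta> C0 x0 by (simp add: C_def add_pos_pos)
  have "(\<Sum>d | 1 \<le> d \<and> real d \<le> x powr (1 - \<epsilon>). progression_max x d) \<le> C * x powr (1 - \<eta>)"
    if x: "1 \<le> x" for x
  proof -
    \<comment> \<open>Moduli up to a smaller bound form a subset, so \<open>\<epsilon> > 1\<close> reduces to \<open>\<epsilon> = 1\<close>.\<close>
    have "x powr (1 - \<epsilon>) \<le> x powr (1 - \<epsilon>')" using x by (intro powr_mono) (auto simp: \<epsilon>'_def)
    then have "(\<Sum>d | 1 \<le> d \<and> real d \<le> x powr (1 - \<epsilon>). progression_max x d)
      \<le> (\<Sum>d | 1 \<le> d \<and> real d \<le> x powr (1 - \<epsilon>'). progression_max x d)"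
      using x by (intro sum_mono2 card_real_below(1) progression_max_bounds(1)) auto
    also have "\<dots> \<le> C * x powr (1 - \<eta>)"
    proof (cases "x0 \<le> x")
      case True
      have "(1 / (\<eta> * ln 2) + 1) * C0 * x powr (1 - \<eta>) \<le> C * x powr (1 - \<eta>)"
        using x0 by (intro mult_right_mono) (auto simp: C_def)
      with large[OF True] show ?thesis by linarith
    next
      case False
      have "x0 * (x0 + 1) * x powr (1 - \<eta>) \<le> C * x powr (1 - \<eta>)"
        using \<eta> C0 by (intro mult_right_mono) (auto simp: C_def)
      with small[of x] x False show ?thesis by linarith
    qed
    finally show ?thesis .
  qed
  with \<eta>(1) C show ?thesis by blast
qed

section \<open>The level of distribution\<close>

lemma thue_morse_sign: "real (thue_morse n) = (1 - (-1) ^ binary_digit_sum n) / 2"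
  by (cases "even (binary_digit_sum n)") (auto simp: thue_morse_def Cong.cong_def even_iff_mod_2_eq_zero)

lemma binary_digit_sum_double:
  "binary_digit_sum (Suc (2 * n)) = Suc (binary_digit_sum (2 * n))"
proof -
  have odd: "bit (Suc (2 * n)) i \<longleftrightarrow> i = 0 \<or> bit (2 * n) i" for i
    by (cases i) (simp_all add: bit_0 bit_Suc)
  have fin: "finite {i. bit (2 * n) i}"
  proof (rule finite_subset)
    show "{i. bit (2 * n) i} \<subseteq> {..2 * n}"
    proof
      fix i assume "i \<in> {i. bit (2 * n) i}"
      then have "2 ^ i \<le> 2 * n" by (metis bit_iff_odd div_less even_zero linorder_not_le mem_Collect_eq)
      moreover have "i < 2 ^ i" by (rule less_exp)
      ultimately show "i \<in> {..2 * n}" unfolding atMost_iff by linarith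
    qed
  qed simp
  have "{i. bit (Suc (2 * n)) i} = insert 0 {i. bit (2 * n) i}" using odd by auto
  moreover have "0 \<notin> {i. bit (2 * n) i}" by (simp add: bit_0)
  ultimately show ?thesis unfolding binary_digit_sum_def using fin by simp
qed

text \<open>
  Among \<open>2 * j\<close> and \<open>2 * j + 1\<close> exactly one has an odd digit sum.
\<close>

lemma sum_thue_morse_lower:
  assumes "1 < x"
  shows "x / 3 \<le> (\<Sum>n | real n < x. real (thue_morse n))"
proof -
  have pair: "real (thue_morse (2 * j)) + real (thue_morse (2 * j + 1)) = 1" for j
    unfolding thue_morse_sign using binary_digit_sum_double[of j] by (simp add: field_simps)
  have sums: "(\<Sum>n<2 * J. real (thue_morse n)) = real J" for J
  proof (induction J)
    case (Suc J)
    then show ?case using pair[of J] by simp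
  qed simp
  define J where "J = nat \<lceil>x\<rceil> div 2"
  have c: "2 \<le> nat \<lceil>x\<rceil>" "x \<le> real (nat \<lceil>x\<rceil>)" using assms by linarith+
  have "x / 3 \<le> real J"
  proof -
    have "nat \<lceil>x\<rceil> \<le> 3 * J" using c(1) unfolding J_def by linarith
    then have "real (nat \<lceil>x\<rceil>) \<le> real (3 * J)" by (rule of_nat_mono)
    with c(2) show ?thesis by simp
  qed
  also have "\<dots> = (\<Sum>n<2 * J. real (thue_morse n))" by (rule sums[symmetric])
  also have "\<dots> \<le> (\<Sum>n | real n < x. real (thue_morse n))"
  proof (rule sum_mono2)
    have eq: "{n. real n < x} = {..<nat \<lceil>x\<rceil>}" by (auto simp: less_ceiling_iff zless_nat_eq_int_zless)
    show "finite {n. real n < x}" unfolding eq by simp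
    show "{..<2 * J} \<subseteq> {n. real n < x}" unfolding eq J_def by auto
  qed simp
  finally show ?thesis .
qed

lemma max_over_le:
  assumes "finite (f ` I)" "\<And>i. i \<in> I \<Longrightarrow> f i \<le> B" "0 \<le> B"
  shows "max_over I f \<le> B"
  using assms unfolding max_over_def by auto

lemma card_progression_deviation:
  fixes y :: real
  assumes "0 < d" "a < d" "0 \<le> y"
  shows "\<bar>(\<Sum>n | real n < y \<and> [n = a] (mod d). 1) - 1 / real d * (\<Sum>n | real n < y. 1)\<bar> \<le> (1::real)"
proof -
  define u where "u = (y - real a) / real d"
  have "real a + 1 \<le> real d" using assms(2) by linarith
  then have ad: "real a / real d + 1 / real d \<le> 1" using assms(1) by (simp add: divide_le_eq flip: add_divide_distrib)
  have u: "u = y / real d - real a / real d" by (simp add: u_def diff_divide_distrib)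
  have yd: "0 \<le> y / real d" "0 < 1 / real d" "0 \<le> real a / real d" using assms by auto
  then have "- 1 < u" using u ad by linarith
  then have r1: "u \<le> real (nat \<lceil>u\<rceil>)" "real (nat \<lceil>u\<rceil>) \<le> u + 1" by linarith+
  have r2: "y \<le> real (nat \<lceil>y\<rceil>)" "real (nat \<lceil>y\<rceil>) \<le> y + 1" using assms by linarith+
  then have r3: "y / real d \<le> real (nat \<lceil>y\<rceil>) / real d" "real (nat \<lceil>y\<rceil>) / real d \<le> y / real d + 1 / real d"
    using assms by (auto simp: divide_right_mono simp flip: add_divide_distrib)
  have "(\<Sum>n | real n < y \<and> [n = a] (mod d). 1) = real (nat \<lceil>u\<rceil>)"
    using sum_progression[OF assms(1,2), where f = "\<lambda>_. 1" and y = y] by (simp add: u_def)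
  moreover have "(\<Sum>n | real n < y. 1) = real (nat \<lceil>y\<rceil>)"
    using sum_progression[of 1 0 "\<lambda>_. 1" y] by simp
  ultimately have "(\<Sum>n | real n < y \<and> [n = a] (mod d). 1) - 1 / real d * (\<Sum>n | real n < y. 1)
    = real (nat \<lceil>u\<rceil>) - real (nat \<lceil>y\<rceil>) / real d" by (simp only: mult_1 times_divide_eq_left)
  then show ?thesis using r1 r3 u ad yd unfolding abs_le_iff by linarith
qed

lemma finite_real_below: "finite {n::nat. real n < y}"
proof -
  have "{n. real n < y} = {..<nat \<lceil>y\<rceil>}" by (auto simp: less_ceiling_iff zless_nat_eq_int_zless)
  then show ?thesis by simp
qed

lemma progression_sum_le_max:
  assumes "a < d" "0 \<le> y" "y \<le> x"
  shows "\<bar>\<Sum>n | real n < y \<and> [n = a] (mod d). (-1) ^ binary_digit_sum n\<bar> \<le> progression_max x d"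
proof -
  have "\<bar>\<Sum>n | real n < y \<and> [n = a] (mod d). (-1) ^ binary_digit_sum n :: real\<bar>
    \<le> max_over {..<d} (\<lambda>a. \<bar>\<Sum>n | real n < y \<and> [n = a] (mod d). (-1) ^ binary_digit_sum n\<bar>)"
    by (rule le_max_over[where i = a]) (use assms in auto)
  also have "\<dots> \<le> progression_max x d"
    unfolding progression_max_def
    by (rule le_max_over[OF finite_progression_image, where i = y]) (use assms in auto)
  finally show ?thesis .
qed

lemma full_sum_le_max:
  assumes "0 < d" "0 \<le> y" "y \<le> x"
  shows "\<bar>\<Sum>n | real n < y. (-1) ^ binary_digit_sum n\<bar> \<le> real d * progression_max x d"
proof -
  let ?S = "{n. real n < y}"
  let ?u = "\<lambda>n. (-1) ^ binary_digit_sum n :: real"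
  have "(\<Sum>n\<in>?S. ?u n) = (\<Sum>a<d. \<Sum>n\<in>{n \<in> ?S. n mod d = a}. ?u n)"
    by (rule sum.group[symmetric]) (use assms finite_real_below in auto)
  also have "\<dots> = (\<Sum>a<d. \<Sum>n | real n < y \<and> [n = a] (mod d). ?u n)"
    by (intro sum.cong) (auto simp: Cong.cong_def)
  also have "\<bar>\<dots>\<bar> \<le> (\<Sum>a<d. \<bar>\<Sum>n | real n < y \<and> [n = a] (mod d). ?u n\<bar>)" by (rule sum_abs)
  also have "\<dots> \<le> (\<Sum>a<d. progression_max x d)"
    by (intro sum_mono progression_sum_le_max) (use assms in auto)
  finally show ?thesis by simp
qed

text \<open>
  Since \<open>t = (1 - (-1)^s) / 2\<close>, the discrepancy of \<open>t\<close> is half the difference of the discrepancies of the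
  constant sequence 1, which is at most 1, and of \<open>(-1)^s\<close>.
\<close>

lemma thue_morse_discrepancy:
  assumes "0 < d" "a < d" "0 \<le> y" "y \<le> x"
  shows "norm ((\<Sum>n | real n < y \<and> [n = a] (mod d). of_nat (thue_morse n))
      - 1 / of_nat (card {..<d}) * (\<Sum>n | real n < y \<and> n mod d \<in> {..<d}. of_nat (thue_morse n)) :: complex)
    \<le> 1 + progression_max x d"
proof -
  let ?u = "\<lambda>n. (-1) ^ binary_digit_sum n :: real"
  let ?A = "{n. real n < y \<and> [n = a] (mod d)}" and ?B = "{n. real n < y}"
  have half: "(\<Sum>n\<in>I. real (thue_morse n)) = ((\<Sum>n\<in>I. 1) - (\<Sum>n\<in>I. ?u n)) / 2" for I
    unfolding thue_morse_sign by (simp add: sum_subtractf flip: sum_divide_distrib)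
  have B: "{n. real n < y \<and> n mod d \<in> {..<d}} = ?B" using assms(1) by auto
  have "(\<Sum>n\<in>?A. of_nat (thue_morse n)) - 1 / of_nat (card {..<d}) * (\<Sum>n | real n < y \<and> n mod d \<in> {..<d}. of_nat (thue_morse n))
    = complex_of_real ((\<Sum>n\<in>?A. real (thue_morse n)) - 1 / real d * (\<Sum>n\<in>?B. real (thue_morse n)))"
    unfolding B by simp
  also have "norm \<dots> = \<bar>(\<Sum>n\<in>?A. real (thue_morse n)) - 1 / real d * (\<Sum>n\<in>?B. real (thue_morse n))\<bar>" by (rule norm_of_real)
  also have "(\<Sum>n\<in>?A. real (thue_morse n)) - 1 / real d * (\<Sum>n\<in>?B. real (thue_morse n))
    = (((\<Sum>n\<in>?A. 1) - 1 / real d * (\<Sum>n\<in>?B. 1)) - ((\<Sum>n\<in>?A. ?u n) - 1 / real d * (\<Sum>n\<in>?B. ?u n))) / 2"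
  proof -
    have "(p - q) / 2 - r * ((s - t) / 2) = ((p - r * s) - (q - r * t)) / 2" for p q r s t :: real
      by (simp add: diff_divide_distrib right_diff_distrib)
    then show ?thesis unfolding half .
  qed
  also have "\<bar>\<dots>\<bar> \<le> 1 + progression_max x d"
  proof -
    have "\<bar>\<Sum>n\<in>?B. ?u n\<bar> \<le> real d * progression_max x d" by (rule full_sum_le_max) (use assms in auto)
    then have "\<bar>1 / real d * (\<Sum>n\<in>?B. ?u n)\<bar> \<le> progression_max x d"
      using assms(1) by (simp add: abs_mult divide_le_eq mult.commute)
    moreover have "\<bar>\<Sum>n\<in>?A. ?u n\<bar> \<le> progression_max x d" by (rule progression_sum_le_max) (use assms in auto)
    moreover have "\<bar>(\<Sum>n\<in>?A. 1) - 1 / real d * (\<Sum>n\<in>?B. 1)\<bar> \<le> (1::real)"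
      by (rule card_progression_deviation) (use assms in auto)
    moreover have "\<bar>(p - (q - r)) / 2\<bar> \<le> 1 + b" if "\<bar>r\<bar> \<le> b" "\<bar>q\<bar> \<le> b" "\<bar>p\<bar> \<le> 1" for p q r b :: real
      using that by (simp add: abs_le_iff)
    ultimately show ?thesis by blast
  qed
  finally show ?thesis .
qed

lemma log_power_le_power:
  fixes \<delta> A x :: real
  assumes "0 < \<delta>" "0 < A" "1 \<le> x"
  shows "x powr (- \<delta>) \<le> 2 powr \<delta> * (A / \<delta>) powr A * ln (2 * x) powr (- A)"
proof -
  have l: "0 < ln (2 * x)" using assms by simp
  have "ln (2 * x) \<le> (2 * x) powr (\<delta> / A) / (\<delta> / A)" using assms by (intro ln_powr_bound) auto
  also have "\<dots> = (A / \<delta>) * (2 * x) powr (\<delta> / A)" by simp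
  finally have "ln (2 * x) powr A \<le> ((A / \<delta>) * (2 * x) powr (\<delta> / A)) powr A" using assms l by (intro powr_mono2) auto
  also have "\<dots> = (A / \<delta>) powr A * ((2 * x) powr (\<delta> / A)) powr A" by (rule powr_mult)
  also have "((2 * x) powr (\<delta> / A)) powr A = 2 powr \<delta> * x powr \<delta>"
    using assms by (simp add: powr_powr powr_mult)
  finally have le: "ln (2 * x) powr A \<le> (A / \<delta>) powr A * (2 powr \<delta> * x powr \<delta>)" .
  have inv: "ln (2 * x) powr A * ln (2 * x) powr (- A) = 1" "x powr \<delta> * x powr (- \<delta>) = 1"
    using assms l by (simp_all flip: powr_add)
  have "x powr (- \<delta>) = ln (2 * x) powr A * (x powr (- \<delta>) * ln (2 * x) powr (- A))"
    using inv(1) by (metis mult.left_commute mult.right_neutral)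
  also have "\<dots> \<le> (A / \<delta>) powr A * (2 powr \<delta> * x powr \<delta>) * (x powr (- \<delta>) * ln (2 * x) powr (- A))"
    using le by (rule mult_right_mono) simp
  also have "\<dots> = 2 powr \<delta> * (A / \<delta>) powr A * ln (2 * x) powr (- A) * (x powr \<delta> * x powr (- \<delta>))"
    by (simp only: mult_ac)
  finally show ?thesis unfolding inv(2) by simp
qed

text \<open>
  A power saving beats every power of the logarithm, and the sum of \<open>t\<close> up to \<open>x\<close> is at least \<open>x / 3\<close> for
  \<open>x > 1\<close>. For \<open>x = 1\<close> that sum vanishes, but then \<open>d = 1\<close> is the only modulus and its discrepancy is 0.
\<close>

lemma thue_morse_level_of_distribution:
  "level_of_distribution (\<lambda>n. of_nat (thue_morse n)) 1 (\<lambda>d. {..<d}) (\<lambda>d. {..<d})"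
proof -
  let ?E = "\<lambda>d y a. norm ((\<Sum>n | real n < y \<and> [n = a] (mod d). of_nat (thue_morse n))
      - 1 / of_nat (card {..<d}) * (\<Sum>n | real n < y \<and> n mod d \<in> {..<d}. of_nat (thue_morse n)) :: complex)"
  let ?T = "\<lambda>x d. max_over {0..x} (\<lambda>y. max_over {a. a < d \<and> a \<in> {..<d}} (?E d y))"
  have E1: "?E 1 y 0 = 0" for y :: real by simp
  have fin_in: "finite (?E d y ` {a. a < d \<and> a \<in> {..<d}})" for d y by simp
  have fin_out: "finite ((\<lambda>y. max_over {a. a < d \<and> a \<in> {..<d}} (?E d y)) ` {0..x})" for d x
    by (rule finite_image_real_cutoff[where F = "\<lambda>S. max_over {a. a < d \<and> a \<in> {..<d}} (\<lambda>a. norm ((\<Sum>n | n \<in> S \<and> [n = a] (mod d). of_nat (thue_morse n))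
      - 1 / of_nat (card {..<d}) * (\<Sum>n | n \<in> S \<and> n mod d \<in> {..<d}. of_nat (thue_morse n)) :: complex))"]) simp
  have T: "?T x d \<le> 1 + progression_max x d" if "1 \<le> d" "0 \<le> x" for x d
    using that progression_max_bounds(1)[of d x]
    by (intro max_over_le fin_in fin_out thue_morse_discrepancy) auto
  have T1: "?T x 1 \<le> 0" for x
    by (intro max_over_le fin_in fin_out) (use E1 in auto)
  show ?thesis
    unfolding level_of_distribution_def
  proof (intro conjI allI impI)
    fix d :: nat assume "1 \<le> d"
    then show "{..<d} \<noteq> {}" "{..<d} \<subseteq> {..<d}" "{..<d} \<subseteq> {..<d}" by (auto simp: lessThan_empty_iff)
  next
    fix \<epsilon> A :: real assume \<epsilon>: "0 < \<epsilon>" and A: "0 < A"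
    obtain \<eta> C where \<eta>: "0 < \<eta>" and C: "0 < C" and bound:
      "\<And>x. 1 \<le> x \<Longrightarrow> (\<Sum>d | 1 \<le> d \<and> real d \<le> x powr (1 - \<epsilon>). progression_max x d) \<le> C * x powr (1 - \<eta>)"
      using progression_max_sum_decay[OF \<epsilon>] by blast
    define \<delta> where "\<delta> = min \<epsilon> \<eta>"
    have \<delta>: "0 < \<delta>" "\<delta> \<le> \<epsilon>" "\<delta> \<le> \<eta>" using \<epsilon> \<eta> by (auto simp: \<delta>_def)
    define C' where "C' = 3 * (1 + C) * (2 powr \<delta> * (A / \<delta>) powr A)"
    have C'0: "0 \<le> C'" using C by (simp add: C'_def)
    have "(\<Sum>d | 1 \<le> d \<and> real d \<le> x powr (1 - \<epsilon>). ?T x d) \<le> C' * (\<Sum>n | real n < x. norm (of_nat (thue_morse n) :: complex)) * ln (2 * x) powr (- A)"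
      if x: "1 \<le> x" for x :: real
    proof (cases "x = 1")
      case True
      have "{d::nat. 1 \<le> d \<and> real d \<le> x powr (1 - \<epsilon>)} = {1}" using True by auto
      then have "(\<Sum>d | 1 \<le> d \<and> real d \<le> x powr (1 - \<epsilon>). ?T x d) = ?T x 1" by simp
      also have "\<dots> \<le> 0" by (rule T1)
      also have "0 \<le> C' * (\<Sum>n | real n < x. norm (of_nat (thue_morse n) :: complex)) * ln (2 * x) powr (- A)"
        using C'0 by (intro mult_nonneg_nonneg sum_nonneg) auto
      finally show ?thesis .
    next
      case False
      let ?S = "{d::nat. 1 \<le> d \<and> real d \<le> x powr (1 - \<epsilon>)}"
      have "(\<Sum>d\<in>?S. ?T x d) \<le> (\<Sum>d\<in>?S. 1 + progression_max x d)"
        using x by (intro sum_mono T) auto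
      also have "\<dots> = real (card ?S) + (\<Sum>d\<in>?S. progression_max x d)" by (simp add: sum.distrib)
      also have "\<dots> \<le> x powr (1 - \<epsilon>) + C * x powr (1 - \<eta>)"
        using card_real_below(2)[of "x powr (1 - \<epsilon>)"] by (intro add_mono bound x) simp
      also have "\<dots> \<le> x powr (1 - \<delta>) + C * x powr (1 - \<delta>)"
        using x \<delta> C by (intro add_mono mult_left_mono powr_mono) auto
      also have "\<dots> = (1 + C) * x * x powr (- \<delta>)"
        using powr_add[of x 1 "- \<delta>"] x by (simp add: algebra_simps)
      also have "\<dots> \<le> (1 + C) * x * (2 powr \<delta> * (A / \<delta>) powr A * ln (2 * x) powr (- A))"
        using C x by (intro mult_left_mono log_power_le_power \<delta> A) auto
      also have "\<dots> = C' * (x / 3) * ln (2 * x) powr (- A)" by (simp add: C'_def)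
      also have "\<dots> \<le> C' * (\<Sum>n | real n < x. norm (of_nat (thue_morse n) :: complex)) * ln (2 * x) powr (- A)"
        using C'0 sum_thue_morse_lower[of x] x False by (intro mult_right_mono mult_left_mono) auto
      finally show ?thesis .
    qed
    then show "\<exists>C'. \<forall>x\<ge>1. (\<Sum>d | 1 \<le> d \<and> real d \<le> x powr (1 - \<epsilon>). ?T x d)
        \<le> C' * (\<Sum>n | real n < x. norm (of_nat (thue_morse n) :: complex)) * ln (2 * x) powr (- A)" by blast
  qed
qed

theorem theorem1p1:
  shows "level_of_distribution (\<lambda>n. of_nat (thue_morse n)) 1 (\<lambda>d. {..<d}) (\<lambda>d. {..<d}) \<and>
    (\<forall>\<epsilon>::real. \<epsilon> > 0 \<longrightarrow> (\<exists>\<eta>>0. \<exists>C>0. \<forall>x::real. x \<ge> 1 \<longrightarrow>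
       (\<Sum>d::nat | 1 \<le> d \<and> real d \<le> x powr (1 - \<epsilon>).
          max_over {0..x} (\<lambda>y.
            max_over {..<d} (\<lambda>a.
              \<bar>\<Sum>n | real n < y \<and> [n = a] (mod d). (-1) ^ binary_digit_sum n\<bar>)))
       \<le> C * x powr (1 - \<eta>)))"
  using thue_morse_level_of_distribution progression_max_sum_decay unfolding progression_max_def by blast

end
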